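(* Let $k\geq 4$ be an integer. Then $\mathrm{ex}(n, K_{C_k,1}^{\mathrm{sub}})=\Theta(n^{4/3})$; that is, there exist constants $c,C>0$ (depending only on $k$) such that $c\,n^{4/3}\le \mathrm{ex}(n, K_{C_k,1}^{\mathrm{sub}})\le C\,n^{4/3}$ for all sufficiently large $n$.
   Context: For a graph $F$, $\mathrm{ex}(n,F)$ denotes the maximum number of edges in an $n$-vertex graph containing no (not necessarily induced) subgraph isomorphic to $F$. For a graph $H$, its $1$-subdivision $H^{\mathrm{sub}}$ is the graph obtained by replacing every edge of $H$ by a path of length two (each edge gets its own new middle vertex). $C_k$ denotes the cycle on $k$ vertices, and $K_{C_k,1}$ is the graph obtained from $C_k$ by adding one new vertex adjacent to every vertex of the cycle. *)

theory Defs
  imports Complex_Main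
begin

type_synonym 'a graph = "'a set \<times> 'a set set"

abbreviation verts :: "'a graph \<Rightarrow> 'a set" where
  "verts G \<equiv> fst G"

abbreviation edges :: "'a graph \<Rightarrow> 'a set set" where
  "edges G \<equiv> snd G"

definition finite_simple_graph :: "'a graph \<Rightarrow> bool" where
  "finite_simple_graph G \<longleftrightarrow>
     finite (verts G) \<and> (\<forall>e\<in>edges G. e \<subseteq> verts G \<and> card e = 2)"

definition subgraph :: "'a graph \<Rightarrow> 'a graph \<Rightarrow> bool" where
  "subgraph H G \<longleftrightarrow>
     finite_simple_graph H \<and> verts H \<subseteq> verts G \<and> edges H \<subseteq> edges G"

definition isomorphic :: "'a graph \<Rightarrow> 'b graph \<Rightarrow> bool" where
  "isomorphic G H \<longleftrightarrow>
     (\<exists>f. bij_betw f (verts G) (verts H) \<and> (\<lambda>e. f ` e) ` edges G = edges H)"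

definition contains_copy :: "'a graph \<Rightarrow> 'b graph \<Rightarrow> bool" where
  "contains_copy G F \<longleftrightarrow> (\<exists>H. subgraph H G \<and> isomorphic H F)"

text \<open>
  Every \<open>n\<close>-vertex graph is isomorphic to one with vertices in \<open>nat\<close>, so ranging over
  graphs on finite sets of naturals loses nothing. The set below is finite (each value is at most
  \<open>n choose 2\<close>), and it contains \<open>0\<close> whenever \<open>F\<close> has an edge.
\<close>

definition ex :: "nat \<Rightarrow> 'b graph \<Rightarrow> nat" where
  "ex n F = Max {card (edges G) | G :: nat graph.
     finite_simple_graph G \<and> card (verts G) = n \<and> \<not> contains_copy G F}"

text \<open>The middle vertex of the path replacing the edge \<open>e\<close> is \<open>Inr e\<close>.\<close>

definition subdivision1 :: "'a graph \<Rightarrow> ('a + 'a set) graph" where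
  "subdivision1 H =
     (Inl ` verts H \<union> Inr ` edges H, {{Inl v, Inr e} | v e. e \<in> edges H \<and> v \<in> e})"

text \<open>A cycle only for \<open>k \<ge> 3\<close>.\<close>

definition cycle_graph :: "nat \<Rightarrow> nat graph" where
  "cycle_graph k = ({..<k}, {{i, Suc i mod k} | i. i < k})"

text \<open>The new vertex, adjacent to all old ones, is \<open>None\<close>.\<close>

definition add_apex :: "'a graph \<Rightarrow> 'a option graph" where
  "add_apex G =
     (insert None (Some ` verts G),
      (\<lambda>e. Some ` e) ` edges G \<union> {{None, Some v} | v. v \<in> verts G})"

end

theory Submission
  imports Defs "HOL-Library.Ramsey" "HOL-Algebra.Algebraic_Closure_Type" "HOL-Library.Z2"
begin

text \<open>
  Lower bound: the subdivided wheel contains a hexagon, and the Wenger graph over the field with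
  \<open>q = 2\<^sup>m\<close> elements (points \<open>(a, b, c)\<close>, lines \<open>(x, y, z)\<close>, incidence \<open>b + y = a x\<close>, \<open>c + z = a y\<close>)
  has \<open>2 q\<^sup>3\<close> vertices, \<open>q\<^sup>4\<close> edges and no hexagon, by a Vandermonde argument.

  Upper bound: pass to an almost regular subgraph with degrees about \<open>\<Delta>\<close> and suppose that \<open>\<Delta>\<^sup>3\<close> is much
  larger than the number \<open>n\<close> of vertices. Call two vertices a heavy pair if they have at least \<open>3 k + 1\<close>
  common neighbours and a light pair otherwise. The heavy pairs form a graph without \<open>K\<^sub>k\<^sub>+\<^sub>1\<close>, as this would
  extend greedily to the subdivided wheel; so there are of order \<open>n \<Delta>\<^sup>3\<close> light paths, that is, paths of
  length three all of whose pairs at distance two are light. For a hub \<open>v\<close> one looks for the rim, a cycle of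
  length \<open>2 k\<close> alternating between the second neighbourhood of \<open>v\<close> (at most \<open>\<Delta>\<^sup>2\<close> vertices \<open>u\<close>, each with
  a spoke vertex \<open>p\<close> between \<open>v\<close> and \<open>u\<close>) and other vertices \<open>b\<close>, with distinct spoke vertices. Exploring
  from a rim vertex \<open>x\<close> through \<open>x, b', u', b, u\<close> gives more than \<open>\<Delta>\<^sup>2\<close> walks, so that some \<open>u\<close> are reached
  many times. In the bipartite graph between the walks \<open>b', u', b\<close> and their ends \<open>u\<close>, both sides then have
  large minimum degree (after cleaning), and a zigzag path of any prescribed length can be chosen greedily;
  closing it up at the place where the first and the last walk branch gives the rim. The exploration uses
  four levels, which is why \<open>k \<ge> 4\<close> is needed. The spoke vertices of branching walks are distinct provided
  that no pair \<open>(x, p')\<close> is joined by too many light paths. To guarantee this, count hexagons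
  \<open>v, p, x, b', u', p'\<close> with \<open>Q\<close> to \<open>4 Q\<close> light paths from \<open>x\<close> to \<open>p'\<close>, where \<open>Q\<close> maximises \<open>Q F(Q)\<^sup>2\<close> and
  \<open>F(Q)\<close> is the number of light paths whose ends are joined by at least \<open>Q\<close> of them.
\<close>

section \<open>Counting and greedy choices\<close>

lemma card_eq_sum_fibres: "finite A \<Longrightarrow> card A = (\<Sum>y\<in>f ` A. card {a \<in> A. f a = y})"
  unfolding card_eq_sum by (rule sum.image_gen)

lemma card_le_fibres:
  fixes m :: "'c :: linordered_semidom"
  assumes "finite A" "\<And>y. y \<in> f ` A \<Longrightarrow> of_nat (card {a \<in> A. f a = y}) \<le> m"
  shows "of_nat (card A) \<le> of_nat (card (f ` A)) * m"
  unfolding card_eq_sum_fibres[OF assms(1), of f]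
  using sum_bounded_above[of "f ` A" "\<lambda>y. of_nat (card {a \<in> A. f a = y})" m] assms(2) by simp

lemma card_ge_fibres:
  fixes m :: "'c :: linordered_semidom"
  assumes "finite A" "\<And>y. y \<in> f ` A \<Longrightarrow> m \<le> of_nat (card {a \<in> A. f a = y})"
  shows "of_nat (card (f ` A)) * m \<le> of_nat (card A)"
  unfolding card_eq_sum_fibres[OF assms(1), of f]
  using sum_bounded_below[of "f ` A" m "\<lambda>y. of_nat (card {a \<in> A. f a = y})"] assms(2) by simp

lemma exists_large_fibre:
  fixes m :: "'c :: linordered_semidom"
  assumes "finite A" "of_nat (card (f ` A)) * m < of_nat (card A)"
  obtains y where "m < of_nat (card {a \<in> A. f a = y})"
  using card_le_fibres[OF assms(1), of f m] assms(2) by (meson not_less)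

definition crowded :: "('a \<Rightarrow> 'b) \<Rightarrow> 'c :: linordered_semidom \<Rightarrow> 'a set \<Rightarrow> 'a set" where
  "crowded f m A = {a \<in> A. m < of_nat (card {a' \<in> A. f a' = f a})}"

lemma crowded_subset: "crowded f m A \<subseteq> A"
  by (auto simp: crowded_def)

lemma card_fibre_not_crowded_le:
  fixes m :: "'c :: linordered_semidom"
  assumes "finite A" "0 \<le> m"
  shows "of_nat (card {a \<in> A - crowded f m A. f a = y}) \<le> m"
proof (cases "{a \<in> A - crowded f m A. f a = y} = {}")
  case False
  then obtain a where a: "a \<in> A - crowded f m A" "f a = y" by blast
  have "card {a' \<in> A - crowded f m A. f a' = y} \<le> card {a' \<in> A. f a' = f a}"
    using assms(1) a(2) by (intro card_mono) auto
  then have "of_nat (card {a' \<in> A - crowded f m A. f a' = y}) \<le> (of_nat (card {a' \<in> A. f a' = f a}) :: 'c)"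
    by (rule of_nat_mono)
  also have "\<dots> \<le> m" using a by (auto simp: crowded_def)
  finally show ?thesis .
next
  case True
  then show ?thesis unfolding True using assms(2) by simp
qed

lemma card_image_crowded_le:
  assumes "finite A"
  shows "of_nat (card (f ` crowded f m A)) * m \<le> of_nat (card (crowded f m A))"
proof (rule card_ge_fibres)
  fix y assume "y \<in> f ` crowded f m A"
  then obtain a where a: "a \<in> crowded f m A" "y = f a" by blast
  then have "{a' \<in> crowded f m A. f a' = y} = {a' \<in> A. f a' = f a}" by (auto simp: crowded_def)
  moreover have "m < of_nat (card {a' \<in> A. f a' = f a})" using a(1) by (simp add: crowded_def)
  ultimately show "m \<le> of_nat (card {a' \<in> crowded f m A. f a' = y})" by (simp only: less_imp_le)
qed (use assms in \<open>simp add: crowded_def\<close>)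

lemma card_not_crowded_le:
  assumes "finite A" "0 \<le> m"
  shows "of_nat (card (A - crowded f m A)) \<le> of_nat (card (f ` A)) * m"
proof -
  have "of_nat (card (A - crowded f m A)) \<le> of_nat (card (f ` (A - crowded f m A))) * m"
    using assms(1) by (intro card_le_fibres card_fibre_not_crowded_le[OF assms] finite_Diff)
  also have "\<dots> \<le> of_nat (card (f ` A)) * m"
    using assms by (intro mult_right_mono of_nat_mono card_mono) auto
  finally show ?thesis .
qed

lemma card_le_image_Sigma:
  assumes "A \<subseteq> g ` Sigma I B" "finite I" "card I \<le> m" "\<And>i. i \<in> I \<Longrightarrow> finite (B i) \<and> card (B i) \<le> n"
  shows "card A \<le> m * n"
proof -
  have "card A \<le> card (Sigma I B)"
    using assms by (intro surj_card_le[of _ _ g]) auto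
  also have "\<dots> = (\<Sum>i\<in>I. card (B i))"
    using assms by (intro card_SigmaI) auto
  also have "\<dots> \<le> card I * n"
    using sum_bounded_above[of I "\<lambda>i. card (B i)" n] assms(4) by simp
  also have "\<dots> \<le> m * n"
    using assms(3) by (rule mult_le_mono1)
  finally show ?thesis .
qed

lemma card_Sigma_ge:
  assumes "finite I" "\<And>i. i \<in> I \<Longrightarrow> finite (B i) \<and> m \<le> card (B i)"
  shows "card I * m \<le> card (Sigma I B)"
proof -
  have "card I * m \<le> (\<Sum>i\<in>I. card (B i))"
    using sum_bounded_below[of I m "\<lambda>i. card (B i)"] assms(2) by simp
  also have "\<dots> = card (Sigma I B)" using assms by (intro card_SigmaI[symmetric]) auto
  finally show ?thesis .
qed

lemma card_distinct_pairs_ge: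
  assumes "finite A" "finite B" "d \<le> card A" "d \<le> card B"
  shows "d * (d - 1) \<le> card (SIGMA a:A. B - {a})"
proof -
  have "d - 1 \<le> card (B - {a})" for a
    using assms(2,4) by (cases "a \<in> B") auto
  then have "card A * (d - 1) \<le> card (SIGMA a:A. B - {a})"
    using assms(1,2) by (intro card_Sigma_ge) auto
  moreover have "d * (d - 1) \<le> card A * (d - 1)" using assms(3) by (rule mult_le_mono1)
  ultimately show ?thesis by linarith
qed

lemma card_eq_card_plus_card_Diff: "finite A \<Longrightarrow> B \<subseteq> A \<Longrightarrow> card A = card B + card (A - B)"
  by (metis card_Diff_subset card_mono finite_subset le_add_diff_inverse)

lemma exists_small_fibres:
  assumes U: "finite U" and s: "0 < s"
  obtains g :: "'a \<Rightarrow> nat" where "\<And>w. w \<in> U \<Longrightarrow> g w \<le> card U div s" "\<And>i. card {w \<in> U. g w = i} \<le> s"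
proof -
  obtain h where h: "bij_betw h U {..<card U}"
    using ex_bij_betw_finite_nat[OF U] by (auto simp: atLeast0LessThan)
  have "h w div s \<le> card U div s" if "w \<in> U" for w
    using bij_betw_apply[OF h that] by (intro div_le_mono) simp
  moreover have "card {w \<in> U. h w div s = i} \<le> s" for i
  proof -
    have "inj_on h {w \<in> U. h w div s = i}" using h by (auto simp: bij_betw_def inj_on_def)
    moreover have "h ` {w \<in> U. h w div s = i} \<subseteq> {i * s..<i * s + s}"
      using s by (auto simp: div_times_less_eq_dividend dividend_less_div_times add.commute)
    ultimately have "card {w \<in> U. h w div s = i} \<le> card {i * s..<i * s + s}"
      by (rule card_inj_on_le) simp
    then show ?thesis by simp
  qed
  ultimately show thesis by (rule that)
qed

lemma exists_avoiding:
  assumes "finite U" "\<And>z. z \<in> U \<Longrightarrow> card {y \<in> B. z \<in> V y} \<le> a" "card U * a < card B"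
  shows "\<exists>y\<in>B. V y \<inter> U = {}"
proof (rule ccontr)
  assume "\<not> ?thesis"
  then have "B = (\<Union>z\<in>U. {y \<in> B. z \<in> V y})" by blast
  then have "card B \<le> (\<Sum>z\<in>U. card {y \<in> B. z \<in> V y})"
    using assms(1) by (metis card_UN_le)
  also have "\<dots> \<le> card U * a"
    using sum_bounded_above[of U "\<lambda>z. card {y \<in> B. z \<in> V y}" a] assms(2) by simp
  finally show False using assms(3) by simp
qed

lemma exists_pairwise_unrelated:
  assumes "finite S" and ball: "\<And>z. z \<in> S \<Longrightarrow> card {w \<in> S. R z w} \<le> d"
    and refl: "\<And>z. z \<in> S \<Longrightarrow> R z z" and sym: "\<And>z w. R z w \<Longrightarrow> R w z"
    and "n * d < card S"
  shows "\<exists>T\<subseteq>S. card T = Suc n \<and> (\<forall>z\<in>T. \<forall>w\<in>T. z \<noteq> w \<longrightarrow> \<not> R z w)"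
  using assms(5)
proof (induction n)
  case 0
  then obtain z where "z \<in> S" by fastforce
  then show ?case by (intro exI[of _ "{z}"]) auto
next
  case (Suc n)
  then obtain T where T: "T \<subseteq> S" "card T = Suc n" "\<forall>z\<in>T. \<forall>w\<in>T. z \<noteq> w \<longrightarrow> \<not> R z w"
    by fastforce
  have "finite T" using T(1) assms(1) finite_subset by blast
  have "\<exists>s\<in>S. {z. R z s} \<inter> T = {}"
    by (rule exists_avoiding[OF \<open>finite T\<close>, of _ _ d]) (use ball T Suc.prems in auto)
  then obtain s where s: "s \<in> S" "\<And>z. z \<in> T \<Longrightarrow> \<not> R z s" by blast
  have "s \<notin> T" using s refl by blast
  then show ?case
    using T s \<open>finite T\<close> by (intro exI[of _ "insert s T"]) (auto dest: sym)
qed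

lemma exists_distinct_representatives:
  assumes "finite I" "finite T" "\<And>i. i \<in> I \<Longrightarrow> card T + card I \<le> card (W i)"
  shows "\<exists>c. (\<forall>i\<in>I. c i \<in> W i - T) \<and> inj_on c I"
  using assms
proof (induction I rule: finite_induct)
  case (insert i I)
  then have "\<And>j. j \<in> I \<Longrightarrow> card T + card I \<le> card (W j)" by fastforce
  with insert obtain c where c: "\<forall>j\<in>I. c j \<in> W j - T" "inj_on c I" by blast
  have "card (T \<union> c ` I) \<le> card T + card I"
    using card_Un_le[of T "c ` I"] card_image_le[OF insert.hyps(1), of c] by linarith
  also have "\<dots> < card (W i)" using insert.prems(2)[of i] insert.hyps by simp
  finally have "\<not> W i \<subseteq> T \<union> c ` I"
    using card_mono[of "T \<union> c ` I" "W i"] insert by auto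
  then obtain y where "y \<in> W i - T" "y \<notin> c ` I" by blast
  then show ?case
    using c insert.hyps(2) by (intro exI[of _ "c(i := y)"]) (auto simp: inj_on_def)
qed auto

text \<open>A subset of \<open>E\<close> minimal for the inequality works: deleting a small fibre would preserve it.\<close>

lemma exists_subset_with_large_fibres:
  assumes "finite E" "A * card (f ` E) + B * card (g ` E) < card E"
  obtains E' where "E' \<subseteq> E" "E' \<noteq> {}"
    "\<And>e. e \<in> E' \<Longrightarrow> A < card {e' \<in> E'. f e' = f e}"
    "\<And>e. e \<in> E' \<Longrightarrow> B < card {e' \<in> E'. g e' = g e}"
proof -
  define heavy where "heavy J \<longleftrightarrow> A * card (f ` J) + B * card (g ` J) < card J" for J
  obtain J where J: "J \<subseteq> E" "heavy J" and min: "\<And>Y. Y \<subseteq> E \<Longrightarrow> heavy Y \<Longrightarrow> card J \<le> card Y"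
    using ex_has_least_nat[of "\<lambda>J. J \<subseteq> E \<and> heavy J" E card] assms(2) by (auto simp: heavy_def)
  have "finite J" using J(1) assms(1) finite_subset by blast
  have large: "a < card {e' \<in> J. h e' = h e}"
    if e: "e \<in> J" and h: "\<And>Y. heavy Y \<longleftrightarrow> a * card (h ` Y) + b * card (h' ` Y) < card Y" for h h' e a b
  proof (rule ccontr)
    assume small: "\<not> ?thesis"
    define Y where "Y = {e' \<in> J. h e' \<noteq> h e}"
    have "Y \<subset> J" using e by (auto simp: Y_def)
    then have "card Y < card J" using \<open>finite J\<close> by (rule psubset_card_mono[rotated])
    have "h ` Y = h ` J - {h e}" by (auto simp: Y_def)
    then have "card (h ` J) = Suc (card (h ` Y))"
      using \<open>finite J\<close> e card.remove[of "h ` J" "h e"] by simp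
    moreover have "b * card (h' ` Y) \<le> b * card (h' ` J)"
      using \<open>finite J\<close> \<open>Y \<subset> J\<close> by (intro mult_le_mono2 card_mono) auto
    moreover have "J - Y = {e' \<in> J. h e' = h e}" by (auto simp: Y_def)
    then have "card J \<le> card Y + a"
      using card_eq_card_plus_card_Diff[OF \<open>finite J\<close>, of Y] \<open>Y \<subset> J\<close> small by auto
    ultimately have "heavy Y" using J(2) unfolding h by (simp only: mult_Suc_right)
    moreover have "Y \<subseteq> E" using J(1) \<open>Y \<subset> J\<close> by blast
    ultimately show False using min[of Y] \<open>card Y < card J\<close> by simp
  qed
  show ?thesis
  proof (rule that[OF J(1)])
    show "J \<noteq> {}" using J(2) by (auto simp: heavy_def)
    show "A < card {e' \<in> J. f e' = f e}" if "e \<in> J" for e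
      by (rule large[OF that, of A f B g]) (simp add: heavy_def)
    show "B < card {e' \<in> J. g e' = g e}" if "e \<in> J" for e
      by (rule large[OF that, of B g A f]) (simp add: heavy_def add.commute)
  qed
qed

definition ramsey_number :: "nat \<Rightarrow> nat" where
  "ramsey_number m = (LEAST r. \<forall>E :: nat set set. \<exists>R\<subseteq>{..<r}. card R = m \<and> (clique R E \<or> indep R E))"

lemma ramsey_number_nat: "\<exists>R\<subseteq>{..<ramsey_number m}. card R = m \<and> (clique R E \<or> indep R E)"
proof -
  obtain r where "\<forall>(V :: nat set) E. finite V \<and> r \<le> card V \<longrightarrow>
      (\<exists>R\<subseteq>V. card R = m \<and> clique R E \<or> card R = m \<and> indep R E)"
    using ramsey2[of m m] by blast
  then have "\<forall>E. \<exists>R\<subseteq>{..<r}. card R = m \<and> (clique R E \<or> indep R E)"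
    by (intro allI) (drule spec[of _ "{..<r}"], auto)
  then have "\<forall>E. \<exists>R\<subseteq>{..<ramsey_number m}. card R = m \<and> (clique R E \<or> indep R E)"
    unfolding ramsey_number_def by (rule LeastI)
  then show ?thesis by blast
qed

lemma le_ramsey_number: "m \<le> ramsey_number m"
proof -
  obtain R where "R \<subseteq> {..<ramsey_number m}" "card R = m" using ramsey_number_nat by blast
  then show ?thesis using card_mono[of "{..<ramsey_number m}" R] by simp
qed

lemma ramsey_relation:
  assumes "finite T" "ramsey_number m \<le> card T" and sym: "\<And>z w. H z w \<longleftrightarrow> H w z"
  shows "\<exists>R\<subseteq>T. card R = m \<and>
    ((\<forall>z\<in>R. \<forall>w\<in>R. z \<noteq> w \<longrightarrow> H z w) \<or> (\<forall>z\<in>R. \<forall>w\<in>R. z \<noteq> w \<longrightarrow> \<not> H z w))"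
proof -
  obtain h where h: "inj_on h {..<ramsey_number m}" "h ` {..<ramsey_number m} \<subseteq> T"
    using card_le_inj[of "{..<ramsey_number m}" T] assms(1,2) by auto
  define E where "E = {{i, j} | i j. H (h i) (h j)}"
  have E: "{i, j} \<in> E \<longleftrightarrow> H (h i) (h j)" for i j
    using sym by (auto simp: E_def doubleton_eq_iff)
  obtain R where R: "R \<subseteq> {..<ramsey_number m}" "card R = m" "clique R E \<or> indep R E"
    using ramsey_number_nat by blast
  have "inj_on h R" using h(1) R(1) by (rule inj_on_subset)
  then have "card (h ` R) = m" using R(2) by (simp add: card_image)
  moreover have "(\<forall>z\<in>h ` R. \<forall>w\<in>h ` R. z \<noteq> w \<longrightarrow> H z w) \<or> (\<forall>z\<in>h ` R. \<forall>w\<in>h ` R. z \<noteq> w \<longrightarrow> \<not> H z w)"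
    using R(3) by (auto simp: clique_def indep_def E)
  ultimately show ?thesis using h(2) R(1) by (intro exI[of _ "h ` R"]) auto
qed

definition tail_sum :: "('i \<Rightarrow> nat) \<Rightarrow> 'i set \<Rightarrow> nat \<Rightarrow> nat" where
  "tail_sum q I Q = (\<Sum>i | i \<in> I \<and> Q \<le> q i. q i)"

lemma tail_sum_split:
  assumes "finite I" "Q \<le> R"
  shows "tail_sum q I Q = (\<Sum>i | i \<in> I \<and> Q \<le> q i \<and> q i < R. q i) + tail_sum q I R"
proof -
  have "{i. i \<in> I \<and> Q \<le> q i} = {i. i \<in> I \<and> Q \<le> q i \<and> q i < R} \<union> {i. i \<in> I \<and> R \<le> q i}"
    using assms(2) by auto
  moreover have "{i. i \<in> I \<and> Q \<le> q i \<and> q i < R} \<inter> {i. i \<in> I \<and> R \<le> q i} = {}" by auto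
  ultimately show ?thesis unfolding tail_sum_def using assms(1) by (simp add: sum.union_disjoint)
qed

lemma sum_le_tail_sum: "finite I \<Longrightarrow> sum q I \<le> card I * Q + tail_sum q I Q"
proof -
  assume "finite I"
  have "sum q I = (\<Sum>i | i \<in> I \<and> q i < Q. q i) + tail_sum q I Q"
    using tail_sum_split[OF \<open>finite I\<close>, of 0 Q q] by (simp add: tail_sum_def)
  moreover have "(\<Sum>i | i \<in> I \<and> q i < Q. q i) \<le> card {i. i \<in> I \<and> q i < Q} * Q"
    using sum_bounded_above[of "{i. i \<in> I \<and> q i < Q}" q Q] by simp
  moreover have "card {i. i \<in> I \<and> q i < Q} * Q \<le> card I * Q"
    using \<open>finite I\<close> by (intro mult_le_mono1 card_mono) auto
  ultimately show ?thesis by linarith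
qed

text \<open>At a maximum of \<open>Q F(Q)\<^sup>2\<close>, where \<open>F\<close> is the tail sum, one has \<open>2 F(4 Q) \<le> F(Q)\<close>.\<close>

lemma exists_dyadic_level:
  assumes "finite I" "0 < Q0"
  obtains Q where "Q0 \<le> Q" "Q0 * (tail_sum q I Q0)\<^sup>2 \<le> Q * (tail_sum q I Q)\<^sup>2"
    "tail_sum q I Q \<le> 2 * (\<Sum>i | i \<in> I \<and> Q \<le> q i \<and> q i < 4 * Q. q i)"
proof -
  define F where "F = tail_sum q I"
  have F_le: "F Q \<le> sum q I" for Q
    unfolding F_def tail_sum_def using assms(1) by (intro sum_mono2) auto
  have F_zero: "F Q = 0" if "sum q I < Q" for Q
  proof -
    have "q i < Q" if "i \<in> I" for i
      using member_le_sum[of i I q] assms(1) that \<open>sum q I < Q\<close> by simp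
    then show ?thesis by (auto simp: F_def tail_sum_def not_le intro!: sum.neutral dest: leD)
  qed
  have "Q * (F Q)\<^sup>2 < Suc (sum q I * (sum q I)\<^sup>2)" for Q
  proof (cases "Q \<le> sum q I")
    case True
    then show ?thesis unfolding less_Suc_eq_le by (intro mult_le_mono power_mono F_le) auto
  qed (simp add: F_zero)
  then obtain Q where Q: "Q0 \<le> Q" "\<And>Q'. Q0 \<le> Q' \<Longrightarrow> Q' * (F Q')\<^sup>2 \<le> Q * (F Q)\<^sup>2"
    using Lattices_Big.ex_has_greatest_nat[of "\<lambda>Q. Q0 \<le> Q" Q0 "\<lambda>Q. Q * (F Q)\<^sup>2"] by blast
  have "Q * (2 * F (4 * Q))\<^sup>2 \<le> Q * (F Q)\<^sup>2" using Q(2)[of "4 * Q"] Q(1) by (simp add: power_mult_distrib)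
  then have "2 * F (4 * Q) \<le> F Q" using Q(1) assms(2) by (auto intro: power2_le_imp_le)
  moreover have "F Q = (\<Sum>i | i \<in> I \<and> Q \<le> q i \<and> q i < 4 * Q. q i) + F (4 * Q)"
    unfolding F_def by (rule tail_sum_split[OF assms(1)]) simp
  ultimately have "F Q \<le> 2 * (\<Sum>i | i \<in> I \<and> Q \<le> q i \<and> q i < 4 * Q. q i)" by linarith
  then show thesis using that Q(1) Q(2)[of Q0] by (simp add: F_def)
qed

section \<open>Subdivided wheels from walks around a hub\<close>

text \<open>The hub is \<open>v\<close>, the vertices of the rim are \<open>a i\<close>; \<open>p i\<close> and \<open>b i\<close> subdivide the spokes and
  the edges of the rim.\<close>

definition has_wheel :: "('a \<Rightarrow> 'a \<Rightarrow> bool) \<Rightarrow> nat \<Rightarrow> bool" where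
  "has_wheel adj k \<longleftrightarrow> (\<exists>v a p b.
     (\<forall>i<k. adj v (p i) \<and> adj (p i) (a i) \<and> adj (a i) (b i) \<and> adj (b i) (a (Suc i mod k))) \<and>
     distinct (v # map a [0..<k] @ map p [0..<k] @ map b [0..<k]))"

lemma distinct_wheel_iff:
  "distinct (v # map a [0..<k] @ map p [0..<k] @ map b [0..<k]) \<longleftrightarrow>
    (\<forall>i<k. v \<noteq> a i \<and> v \<noteq> p i \<and> v \<noteq> b i) \<and>
    (\<forall>i<k. \<forall>j<k. a i \<noteq> p j \<and> a i \<noteq> b j \<and> p i \<noteq> b j) \<and>
    inj_on a {..<k} \<and> inj_on p {..<k} \<and> inj_on b {..<k}"
proof -
  have "f ` {..<k} \<inter> g ` {..<k} = {} \<longleftrightarrow> (\<forall>i<k. \<forall>j<k. f i \<noteq> g j)" for f g :: "nat \<Rightarrow> 'a"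
    by blast
  then show ?thesis
    by (auto simp: distinct_map atLeast0LessThan Int_Un_distrib)
qed

text \<open>The rim of a subdivided wheel is a closed walk alternating between rim vertices, each carried
  together with the vertex subdividing its spoke, and vertices subdividing the edges of the rim.\<close>

datatype 'a rim_node = Spoked (spoke_vertex: 'a) (rim_vertex: 'a) | Middle (middle_vertex: 'a)

fun cell :: "'a rim_node \<Rightarrow> 'a set" where
  "cell (Spoked p u) = {p, u}"
| "cell (Middle b) = {b}"

definition cells :: "'a rim_node list \<Rightarrow> 'a set" where
  "cells ns = (\<Union>n\<in>set ns. cell n)"

abbreviation disjoint_cells :: "'a rim_node list \<Rightarrow> bool" where
  "disjoint_cells \<equiv> sorted_wrt (\<lambda>m n. cell m \<inter> cell n = {})"

abbreviation inner :: "'b list \<Rightarrow> 'b list" where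
  "inner xs \<equiv> tl (butlast xs)"

lemma finite_cell [simp]: "finite (cell n)"
  by (cases n) auto

lemma card_cell_le: "card (cell n) \<le> 2"
  by (cases n) (auto simp: card_insert_if)

lemma cells_simps [simp]:
  "cells [] = {}" "cells (n # ns) = cell n \<union> cells ns" "cells (ns @ ms) = cells ns \<union> cells ms"
  "cells (rev ns) = cells ns"
  by (auto simp: cells_def)

lemma finite_cells [simp]: "finite (cells ns)"
  by (simp add: cells_def)

lemma card_cells_le: "card (cells ns) \<le> 2 * length ns"
proof (induction ns)
  case (Cons n ns)
  then show ?case using card_Un_le[of "cell n" "cells ns"] card_cell_le[of n] by simp
qed simp

lemma cell_subset_cells: "n \<in> set ns \<Longrightarrow> cell n \<subseteq> cells ns"
  by (auto simp: cells_def)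

lemma cells_disjoint_iff: "cells ms \<inter> cells ns = {} \<longleftrightarrow> (\<forall>m\<in>set ms. \<forall>n\<in>set ns. cell m \<inter> cell n = {})"
  by (auto simp: cells_def)

lemma disjoint_cells_Cons: "disjoint_cells (n # ns) \<longleftrightarrow> cell n \<inter> cells ns = {} \<and> disjoint_cells ns"
  by (auto simp: cells_def)

lemma disjoint_cells_append:
  "disjoint_cells (ms @ ns) \<longleftrightarrow> disjoint_cells ms \<and> disjoint_cells ns \<and> cells ms \<inter> cells ns = {}"
  by (auto simp: sorted_wrt_append cells_disjoint_iff)

lemma disjoint_cells_rev: "disjoint_cells (rev ns) \<longleftrightarrow> disjoint_cells ns"
  by (simp add: sorted_wrt_rev Int_commute)

lemma butlast_eq_hd_inner: "2 \<le> length xs \<Longrightarrow> butlast xs = hd xs # inner xs"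
  by (cases xs rule: remdups_adj.cases) auto

lemma hd_inner_last: "2 \<le> length xs \<Longrightarrow> xs = hd xs # inner xs @ [last xs]"
  by (metis append_Cons append_butlast_last_id butlast_eq_hd_inner list.size(3) not_numeral_le_zero)

lemma inner_nonempty: "3 \<le> length xs \<Longrightarrow> inner xs \<noteq> []"
  by (auto dest: arg_cong[of _ _ length])

locale simple_graph =
  fixes adj :: "'a \<Rightarrow> 'a \<Rightarrow> bool" and V :: "'a set"
  assumes finite_V: "finite V" and adj_sym: "adj x y \<Longrightarrow> adj y x"
    and adj_irrefl: "\<not> adj x x" and adj_V: "adj x y \<Longrightarrow> x \<in> V"
begin

lemma adj_in_V: "adj x y \<Longrightarrow> x \<in> V \<and> y \<in> V"
  using adj_V adj_sym by blast

lemma adj_neq: "adj x y \<Longrightarrow> x \<noteq> y"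
  using adj_irrefl by blast

lemma adj_commute: "adj x y \<longleftrightarrow> adj y x"
  using adj_sym by blast

fun rim_adj :: "'a \<Rightarrow> 'a rim_node \<Rightarrow> 'a rim_node \<Rightarrow> bool" where
  "rim_adj v (Spoked p u) (Middle b) \<longleftrightarrow> adj v p \<and> adj p u \<and> adj u b"
| "rim_adj v (Middle b) (Spoked p u) \<longleftrightarrow> adj v p \<and> adj p u \<and> adj u b"
| "rim_adj v _ _ \<longleftrightarrow> False"

lemma rim_adj_commute: "rim_adj v m n \<longleftrightarrow> rim_adj v n m"
  by (cases m; cases n) auto

lemma successively_rim_adj_rev: "successively (rim_adj v) (rev ns) \<longleftrightarrow> successively (rim_adj v) ns"
  by (simp add: rim_adj_commute)

lemma is_Spoked_rim_adj: "rim_adj v m n \<Longrightarrow> is_Spoked n \<longleftrightarrow> \<not> is_Spoked m"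
  by (cases m; cases n) auto

lemma wheel_from_spoked_closed_walk:
  assumes walk: "successively (rim_adj v) (ns @ [hd ns])" and spoked: "is_Spoked (hd ns)"
    and disj: "disjoint_cells ns" and v: "v \<notin> cells ns" and len: "length ns = 2 * k" and k: "0 < k"
  shows "has_wheel adj k"
proof -
  have hd: "hd ns = ns ! 0" using len k by (intro hd_conv_nth) auto
  have next_adj: "rim_adj v (ns ! i) (ns ! (Suc i mod (2 * k)))" if "i < 2 * k" for i
    using successively_nth[OF walk, of i] that len by (cases "Suc i = 2 * k") (auto simp: nth_append hd)
  have parity: "is_Spoked (ns ! i) \<longleftrightarrow> even i" if "i < 2 * k" for i
    using that
  proof (induction i)
    case (Suc i)
    then show ?case using is_Spoked_rim_adj[OF next_adj[of i]] by simp
  qed (use spoked hd in simp)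
  define p where "p i = spoke_vertex (ns ! (2 * i))" for i
  define a where "a i = rim_vertex (ns ! (2 * i))" for i
  define b where "b i = middle_vertex (ns ! Suc (2 * i))" for i
  have node: "ns ! (2 * i) = Spoked (p i) (a i)" "ns ! Suc (2 * i) = Middle (b i)" if "i < k" for i
    using parity[of "2 * i"] parity[of "Suc (2 * i)"] that
    by (auto simp: p_def a_def b_def rim_node.is_Spoked_def intro: rim_node.collapse)
  have "Suc (Suc (2 * i)) mod (2 * k) = 2 * (Suc i mod k)" for i
    using mult_mod_right[of 2 "Suc i" k] by simp
  then have adjs: "adj v (p i)" "adj (p i) (a i)" "adj (a i) (b i)" "adj (b i) (a (Suc i mod k))"
    if "i < k" for i
    using next_adj[of "2 * i"] next_adj[of "Suc (2 * i)"] node[of i] node[of "Suc i mod k"] that k adj_commute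
    by auto
  have cell_disj: "cell (ns ! i) \<inter> cell (ns ! j) = {}" if "i < 2 * k" "j < 2 * k" "i \<noteq> j" for i j
    using sorted_wrt_nth_less[OF disj] that len by (cases i j rule: linorder_cases) (auto simp: Int_commute)
  have neq: "a i \<noteq> p j" "a i \<noteq> b j" "p i \<noteq> b j" if "i < k" "j < k" for i j
    using cell_disj[of "2 * i" "2 * j"] cell_disj[of "2 * i" "Suc (2 * j)"] node[of i] node[of j]
      adj_neq[OF adjs(2)[of i]] that
    by (cases "i = j"; auto)+
  have "a i \<noteq> a j \<and> p i \<noteq> p j \<and> b i \<noteq> b j" if "i < k" "j < k" "i \<noteq> j" for i j
    using cell_disj[of "2 * i" "2 * j"] cell_disj[of "Suc (2 * i)" "Suc (2 * j)"] node[of i] node[of j] that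
    by auto
  then have inj: "inj_on a {..<k}" "inj_on p {..<k}" "inj_on b {..<k}"
    unfolding inj_on_def lessThan_iff by blast+
  have "v \<noteq> a i" "v \<noteq> p i" "v \<noteq> b i" if "i < k" for i
    using v cell_subset_cells[OF nth_mem, of "2 * i" ns] cell_subset_cells[OF nth_mem, of "Suc (2 * i)" ns]
      node[of i] len that by auto
  with neq inj have "distinct (v # map a [0..<k] @ map p [0..<k] @ map b [0..<k])"
    unfolding distinct_wheel_iff by simp
  then show ?thesis unfolding has_wheel_def using adjs by blast
qed

lemma wheel_from_closed_walk:
  assumes walk: "successively (rim_adj v) (ns @ [hd ns])"
    and disj: "disjoint_cells ns" and v: "v \<notin> cells ns" and len: "length ns = 2 * k" and k: "0 < k"
  shows "has_wheel adj k"
proof (cases "is_Spoked (hd ns)")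
  case True
  show ?thesis using walk True disj v len k by (rule wheel_from_spoked_closed_walk)
next
  case False
  obtain m n ms where ns: "ns = m # n # ms"
    using len k by (cases ns rule: list.exhaust; cases "tl ns") auto
  show ?thesis
  proof (rule wheel_from_spoked_closed_walk)
    show "successively (rim_adj v) ((n # ms @ [m]) @ [hd (n # ms @ [m])])"
      using walk by (cases ms) (auto simp: ns successively_append_iff successively_Cons hd_append)
    show "is_Spoked (hd (n # ms @ [m]))"
      using False walk is_Spoked_rim_adj by (auto simp: ns)
    show "disjoint_cells (n # ms @ [m])"
      using disj by (auto simp: ns sorted_wrt_append Int_commute)
  qed (use v len k in \<open>auto simp: ns\<close>)
qed

definition rim_walk :: "'a \<Rightarrow> 'a rim_node list \<Rightarrow> bool" where
  "rim_walk v w \<longleftrightarrow> successively (rim_adj v) w \<and> disjoint_cells (inner w) \<and> v \<notin> cells w"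

lemma rim_walk_adj:
  assumes "rim_walk v w" "3 \<le> length w"
  shows "rim_adj v (last (inner w)) (last w)" "successively (rim_adj v) (hd w # inner w)"
proof -
  have "inner w \<noteq> []" using assms(2) by (rule inner_nonempty)
  moreover have "successively (rim_adj v) ((hd w # inner w) @ [last w])"
    using assms hd_inner_last[of w] by (simp add: rim_walk_def)
  ultimately show "rim_adj v (last (inner w)) (last w)" "successively (rim_adj v) (hd w # inner w)"
    unfolding successively_append_iff by auto
qed

lemma rim_walk_tl:
  assumes "rim_walk v w" "3 \<le> length w" shows "rim_walk v (tl w)"
proof -
  obtain m n ms where "w = m # n # ms" "ms \<noteq> []" using assms(2)
    by (cases w rule: remdups_adj.cases) (auto simp: Suc_le_length_iff)
  then show ?thesis using assms(1) by (auto simp: rim_walk_def disjoint_cells_Cons)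
qed

definition reroutable :: "'a \<Rightarrow> nat \<Rightarrow> nat \<Rightarrow> 'a rim_node list set \<Rightarrow> bool" where
  "reroutable v d N W \<longleftrightarrow> (\<forall>w\<in>W. rim_walk v w \<and> length w = d + 2 \<and>
     (\<forall>U. finite U \<and> card U \<le> N \<longrightarrow>
       (\<exists>w'\<in>W. butlast w' = butlast w \<and> cell (last w') \<inter> U = {}) \<and>
       (\<exists>w'\<in>W. hd w' = hd w \<and> last w' = last w \<and> cells (inner w') \<inter> U = {})))"

lemma reroutableD:
  assumes "reroutable v d N W" "w \<in> W"
  shows "rim_walk v w" "length w = d + 2"
    and "finite U \<Longrightarrow> card U \<le> N \<Longrightarrow> \<exists>w'\<in>W. butlast w' = butlast w \<and> cell (last w') \<inter> U = {}"
    and "finite U \<Longrightarrow> card U \<le> N \<Longrightarrow>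
      \<exists>w'\<in>W. hd w' = hd w \<and> last w' = last w \<and> cells (inner w') \<inter> U = {}"
  using assms unfolding reroutable_def by blast+

lemma exists_alternating_step:
  assumes W: "reroutable v d N W" and d: "0 < d"
    and w: "w \<in> W" and U: "finite U" "card U + (2 * d + 2) \<le> N"
  obtains w1 w2 where "w2 \<in> W" "hd w2 = hd w"
    "rim_adj v (last (inner w)) (last w1)" "rim_adj v (last w1) (last (inner w2))"
    "cell (last w1) \<inter> (U \<union> cells (inner w)) = {}"
    "cells (inner w2) \<inter> (U \<union> cells (inner w) \<union> cell (last w1)) = {}"
    "card (U \<union> cells (inner w) \<union> cell (last w1)) \<le> card U + (2 * d + 2)"
proof -
  note walk = reroutableD(1,2)[OF W]
  have card_U_inner: "card (U \<union> cells (inner w)) \<le> card U + 2 * d"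
    using card_Un_le[of U "cells (inner w)"] card_cells_le[of "inner w"] walk[OF w] by simp
  then obtain w1 where w1: "w1 \<in> W" "butlast w1 = butlast w" "cell (last w1) \<inter> (U \<union> cells (inner w)) = {}"
    using reroutableD(3)[OF W w, of "U \<union> cells (inner w)"] U by auto
  have card_U_inner_last: "card (U \<union> cells (inner w) \<union> cell (last w1)) \<le> card U + (2 * d + 2)"
    using card_Un_le[of "U \<union> cells (inner w)" "cell (last w1)"] card_U_inner card_cell_le[of "last w1"]
    by linarith
  then obtain w2 where w2: "w2 \<in> W" "hd w2 = hd w1" "last w2 = last w1"
    "cells (inner w2) \<inter> (U \<union> cells (inner w) \<union> cell (last w1)) = {}"
    using reroutableD(4)[OF W w1(1), of "U \<union> cells (inner w) \<union> cell (last w1)"] U by auto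
  have "hd w1 = hd w"
    using w1(2) butlast_eq_hd_inner[of w1] butlast_eq_hd_inner[of w] walk[OF w] walk[OF w1(1)]
    by (metis le_add2 list.inject)
  moreover have "rim_adj v (last (inner w)) (last w1)" "rim_adj v (last w1) (last (inner w2))"
    using rim_walk_adj(1)[of v w1] rim_walk_adj(1)[of v w2] walk[OF w1(1)] walk[OF w2(1)] d w1(2) w2(3)
      rim_adj_commute by auto
  ultimately show thesis using that[of w2 w1] w1(3) w2 card_U_inner_last by simp
qed

text \<open>Alternately replacing the last node of a walk and, keeping both ends, its inner nodes traces a path
  through the ends and the penultimate nodes of the walks.\<close>

lemma exists_alternating_walk:
  assumes W: "reroutable v d N W" and d: "0 < d"
    and "w \<in> W" "finite U" "card U + (2 * d + 2) * Suc l \<le> N"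
  shows "\<exists>ms w'. w' \<in> W \<and> hd w' = hd w \<and> length ms = 2 * l + 1 \<and>
    successively (rim_adj v) (last (inner w) # ms @ [last (inner w')]) \<and>
    disjoint_cells (ms @ inner w') \<and> cells (ms @ inner w') \<inter> (U \<union> cells (inner w)) = {}"
  using assms(3-5)
proof (induction l arbitrary: w U)
  case 0
  then have "card U + (2 * d + 2) \<le> N" by simp
  with 0 obtain w1 w2 where step: "w2 \<in> W" "hd w2 = hd w" "rim_adj v (last (inner w)) (last w1)"
    "rim_adj v (last w1) (last (inner w2))" "cell (last w1) \<inter> (U \<union> cells (inner w)) = {}"
    "cells (inner w2) \<inter> (U \<union> cells (inner w) \<union> cell (last w1)) = {}"
    by (metis exists_alternating_step[OF W d])
  have "disjoint_cells (inner w2)" using reroutableD(1)[OF W step(1)] by (simp add: rim_walk_def)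
  then have "disjoint_cells ([last w1] @ inner w2)"
    "cells ([last w1] @ inner w2) \<inter> (U \<union> cells (inner w)) = {}"
    unfolding append_Cons append_Nil disjoint_cells_Cons cells_simps(2) using step(5,6) by blast+
  then show ?case using step(1-4) by (intro exI[of _ "[last w1]"] exI[of _ w2] conjI) simp_all
next
  case (Suc l)
  then have "card U + (2 * d + 2) \<le> N" by simp
  with Suc.prems obtain w1 w2 where step: "w2 \<in> W" "hd w2 = hd w" "rim_adj v (last (inner w)) (last w1)"
    "rim_adj v (last w1) (last (inner w2))" "cell (last w1) \<inter> (U \<union> cells (inner w)) = {}"
    "cells (inner w2) \<inter> (U \<union> cells (inner w) \<union> cell (last w1)) = {}"
    "card (U \<union> cells (inner w) \<union> cell (last w1)) \<le> card U + (2 * d + 2)"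
    by (metis exists_alternating_step[OF W d])
  define U' where "U' = U \<union> cells (inner w) \<union> cell (last w1)"
  have "finite U'" "card U' + (2 * d + 2) * Suc l \<le> N" using Suc.prems step(7) by (auto simp: U'_def)
  from Suc.IH[OF step(1) this] obtain ms w' where IH: "w' \<in> W" "hd w' = hd w2" "length ms = 2 * l + 1"
    "successively (rim_adj v) (last (inner w2) # ms @ [last (inner w')])"
    "disjoint_cells (ms @ inner w')" "cells (ms @ inner w') \<inter> (U' \<union> cells (inner w2)) = {}"
    by blast
  have "inner w2 \<noteq> []" using reroutableD(2)[OF W step(1)] d by (intro inner_nonempty) simp
  then have tip: "cell (last (inner w2)) \<subseteq> cells (inner w2)" by (simp add: cell_subset_cells)
  let ?ms = "last w1 # last (inner w2) # ms"
  have "disjoint_cells (?ms @ inner w')"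
    unfolding append_Cons disjoint_cells_Cons cells_simps(2) using IH(5,6) step(6) tip U'_def by blast
  moreover have "cells (?ms @ inner w') \<inter> (U \<union> cells (inner w)) = {}"
    unfolding append_Cons cells_simps(2) using IH(6) step(5,6) tip U'_def by blast
  moreover have "successively (rim_adj v) (last (inner w) # ?ms @ [last (inner w')])"
    using IH(4) step(3,4) by simp
  ultimately show ?case using IH(1-3) step(2) by (intro exI[of _ ?ms] exI[of _ w'] conjI) simp_all
qed

lemma wheel_from_reroutable_walks:
  assumes W: "reroutable v d N W" "W \<noteq> {}" and d: "0 < d" "d < k" and N: "2 * (d + 1) * k \<le> N"
  shows "has_wheel adj k"
proof -
  note walk = reroutableD(1,2)[OF W(1)]
  obtain l where l: "k = Suc l + d"
    using d(2) less_iff_Suc_add by auto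
  obtain w0 where w0: "w0 \<in> W" using W(2) by blast
  define U where "U = insert v (cell (hd w0))"
  have "card U \<le> 3" using card_insert_le_m1[of 3 "cell (hd w0)" v] card_cell_le[of "hd w0"] by (simp add: U_def)
  also have "3 \<le> (2 * d + 2) * d" using d(1) by (cases d) auto
  finally have "card U + (2 * d + 2) * Suc l \<le> (2 * d + 2) * k" by (simp add: l algebra_simps)
  also have "\<dots> \<le> N" using N by simp
  finally have U: "finite U" "card U + (2 * d + 2) * Suc l \<le> N" by (simp_all add: U_def)
  then obtain w where w: "w \<in> W" "hd w = hd w0" "cells (inner w) \<inter> U = {}"
    using reroutableD(4)[OF W(1) w0, of U] by auto
  obtain ms w' where ms: "w' \<in> W" "hd w' = hd w" "length ms = 2 * l + 1"
    "successively (rim_adj v) (last (inner w) # ms @ [last (inner w')])"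
    "disjoint_cells (ms @ inner w')" "cells (ms @ inner w') \<inter> (U \<union> cells (inner w)) = {}"
    using exists_alternating_walk[OF W(1) d(1) w(1) U] by blast
  let ?ns = "(hd w # inner w) @ ms @ rev (inner w')"
  have ne: "inner w \<noteq> []" "inner w' \<noteq> []"
    using walk[OF w(1)] walk[OF ms(1)] d(1) by (intro inner_nonempty; simp)+
  show ?thesis
  proof (rule wheel_from_closed_walk)
    have "successively (rim_adj v) (hd w # inner w)" "successively (rim_adj v) (rev (hd w' # inner w'))"
      unfolding successively_rim_adj_rev using rim_walk_adj(2) walk[OF w(1)] walk[OF ms(1)] d(1) by simp_all
    moreover have "ms \<noteq> []" using ms(3) by auto
    ultimately show "successively (rim_adj v) (?ns @ [hd ?ns])"
      using ms(2,4) ne by (simp add: successively_append_iff successively_Cons hd_rev last_rev)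
    have "cells ?ns = cell (hd w) \<union> cells (inner w) \<union> cells ms \<union> cells (inner w')" by auto
    moreover have "v \<notin> cell (hd w)"
      using walk[OF w(1)] cell_subset_cells[of "hd w" w] by (cases w) (auto simp: rim_walk_def)
    ultimately show "v \<notin> cells ?ns" using w(3) ms(6) by (auto simp: U_def)
    have "disjoint_cells (inner w)" using walk[OF w(1)] by (simp add: rim_walk_def)
    then show "disjoint_cells ?ns"
      using ms(5,6) w(2,3) unfolding disjoint_cells_append disjoint_cells_rev disjoint_cells_Cons append_Cons
      by (simp add: U_def) blast
    show "length ?ns = 2 * k" using walk[OF w(1)] walk[OF ms(1)] ms(3) by (simp add: l)
    show "0 < k" using d by simp
  qed
qed

lemma wheel_from_walks:
  assumes fin: "finite W" and walk: "\<And>w. w \<in> W \<Longrightarrow> rim_walk v w \<and> length w = d + 2"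
    and d: "0 < d" "d < k" and N: "2 * (d + 1) * k \<le> N"
    and last_bound: "\<And>w z. w \<in> W \<Longrightarrow> card {w' \<in> W. butlast w' = butlast w \<and> z \<in> cell (last w')} \<le> a"
    and inner_bound: "\<And>w z. w \<in> W \<Longrightarrow>
        card {w' \<in> W. hd w' = hd w \<and> last w' = last w \<and> z \<in> cells (inner w')} \<le> c"
    and many: "N * a * card (butlast ` W) + N * c * card ((\<lambda>w. (hd w, last w)) ` W) < card W"
  shows "has_wheel adj k"
proof -
  obtain W' where W': "W' \<subseteq> W" "W' \<noteq> {}"
    and last_fibre: "\<And>w. w \<in> W' \<Longrightarrow> N * a < card {w' \<in> W'. butlast w' = butlast w}"
    and ends_fibre: "\<And>w. w \<in> W' \<Longrightarrow> N * c < card {w' \<in> W'. (hd w', last w') = (hd w, last w)}"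
    using exists_subset_with_large_fibres[OF fin many] by blast
  have reroute_last: "\<exists>w'\<in>{w' \<in> W'. butlast w' = butlast w}. cell (last w') \<inter> U = {}"
    if w: "w \<in> W'" and U: "finite U" "card U \<le> N" for w U
  proof (rule exists_avoiding[OF U(1)])
    show "card {w'' \<in> {w' \<in> W'. butlast w' = butlast w}. z \<in> cell (last w'')} \<le> a" for z
      by (rule order_trans[OF card_mono last_bound[of w z]]) (use w W'(1) fin in auto)
    show "card U * a < card {w' \<in> W'. butlast w' = butlast w}"
      using last_fibre[OF w] mult_le_mono1[OF U(2), of a] by linarith
  qed
  have reroute_inner: "\<exists>w'\<in>{w' \<in> W'. (hd w', last w') = (hd w, last w)}. cells (inner w') \<inter> U = {}"
    if w: "w \<in> W'" and U: "finite U" "card U \<le> N" for w U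
  proof (rule exists_avoiding[OF U(1)])
    show "card {w'' \<in> {w' \<in> W'. (hd w', last w') = (hd w, last w)}. z \<in> cells (inner w'')} \<le> c" for z
      by (rule order_trans[OF card_mono inner_bound[of w z]]) (use w W'(1) fin in auto)
    show "card U * c < card {w' \<in> W'. (hd w', last w') = (hd w, last w)}"
      using ends_fibre[OF w] mult_le_mono1[OF U(2), of c] by linarith
  qed
  have "reroutable v d N W'"
    unfolding reroutable_def
  proof (intro ballI conjI allI impI)
    fix w assume w: "w \<in> W'"
    show "rim_walk v w" "length w = d + 2" using w W'(1) walk by blast+
    fix U :: "'a set" assume U: "finite U \<and> card U \<le> N"
    show "\<exists>w'\<in>W'. butlast w' = butlast w \<and> cell (last w') \<inter> U = {}"
      using reroute_last[OF w] U by blast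
    show "\<exists>w'\<in>W'. hd w' = hd w \<and> last w' = last w \<and> cells (inner w') \<inter> U = {}"
      using reroute_inner[OF w] U by blast
  qed
  then show ?thesis using W'(2) d N by (rule wheel_from_reroutable_walks)
qed

lemma wheel_from_tails:
  assumes fin: "finite W" and walk: "\<And>w. w \<in> W \<Longrightarrow> rim_walk v w \<and> length w = d + 2 \<and> hd w = \<rho>"
    and d: "2 \<le> d" "d < k" and N: "2 * (d + 1) * k \<le> N"
    and last_bound: "\<And>w z. w \<in> W \<Longrightarrow> card {w' \<in> W. butlast w' = butlast w \<and> z \<in> cell (last w')} \<le> a"
    and tail_bound: "\<And>w z. w \<in> W \<Longrightarrow>
        card {w' \<in> W. w' ! 1 = w ! 1 \<and> last w' = last w \<and> z \<in> cells (tl (inner w'))} \<le> c"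
    and many: "N * a * card (butlast ` W) + N * c * card ((\<lambda>w. (w ! 1, last w)) ` W) < card W"
  shows "has_wheel adj k"
proof -
  have tl_W: "w = \<rho> # tl w" "butlast w = \<rho> # butlast (tl w)" "hd (tl w) = w ! 1" "last (tl w) = last w"
    if "w \<in> W" for w
    using walk[OF that] d(1) by (cases w rule: remdups_adj.cases; auto)+
  show ?thesis
  proof (rule wheel_from_walks)
    show "finite (tl ` W)" using fin by simp
    show "rim_walk v w \<and> length w = (d - 1) + 2" if "w \<in> tl ` W" for w
      using that walk d(1) by (auto intro!: rim_walk_tl)
    show "0 < d - 1" "d - 1 < k" "2 * (d - 1 + 1) * k \<le> N" using d N by auto
    fix w z assume "w \<in> tl ` W"
    then obtain w0 where w0: "w0 \<in> W" "w = tl w0" by blast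
    have "card {w' \<in> tl ` W. butlast w' = butlast w \<and> z \<in> cell (last w')}
        \<le> card {w' \<in> W. butlast w' = butlast w0 \<and> z \<in> cell (last w')}"
      using fin w0 by (intro surj_card_le[of _ _ tl]) (auto simp: tl_W(2-4))
    then show "card {w' \<in> tl ` W. butlast w' = butlast w \<and> z \<in> cell (last w')} \<le> a"
      using last_bound[OF w0(1), of z] by linarith
    have "card {w' \<in> tl ` W. hd w' = hd w \<and> last w' = last w \<and> z \<in> cells (inner w')}
        \<le> card {w' \<in> W. w' ! 1 = w0 ! 1 \<and> last w' = last w0 \<and> z \<in> cells (tl (inner w'))}"
      using fin w0 by (intro surj_card_le[of _ _ tl]) (auto simp: tl_W(2-4))
    then show "card {w' \<in> tl ` W. hd w' = hd w \<and> last w' = last w \<and> z \<in> cells (inner w')} \<le> c"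
      using tail_bound[OF w0(1), of z] by linarith
  next
    have "inj_on tl W" by (metis inj_onI tl_W(1))
    then have card_tl: "card (tl ` W) = card W" by (rule card_image)
    have "card (butlast ` tl ` W) \<le> card (butlast ` W)"
      using fin by (intro surj_card_le[of _ _ tl]) (auto simp: butlast_tl)
    then have "N * a * card (butlast ` tl ` W) \<le> N * a * card (butlast ` W)"
      by (rule mult_le_mono2)
    moreover have ends: "(\<lambda>w. (hd w, last w)) ` tl ` W = (\<lambda>w. (w ! 1, last w)) ` W"
      unfolding image_image using tl_W(3,4) by (intro image_cong) simp_all
    ultimately show
      "N * a * card (butlast ` tl ` W) + N * c * card ((\<lambda>w. (hd w, last w)) ` tl ` W) < card (tl ` W)"
      using many unfolding card_tl ends by linarith
  qed
qed

lemma card_inner_le_card_tail: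
  assumes "finite W" and walk: "\<And>w. w \<in> W \<Longrightarrow> 3 \<le> length w \<and> \<not> is_Spoked (w ! 1)"
    and "card {w \<in> W. w ! 1 = Middle z \<and> last w = n} \<le> T"
    and "card {w \<in> W. last w = n \<and> z \<in> cells (tl (inner w))} \<le> c"
  shows "card {w \<in> W. last w = n \<and> z \<in> cells (inner w)} \<le> T + c"
proof -
  let ?A = "{w \<in> W. w ! 1 = Middle z \<and> last w = n}"
  let ?B = "{w \<in> W. last w = n \<and> z \<in> cells (tl (inner w))}"
  have "w ! 1 = Middle z \<or> z \<in> cells (tl (inner w))" if "w \<in> W" "z \<in> cells (inner w)" for w
  proof -
    have "inner w = w ! 1 # tl (inner w)"
      using walk[OF that(1)] by (cases w rule: remdups_adj.cases) auto
    then have "cells (inner w) = cell (w ! 1) \<union> cells (tl (inner w))"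
      by (metis cells_simps(2))
    then show ?thesis using walk[OF that(1)] that(2) by (cases "w ! 1") auto
  qed
  then have "card {w \<in> W. last w = n \<and> z \<in> cells (inner w)} \<le> card (?A \<union> ?B)"
    using assms(1) by (intro card_mono) auto
  also have "\<dots> \<le> card ?A + card ?B" by (rule card_Un_le)
  finally show ?thesis using assms(3,4) by linarith
qed

lemma wheel_from_rare_second_nodes:
  assumes fin: "finite W"
    and walk: "\<And>w. w \<in> W \<Longrightarrow> rim_walk v w \<and> length w = d + 2 \<and> hd w = \<rho> \<and> \<not> is_Spoked (w ! 1)"
    and d: "0 < d" "d < k" and N: "2 * (d + 1) * k \<le> N"
    and last_bound: "\<And>w z. w \<in> W \<Longrightarrow> card {w' \<in> W. butlast w' = butlast w \<and> z \<in> cell (last w')} \<le> a"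
    and rare: "\<And>w z. w \<in> W \<Longrightarrow> card {w' \<in> W. w' ! 1 = Middle z \<and> last w' = last w} \<le> T"
    and inner_bound: "\<And>w z. w \<in> W \<Longrightarrow> card {w' \<in> W. last w' = last w \<and> z \<in> cells (tl (inner w'))} \<le> c"
    and many: "N * a * card (butlast ` W) + N * (T + c) * card (last ` W) < card W"
  shows "has_wheel adj k"
proof (rule wheel_from_walks[OF fin _ d N last_bound])
  show "rim_walk v w \<and> length w = d + 2" if "w \<in> W" for w
    using walk[OF that] by simp
  show "card {w' \<in> W. hd w' = hd w \<and> last w' = last w \<and> z \<in> cells (inner w')} \<le> T + c" if "w \<in> W" for w z
  proof (rule order_trans[OF card_mono])
    show "card {w' \<in> W. last w' = last w \<and> z \<in> cells (inner w')} \<le> T + c"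
      using walk d(1) by (intro card_inner_le_card_tail[OF fin _ rare inner_bound] that) auto
  qed (use fin in auto)
  have "card ((\<lambda>w. (hd w, last w)) ` W) \<le> card (last ` W)"
    using fin walk by (intro surj_card_le[of _ _ "Pair \<rho>"]) auto
  then have "N * (T + c) * card ((\<lambda>w. (hd w, last w)) ` W) \<le> N * (T + c) * card (last ` W)"
    by (rule mult_le_mono2)
  then show "N * a * card (butlast ` W) + N * (T + c) * card ((\<lambda>w. (hd w, last w)) ` W) < card W"
    using many by linarith
qed

text \<open>If for most walks the second node recurs more than \<open>T\<close> times among the walks with the same end, cut off
  the root and close up at the second node; otherwise close up at the root.\<close>

lemma wheel_from_rooted_walks:
  assumes fin: "finite W"
    and walk: "\<And>w. w \<in> W \<Longrightarrow> rim_walk v w \<and> length w = d + 2 \<and> hd w = \<rho> \<and> \<not> is_Spoked (w ! 1)"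
    and d: "2 \<le> d" "d < k" and N: "2 * (d + 1) * k \<le> N"
    and last_bound: "\<And>w z. w \<in> W \<Longrightarrow> card {w' \<in> W. butlast w' = butlast w \<and> z \<in> cell (last w')} \<le> a"
    and tail_bound: "\<And>w z. w \<in> W \<Longrightarrow>
        card {w' \<in> W. w' ! 1 = w ! 1 \<and> last w' = last w \<and> z \<in> cells (tl (inner w'))} \<le> c"
    and inner_bound: "\<And>w z. w \<in> W \<Longrightarrow> card {w' \<in> W. last w' = last w \<and> z \<in> cells (tl (inner w'))} \<le> c'"
    and many_prefix: "4 * N * a * card (butlast ` W) < card W"
    and many_last: "4 * N * (2 * N * c + c') * card (last ` W) \<le> card W"
  shows "has_wheel adj k"
proof -
  define T where "T = 2 * N * c"
  define pivot where "pivot w = (w ! 1, last w)" for w :: "'a rim_node list"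
  let ?C = "crowded pivot T W"
  let ?D = "W - ?C"
  have sub: "?C \<subseteq> W" "?D \<subseteq> W" "finite ?C" "finite ?D"
    using crowded_subset[of pivot T W] fin finite_subset by auto
  have restrict: "card {w \<in> Y. P w} \<le> m" if "Y \<subseteq> W" "card {w \<in> W. P w} \<le> m" for Y P m
    by (rule order_trans[OF card_mono that(2)]) (use that(1) fin in auto)
  have image_le: "4 * (m * card (f ` Y)) \<le> 4 * (m * card (f ` W))" if "Y \<subseteq> W" for Y f m
    using that fin by (intro mult_le_mono2 card_mono) auto
  have "4 * (N * a * card (butlast ` W)) < card W" using many_prefix by (simp only: mult.assoc)
  then have prefix: "4 * (N * a * card (butlast ` Y)) < card W" if "Y \<subseteq> W" for Y
    using image_le[OF that, of "N * a" butlast] by linarith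
  show ?thesis
  proof (cases "card W \<le> 2 * card ?C")
    case True
    have "card (pivot ` ?C) * T \<le> card ?C" using card_image_crowded_le[OF fin, of pivot T] by simp
    then have "2 * (N * c * card (pivot ` ?C)) \<le> card ?C" by (simp add: T_def algebra_simps)
    then have "N * a * card (butlast ` ?C) + N * c * card ((\<lambda>w. (w ! 1, last w)) ` ?C) < card ?C"
      using prefix[OF sub(1)] True unfolding pivot_def by linarith
    then show ?thesis
      using sub(1) walk
      by (intro wheel_from_tails[OF sub(3) _ d N restrict[OF sub(1) last_bound] restrict[OF sub(1) tail_bound]])
        auto
  next
    case False
    then have half: "card W \<le> 2 * card ?D"
      using card_eq_card_plus_card_Diff[OF fin sub(1)] by simp
    have "card {w \<in> ?D. w ! 1 = Middle z \<and> last w = n} \<le> T" for z n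
      using card_fibre_not_crowded_le[OF fin, of T pivot "(Middle z, n)"] by (simp add: pivot_def)
    moreover have "4 * (N * (T + c') * card (last ` W)) \<le> card W"
      using many_last by (simp only: T_def mult.assoc)
    then have "N * a * card (butlast ` ?D) + N * (T + c') * card (last ` ?D) < card ?D"
      using prefix[OF sub(2)] image_le[OF sub(2), of "N * (T + c')" last] half by linarith
    ultimately show ?thesis
      using walk d by (intro wheel_from_rare_second_nodes[OF sub(4) _ _ d(2) N restrict[OF sub(2) last_bound]
            _ restrict[OF sub(2) inner_bound]]) auto
  qed
qed

end

section \<open>Wheels from many walks of length four\<close>

locale codegree_graph = simple_graph +
  fixes t :: nat
begin

definition nbrs :: "'a \<Rightarrow> 'a set" where
  "nbrs x = {y. adj x y}"

definition heavy :: "'a \<Rightarrow> 'a \<Rightarrow> bool" where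
  "heavy x y \<longleftrightarrow> x \<noteq> y \<and> t \<le> card (nbrs x \<inter> nbrs y)"

definition light :: "'a \<Rightarrow> 'a \<Rightarrow> bool" where
  "light x y \<longleftrightarrow> x \<noteq> y \<and> \<not> heavy x y"

definition light_common :: "'a \<Rightarrow> 'a \<Rightarrow> 'a set" where
  "light_common x y = (if light x y then nbrs x \<inter> nbrs y else {})"

definition light_path :: "'a \<Rightarrow> 'a \<Rightarrow> 'a \<Rightarrow> 'a \<Rightarrow> bool" where
  "light_path v p u b \<longleftrightarrow> adj v p \<and> adj p u \<and> adj u b \<and> v \<noteq> b \<and> light v u \<and> light p b"

definition light_paths :: "'a \<Rightarrow> 'a \<Rightarrow> ('a \<times> 'a) set" where
  "light_paths v b = {(p, u). light_path v p u b}"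

text \<open>An arc around the hub \<open>v\<close> joins the rim vertices \<open>u\<close> and \<open>u'\<close>, with spoke vertices \<open>p\<close> and \<open>p'\<close>,
  through \<open>b\<close>.\<close>

definition arc :: "'a \<Rightarrow> 'a \<Rightarrow> 'a \<Rightarrow> 'a \<Rightarrow> 'a \<Rightarrow> 'a \<Rightarrow> bool" where
  "arc v p u b p' u' \<longleftrightarrow> light_path v p u b \<and> light_path v p' u' b \<and> light u u' \<and> u \<noteq> p' \<and> u' \<noteq> p"

lemma nbrs_subset: "nbrs x \<subseteq> V"
  using adj_in_V by (auto simp: nbrs_def)

lemma finite_nbrs [simp]: "finite (nbrs x)"
  using nbrs_subset finite_V finite_subset by blast

lemma heavy_commute: "heavy x y \<longleftrightarrow> heavy y x"
  by (auto simp: heavy_def Int_commute)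

lemma light_commute: "light x y \<longleftrightarrow> light y x"
  by (auto simp: light_def heavy_commute)

lemma light_neq: "light x y \<Longrightarrow> x \<noteq> y"
  by (auto simp: light_def)

lemma finite_light_common [simp]: "finite (light_common x y)"
  by (auto simp: light_common_def)

lemma card_light_common: "card (light_common x y) \<le> t"
  by (auto simp: light_common_def light_def heavy_def)

lemma light_commonI: "light x y \<Longrightarrow> adj x z \<Longrightarrow> adj z y \<Longrightarrow> z \<in> light_common x y"
  by (auto simp: light_common_def nbrs_def adj_commute)

lemma light_paths_subset: "light_paths x z \<subseteq> V \<times> V"
  using adj_in_V by (auto simp: light_paths_def light_path_def)

lemma finite_light_paths [simp]: "finite (light_paths x z)"
  using light_paths_subset finite_V by (meson finite_SigmaI finite_subset)

lemma light_pathD: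
  assumes "light_path v p u b"
  shows "adj v p" "adj p u" "adj u b" "v \<noteq> b" "v \<noteq> p" "v \<noteq> u" "p \<noteq> u" "p \<noteq> b" "u \<noteq> b"
    "p \<in> light_common v u" "u \<in> light_common p b"
  using assms adj_neq light_neq by (auto simp: light_path_def adj_commute intro!: light_commonI)

lemma arc_commute: "arc v p u b p' u' \<longleftrightarrow> arc v p' u' b p u"
  by (auto simp: arc_def light_commute)

lemma arcD:
  assumes "arc v p u b p' u'"
  shows "light_path v p u b" "light_path v p' u' b" "b \<in> light_common u u'" "(b, u') \<in> light_paths u p'"
  using assms adj_commute light_commute
  by (auto simp: arc_def light_paths_def light_path_def intro!: light_commonI)

lemma arc_in_V: "arc v p u b p' u' \<Longrightarrow> p \<in> V \<and> u \<in> V \<and> b \<in> V \<and> p' \<in> V \<and> u' \<in> V"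
  using adj_in_V by (auto simp: arc_def light_path_def)

lemma card_Un_light_common_le:
  assumes "A \<subseteq> f ` light_common x y \<union> g ` light_common x' y'"
  shows "card A \<le> 2 * t"
proof -
  have "card A \<le> card (f ` light_common x y \<union> g ` light_common x' y')"
    using assms by (intro card_mono) auto
  also have "\<dots> \<le> card (f ` light_common x y) + card (g ` light_common x' y')" by (rule card_Un_le)
  also have "\<dots> \<le> t + t"
    by (intro add_mono order_trans[OF card_image_le card_light_common]) auto
  finally show ?thesis by simp
qed

definition short_walk :: "'a \<Rightarrow> 'a \<Rightarrow> 'a \<Rightarrow> 'a rim_node list \<Rightarrow> bool" where
  "short_walk v q x w \<longleftrightarrow> (\<exists>b' p' u' b. w = [Spoked q x, Middle b', Spoked p' u', Middle b] \<and>
     arc v q x b' p' u' \<and> light_path v p' u' b)"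

lemma short_walk_rim_walk:
  assumes "short_walk v q x w"
  shows "rim_walk v w" "length w = 4" "hd w = Spoked q x" "\<not> is_Spoked (w ! 1)"
proof -
  obtain b' p' u' b where w: "w = [Spoked q x, Middle b', Spoked p' u', Middle b]"
    and arc: "arc v q x b' p' u'" "light_path v p' u' b"
    using assms by (auto simp: short_walk_def)
  show "rim_walk v w"
    using light_pathD(1-9)[OF arcD(1)[OF arc(1)]] light_pathD(1-9)[OF arcD(2)[OF arc(1)]]
      light_pathD(1-9)[OF arc(2)]
    by (auto simp: w rim_walk_def)
  show "length w = 4" "hd w = Spoked q x" "\<not> is_Spoked (w ! 1)" by (simp_all add: w)
qed

lemma card_short_walk_tails_le:
  assumes W: "\<And>w. w \<in> W \<Longrightarrow> short_walk v q x w"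
  shows "card {w' \<in> W. w' ! 1 = m \<and> last w' = n \<and> z \<in> cells (tl (inner w'))} \<le> 2 * t"
proof -
  have "{w' \<in> W. w' ! 1 = m \<and> last w' = n \<and> z \<in> cells (tl (inner w'))} \<subseteq>
      (\<lambda>u'. [Spoked q x, m, Spoked z u', n]) ` light_common z (middle_vertex m) \<union>
      (\<lambda>p'. [Spoked q x, m, Spoked p' z, n]) ` light_common v z"
    using light_pathD(10,11) by (fastforce simp: short_walk_def dest!: W arcD(2))
  then show ?thesis by (rule card_Un_light_common_le)
qed

lemma card_short_walk_inner_le:
  assumes W: "\<And>w. w \<in> W \<Longrightarrow> short_walk v q x w"
  shows "card {w' \<in> W. last w' = n \<and> z \<in> cells (tl (inner w'))} \<le> 2 * t * t"
proof -
  define A where "A = (\<lambda>(b', p'). [Spoked q x, Middle b', Spoked p' z, n]) `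
    (light_common x z \<times> light_common v z)"
  define B where "B = (\<lambda>(u', b'). [Spoked q x, Middle b', Spoked z u', n]) `
    (SIGMA u' : light_common z (middle_vertex n). light_common x u')"
  have "w \<in> A \<union> B" if w: "w \<in> W" "last w = n" "z \<in> cells (tl (inner w))" for w
  proof -
    obtain b' p' u' b where w': "w = [Spoked q x, Middle b', Spoked p' u', Middle b]"
      and arc: "arc v q x b' p' u'" and path: "light_path v p' u' b"
      using W[OF w(1)] by (auto simp: short_walk_def)
    have "b' \<in> light_common x u'" "p' \<in> light_common v u'" "u' \<in> light_common p' b"
      using arcD(3)[OF arc] light_pathD(10,11)[OF path] by auto
    moreover have "z = p' \<or> z = u'" using w(3) by (auto simp: w')
    ultimately show ?thesis using w(2) by (auto simp: w' A_def B_def)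
  qed
  then have "card {w' \<in> W. last w' = n \<and> z \<in> cells (tl (inner w'))} \<le> card (A \<union> B)"
    by (intro card_mono) (auto simp: A_def B_def)
  also have "\<dots> \<le> card A + card B" by (rule card_Un_le)
  also have "card A \<le> t * t"
    using card_light_common unfolding A_def by (intro card_le_image_Sigma[OF subset_refl]) auto
  also have "card B \<le> t * t"
    using card_light_common unfolding B_def by (intro card_le_image_Sigma[OF subset_refl]) auto
  finally show ?thesis by simp
qed

definition branching :: "nat \<Rightarrow> nat" where
  "branching k = 4 * (8 * k) * (2 * (8 * k) * (2 * t) + 2 * t * t)"

lemma wheel_from_short_walks:
  assumes fin: "finite W" and W: "\<And>w. w \<in> W \<Longrightarrow> short_walk v q x w" and k: "3 \<le> k"
    and many_prefix: "32 * k * card (butlast ` W) < card W"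
    and many_last: "branching k * card (last ` W) \<le> card W"
  shows "has_wheel adj k"
proof (rule wheel_from_rooted_walks[OF fin])
  show "rim_walk v w \<and> length w = 2 + 2 \<and> hd w = Spoked q x \<and> \<not> is_Spoked (w ! 1)" if "w \<in> W" for w
    using short_walk_rim_walk[OF W[OF that]] by simp
  show "card {w' \<in> W. butlast w' = butlast w \<and> z \<in> cell (last w')} \<le> 1" for w z
  proof -
    have "{w' \<in> W. butlast w' = butlast w \<and> z \<in> cell (last w')} \<subseteq> {butlast w @ [Middle z]}"
      using W by (fastforce simp: short_walk_def)
    from card_mono[OF _ this] show ?thesis by simp
  qed
  show "card {w' \<in> W. w' ! 1 = w ! 1 \<and> last w' = last w \<and> z \<in> cells (tl (inner w'))} \<le> 2 * t" for w z
    by (rule card_short_walk_tails_le[OF W])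
  show "card {w' \<in> W. last w' = last w \<and> z \<in> cells (tl (inner w'))} \<le> 2 * t * t" for w z
    by (rule card_short_walk_inner_le[OF W])
  show "4 * (8 * k) * 1 * card (butlast ` W) < card W" using many_prefix by simp
  show "4 * (8 * k) * (2 * (8 * k) * (2 * t) + 2 * t * t) * card (last ` W) \<le> card W"
    using many_last by (simp only: branching_def)
qed (use k in auto)

definition long_walk :: "nat \<Rightarrow> 'a \<Rightarrow> 'a \<Rightarrow> 'a \<Rightarrow> 'a rim_node list \<Rightarrow> bool" where
  "long_walk M v q x w \<longleftrightarrow> (\<exists>b' p' u' b p u. w = [Spoked q x, Middle b', Spoked p' u', Middle b, Spoked p u] \<and>
     arc v q x b' p' u' \<and> arc v p' u' b p u \<and> b \<noteq> b' \<and> card (light_paths x p') \<le> M)"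

lemma long_walk_rim_walk:
  assumes "long_walk M v q x w"
  shows "rim_walk v w" "length w = 5" "hd w = Spoked q x" "\<not> is_Spoked (w ! 1)" "short_walk v q x (butlast w)"
proof -
  obtain b' p' u' b p u where w: "w = [Spoked q x, Middle b', Spoked p' u', Middle b, Spoked p u]"
    and arc: "arc v q x b' p' u'" "arc v p' u' b p u" "b \<noteq> b'"
    using assms by (auto simp: long_walk_def)
  show "rim_walk v w"
    using light_pathD(1-9)[OF arcD(1)[OF arc(1)]] light_pathD(1-9)[OF arcD(2)[OF arc(1)]]
      light_pathD(1-9)[OF arcD(1)[OF arc(2)]] light_pathD(1-9)[OF arcD(2)[OF arc(2)]] arc(3)
    by (auto simp: w rim_walk_def)
  show "length w = 5" "hd w = Spoked q x" "\<not> is_Spoked (w ! 1)" by (simp_all add: w)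
  show "short_walk v q x (butlast w)" using arc(1) arcD(1)[OF arc(2)] by (simp add: w short_walk_def)
qed

lemma card_long_walk_last_le:
  assumes W: "\<And>w. w \<in> W \<Longrightarrow> long_walk M v q x w"
  shows "card {w' \<in> W. butlast w' = w \<and> z \<in> cell (last w')} \<le> 2 * t"
proof -
  have "{w' \<in> W. butlast w' = w \<and> z \<in> cell (last w')} \<subseteq>
      (\<lambda>u. w @ [Spoked z u]) ` light_common z (middle_vertex (last w)) \<union>
      (\<lambda>p. w @ [Spoked p z]) ` light_common v z"
  proof clarify
    fix w' assume w': "w' \<in> W" "z \<in> cell (last w')" "w = butlast w'"
      "w' \<notin> (\<lambda>p. butlast w' @ [Spoked p z]) ` light_common v z"
    obtain b' p' u' b p u where eq: "w' = [Spoked q x, Middle b', Spoked p' u', Middle b, Spoked p u]"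
      and arc: "arc v p' u' b p u"
      using W[OF w'(1)] by (auto simp: long_walk_def)
    show "w' \<in> (\<lambda>u. butlast w' @ [Spoked z u]) ` light_common z (middle_vertex (last (butlast w')))"
      using light_pathD(10,11)[OF arcD(2)[OF arc]] w'(2,4) by (auto simp: eq)
  qed
  then show ?thesis by (rule card_Un_light_common_le)
qed

lemma card_long_walk_split_inner:
  assumes fin: "finite W" and W: "\<And>w. w \<in> W \<Longrightarrow> long_walk M v q x w"
    and S: "card {w \<in> butlast ` W. last w = Middle z} \<le> S"
  shows "card {w \<in> W. P w \<and> last w = n \<and> z \<in> cells (tl (inner w))} \<le>
    S + card {w \<in> W. P w \<and> last w = n \<and> z \<in> cell (w ! 2)}"
proof -
  define A where "A = (\<lambda>w. w @ [n]) ` {w \<in> butlast ` W. last w = Middle z}"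
  have "w \<in> A \<or> z \<in> cell (w ! 2)" if w: "w \<in> W" "last w = n" "z \<in> cells (tl (inner w))" for w
  proof -
    obtain b' p' u' b p u where eq: "w = [Spoked q x, Middle b', Spoked p' u', Middle b, Spoked p u]"
      using W[OF w(1)] by (auto simp: long_walk_def)
    have "w \<in> A" if "z = b"
    proof -
      have "butlast w \<in> {w \<in> butlast ` W. last w = Middle z}" "w = butlast w @ [n]"
        using imageI[OF w(1), of butlast] w(2) that by (simp_all add: eq)
      then show ?thesis unfolding A_def by blast
    qed
    then show ?thesis using w(3) by (auto simp: eq)
  qed
  then have "card {w \<in> W. P w \<and> last w = n \<and> z \<in> cells (tl (inner w))} \<le>
      card (A \<union> {w \<in> W. P w \<and> last w = n \<and> z \<in> cell (w ! 2)})"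
    using fin by (intro card_mono) (auto simp: A_def)
  also have "\<dots> \<le> card A + card {w \<in> W. P w \<and> last w = n \<and> z \<in> cell (w ! 2)}" by (rule card_Un_le)
  also have "card A \<le> S" unfolding A_def using fin S by (intro order_trans[OF card_image_le]) auto
  finally show ?thesis by simp
qed

lemma card_long_walk_tails_le:
  assumes fin: "finite W" and W: "\<And>w. w \<in> W \<Longrightarrow> long_walk M v q x w"
    and S: "card {w \<in> butlast ` W. last w = Middle z} \<le> S"
  shows "card {w' \<in> W. w' ! 1 = m \<and> last w' = n \<and> z \<in> cells (tl (inner w'))} \<le> S + 2 * t * t"
proof -
  define c where "c = middle_vertex m"
  define y where "y = rim_vertex n"
  define B where "B = (\<lambda>(p', b). [Spoked q x, m, Spoked p' z, Middle b, n]) `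
    (light_common v z \<times> light_common z y)"
  define C where "C = (\<lambda>(u', b). [Spoked q x, m, Spoked z u', Middle b, n]) `
    (SIGMA u' : light_common z c. light_common u' y)"
  have "w \<in> B \<union> C" if w: "w \<in> W" "w ! 1 = m" "last w = n" "z \<in> cell (w ! 2)" for w
  proof -
    obtain b' p' u' b p u where eq: "w = [Spoked q x, Middle b', Spoked p' u', Middle b, Spoked p u]"
      and arc: "arc v q x b' p' u'" "arc v p' u' b p u"
      using W[OF w(1)] by (auto simp: long_walk_def)
    have "b \<in> light_common u' u" "p' \<in> light_common v u'" "u' \<in> light_common p' b'"
      using arcD(3)[OF arc(2)] light_pathD(10,11)[OF arcD(2)[OF arc(1)]] by auto
    moreover have "z = p' \<or> z = u'" using w(4) by (auto simp: eq)
    moreover have "w \<in> B" if "z = u'"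
      unfolding B_def using calculation w(2,3) that
      by (intro rev_image_eqI[of "(p', b)"]) (auto simp: eq y_def)
    moreover have "w \<in> C" if "z = p'"
      unfolding C_def using calculation w(2,3) that
      by (intro rev_image_eqI[of "(u', b)"]) (auto simp: eq y_def c_def)
    ultimately show ?thesis by blast
  qed
  then have "card {w' \<in> W. w' ! 1 = m \<and> last w' = n \<and> z \<in> cell (w' ! 2)} \<le> card (B \<union> C)"
    by (intro card_mono) (auto simp: B_def C_def)
  also have "\<dots> \<le> card B + card C" by (rule card_Un_le)
  also have "card B \<le> t * t"
    using card_light_common unfolding B_def by (intro card_le_image_Sigma[OF subset_refl]) auto
  also have "card C \<le> t * t"
    using card_light_common unfolding C_def by (intro card_le_image_Sigma[OF subset_refl]) auto
  finally show ?thesis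
    using card_long_walk_split_inner[OF fin W S, of "\<lambda>w. w ! 1 = m" n] by simp
qed

lemma card_long_walk_inner_le:
  assumes fin: "finite W" and W: "\<And>w. w \<in> W \<Longrightarrow> long_walk M v q x w"
    and S: "card {w \<in> butlast ` W. last w = Middle z} \<le> S"
  shows "card {w' \<in> W. last w' = n \<and> z \<in> cells (tl (inner w'))} \<le> S + t * t * t + M * t"
proof -
  define y where "y = rim_vertex n"
  define Z where "Z = (if card (light_paths x z) \<le> M then light_paths x z else {})"
  define B where "B = (\<lambda>((b', p'), b). [Spoked q x, Middle b', Spoked p' z, Middle b, n]) `
    ((light_common x z \<times> light_common v z) \<times> light_common z y)"
  define C where "C = (\<lambda>((b', u'), b). [Spoked q x, Middle b', Spoked z u', Middle b, n]) `
    (SIGMA w : Z. light_common (snd w) y)"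
  have Z: "finite Z" "card Z \<le> M" by (auto simp: Z_def)
  have "w \<in> B \<union> C" if w: "w \<in> W" "last w = n" "z \<in> cell (w ! 2)" for w
  proof -
    obtain b' p' u' b p u where eq: "w = [Spoked q x, Middle b', Spoked p' u', Middle b, Spoked p u]"
      and arc: "arc v q x b' p' u'" "arc v p' u' b p u" and M: "card (light_paths x p') \<le> M"
      using W[OF w(1)] by (auto simp: long_walk_def)
    have common: "b \<in> light_common u' y" "b' \<in> light_common x u'" "p' \<in> light_common v u'"
      and path: "(b', u') \<in> light_paths x p'"
      using arcD(3)[OF arc(2)] arcD(3,4)[OF arc(1)] light_pathD(10)[OF arcD(2)[OF arc(1)]] w(2)
      by (auto simp: eq y_def)
    have "z = p' \<or> z = u'" using w(3) by (auto simp: eq)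
    moreover have "w \<in> C" if "z = p'"
      unfolding C_def using common path M w(2) that
      by (intro rev_image_eqI[of "((b', u'), b)"]) (auto simp: Z_def eq)
    moreover have "w \<in> B" if "z = u'"
      unfolding B_def using common w(2) that by (intro rev_image_eqI[of "((b', p'), b)"]) (auto simp: eq)
    ultimately show ?thesis by blast
  qed
  then have "card {w' \<in> W. last w' = n \<and> z \<in> cell (w' ! 2)} \<le> card (B \<union> C)"
    using Z by (intro card_mono) (auto simp: B_def C_def)
  also have "\<dots> \<le> card B + card C" by (rule card_Un_le)
  also have "card (light_common x z \<times> light_common v z) \<le> t * t"
    by (simp add: card_cartesian_product card_light_common mult_le_mono)
  then have "card B \<le> t * t * t"
    using card_light_common unfolding B_def by (intro card_le_image_Sigma[OF subset_refl]) auto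
  also have "card C \<le> M * t"
    using Z card_light_common unfolding C_def by (intro card_le_image_Sigma[OF subset_refl]) auto
  finally show ?thesis
    using card_long_walk_split_inner[OF fin W S, of "\<lambda>_. True" n] by simp
qed

lemma wheel_from_long_walks:
  assumes fin: "finite W" and W: "\<And>w. w \<in> W \<Longrightarrow> long_walk M v q x w" and k: "4 \<le> k"
    and S: "\<And>z. card {w \<in> butlast ` W. last w = Middle z} \<le> S"
    and many_prefix: "64 * k * t * card (butlast ` W) < card W"
    and many_last: "32 * k * (16 * k * (S + 2 * t * t) + (S + t * t * t + M * t)) * card (last ` W) \<le> card W"
  shows "has_wheel adj k"
proof (rule wheel_from_rooted_walks[OF fin])
  show "rim_walk v w \<and> length w = 3 + 2 \<and> hd w = Spoked q x \<and> \<not> is_Spoked (w ! 1)" if "w \<in> W" for w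
    using long_walk_rim_walk[OF W[OF that]] by simp
  show "card {w' \<in> W. butlast w' = butlast w \<and> z \<in> cell (last w')} \<le> 2 * t" for w z
    by (rule card_long_walk_last_le[OF W])
  show "card {w' \<in> W. w' ! 1 = w ! 1 \<and> last w' = last w \<and> z \<in> cells (tl (inner w'))} \<le> S + 2 * t * t" for w z
    by (rule card_long_walk_tails_le[OF fin W S])
  show "card {w' \<in> W. last w' = last w \<and> z \<in> cells (tl (inner w'))} \<le> S + t * t * t + M * t" for w z
    by (rule card_long_walk_inner_le[OF fin W S])
  show "4 * (8 * k) * (2 * t) * card (butlast ` W) < card W" using many_prefix by simp
  show "4 * (8 * k) * (2 * (8 * k) * (S + 2 * t * t) + (S + t * t * t + M * t)) * card (last ` W) \<le> card W"
    using many_last by simp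
qed (use k in auto)

lemma card_long_walk_extensions_le:
  assumes W: "\<And>w. w \<in> W \<Longrightarrow> long_walk M v q x w" and deg: "\<And>y. card (nbrs y) \<le> \<Delta>"
  shows "card {w' \<in> W. butlast w' = w} \<le> \<Delta> * t"
proof -
  have "{w' \<in> W. butlast w' = w} \<subseteq> (\<lambda>(u, p). w @ [Spoked p u]) `
      (SIGMA u : nbrs (middle_vertex (last w)). light_common v u)"
  proof clarify
    fix w' assume w': "w' \<in> W" "w = butlast w'"
    obtain b' p' u' b p u where eq: "w' = [Spoked q x, Middle b', Spoked p' u', Middle b, Spoked p u]"
      and arc: "arc v p' u' b p u"
      using W[OF w'(1)] by (auto simp: long_walk_def)
    have "u \<in> nbrs b" "p \<in> light_common v u"
      using light_pathD(3,10)[OF arcD(2)[OF arc]] by (auto simp: nbrs_def adj_commute)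
    then show "w' \<in> (\<lambda>(u, p). butlast w' @ [Spoked p u]) `
        (SIGMA u : nbrs (middle_vertex (last (butlast w'))). light_common v u)"
      by (intro rev_image_eqI[of "(u, p)"]) (auto simp: eq)
  qed
  then show ?thesis by (rule card_le_image_Sigma) (use deg card_light_common in auto)
qed

lemma card_long_walk_prefixes_le:
  assumes fin: "finite W" and W: "\<And>w. w \<in> W \<Longrightarrow> long_walk M v q x w" and deg: "\<And>y. card (nbrs y) \<le> \<Delta>"
  shows "card (butlast ` W) \<le> card (take 3 ` W) * \<Delta>"
proof (rule card_le_image_Sigma)
  show "butlast ` W \<subseteq> (\<lambda>(r, b). r @ [Middle b]) ` (SIGMA r : take 3 ` W. nbrs (rim_vertex (last r)))"
  proof clarify
    fix w assume w: "w \<in> W"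
    obtain b' p' u' b p u where eq: "w = [Spoked q x, Middle b', Spoked p' u', Middle b, Spoked p u]"
      and arc: "arc v p' u' b p u"
      using W[OF w] by (auto simp: long_walk_def)
    have "b \<in> nbrs u'" using light_pathD(3)[OF arcD(1)[OF arc]] by (simp add: nbrs_def)
    then show "butlast w \<in> (\<lambda>(r, b). r @ [Middle b]) ` (SIGMA r : take 3 ` W. nbrs (rim_vertex (last r)))"
      using imageI[OF w, of "take 3"] by (intro rev_image_eqI[of "(take 3 w, b)"]) (auto simp: eq)
  qed
qed (use fin deg in auto)

definition spoked_nodes :: "'a \<Rightarrow> 'a rim_node set" where
  "spoked_nodes v = (\<lambda>(p, u). Spoked p u) ` Sigma (nbrs v) nbrs"

lemma finite_spoked_nodes [simp]: "finite (spoked_nodes v)"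
  by (simp add: spoked_nodes_def)

lemma card_spoked_nodes_le: "(\<And>y. card (nbrs y) \<le> \<Delta>) \<Longrightarrow> card (spoked_nodes v) \<le> \<Delta> * \<Delta>"
  unfolding spoked_nodes_def by (rule card_le_image_Sigma[OF order_refl]) auto

lemma light_path_spoked_node: "light_path v p u b \<Longrightarrow> Spoked p u \<in> spoked_nodes v"
  by (force simp: spoked_nodes_def nbrs_def light_path_def)

lemma card_popular_prefixes_le:
  assumes no_wheel: "\<not> has_wheel adj k" and k: "3 \<le> k" and fin: "finite W"
    and W: "\<And>w. w \<in> W \<Longrightarrow> long_walk M v q x w"
  shows "card (crowded last (branching k) (butlast ` W)) \<le> 32 * k * card (take 3 ` W)"
proof -
  let ?F = "crowded last (branching k) (butlast ` W)"
  have F: "?F \<subseteq> butlast ` W" by (rule crowded_subset)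
  then have "finite ?F" using fin by (simp add: finite_subset)
  have "card ?F \<le> 32 * k * card (butlast ` ?F)"
  proof (rule ccontr)
    assume many_popular: "\<not> ?thesis"
    have "has_wheel adj k"
    proof (rule wheel_from_short_walks[OF \<open>finite ?F\<close>])
      show "branching k * card (last ` ?F) \<le> card ?F"
        using card_image_crowded_le[of "butlast ` W" last "branching k"] fin by (simp add: mult.commute)
      show "short_walk v q x w" if "w \<in> ?F" for w using that F W long_walk_rim_walk(5) by blast
    qed (use many_popular k in auto)
    then show False using no_wheel by blast
  qed
  also have "butlast ` ?F \<subseteq> take 3 ` W"
  proof clarify
    fix w assume "w \<in> ?F"
    then obtain w' where "w' \<in> W" "w = butlast w'" using F by blast
    then show "butlast w \<in> take 3 ` W"
      using long_walk_rim_walk(2)[OF W, of w'] by (intro rev_image_eqI[of w']) (simp_all add: butlast_conv_take)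
  qed
  then have "card (butlast ` ?F) \<le> card (take 3 ` W)" using fin by (intro card_mono) auto
  finally show ?thesis by simp
qed

text \<open>Most long walks do not run through a middle vertex reached from \<open>x\<close> by many walks, as the latter
  would already yield a wheel.\<close>

definition unpopular_walks :: "nat \<Rightarrow> 'a rim_node list set \<Rightarrow> 'a rim_node list set" where
  "unpopular_walks k W = {w \<in> W. butlast w \<notin> crowded last (branching k) (butlast ` W)}"

lemma card_unpopular_prefixes_le:
  assumes "finite W"
  shows "card {w \<in> butlast ` unpopular_walks k W. last w = n} \<le> branching k"
proof (rule order_trans[OF card_mono])
  show "card {w \<in> butlast ` W - crowded last (branching k) (butlast ` W). last w = n} \<le> branching k"
    using card_fibre_not_crowded_le[of "butlast ` W" "branching k" last n] assms by simp
qed (use assms in \<open>auto simp: unpopular_walks_def\<close>)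

lemma card_unpopular_walks_ge:
  assumes no_wheel: "\<not> has_wheel adj k" and k: "3 \<le> k" and fin: "finite W"
    and W: "\<And>w. w \<in> W \<Longrightarrow> long_walk M v q x w" and deg: "\<And>y. card (nbrs y) \<le> \<Delta>"
    and many: "192 * k * t * (\<Delta> * card (take 3 ` W)) \<le> card W"
  shows "2 * card W \<le> 3 * card (unpopular_walks k W)"
proof -
  let ?F = "crowded last (branching k) (butlast ` W)"
  let ?P = "W - unpopular_walks k W"
  have "finite ?F" using fin by (simp add: crowded_def)
  have "card ?P \<le> card (butlast ` ?P) * (\<Delta> * t)"
  proof (rule card_le_fibres[where 'c = nat, unfolded of_nat_id])
    show "card {w \<in> ?P. butlast w = w'} \<le> \<Delta> * t" for w'
      by (rule card_long_walk_extensions_le[OF W deg]) blast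
  qed (use fin in simp)
  also have "card (butlast ` ?P) \<le> card ?F"
    using \<open>finite ?F\<close> by (intro card_mono) (auto simp: unpopular_walks_def)
  also have "card ?F \<le> 32 * k * card (take 3 ` W)"
    by (rule card_popular_prefixes_le[OF no_wheel k fin W])
  finally have "card ?P \<le> 32 * k * card (take 3 ` W) * (\<Delta> * t)" by simp
  moreover have "6 * (32 * k * card (take 3 ` W) * (\<Delta> * t)) = 192 * k * t * (\<Delta> * card (take 3 ` W))"
    by (simp add: mult.commute mult.left_commute)
  moreover have "unpopular_walks k W \<subseteq> W" by (auto simp: unpopular_walks_def)
  ultimately show ?thesis
    using card_eq_card_plus_card_Diff[OF fin, of "unpopular_walks k W"] many by linarith
qed

definition long_branching :: "nat \<Rightarrow> nat \<Rightarrow> nat" where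
  "long_branching k M = 16 * k * (branching k + 2 * t * t) + (branching k + t * t * t + M * t)"

lemma long_branching_mult_le: "1 \<le> Q \<Longrightarrow> long_branching k (M * Q) \<le> long_branching k M * Q"
proof -
  assume "1 \<le> Q"
  then have "a + M * Q * t \<le> (a + M * t) * Q" for a
    using mult_le_mono2[of 1 Q a] by (simp add: algebra_simps)
  then show ?thesis unfolding long_branching_def add.assoc[symmetric] .
qed

lemma wheel_from_many_long_walks:
  assumes fin: "finite W" and W: "\<And>w. w \<in> W \<Longrightarrow> long_walk M v q x w" and k: "4 \<le> k" and "W \<noteq> {}"
    and deg: "\<And>y. card (nbrs y) \<le> \<Delta>"
    and many_starts: "192 * k * t * (\<Delta> * card (take 3 ` W)) \<le> card W"
    and many: "64 * k * long_branching k M * (\<Delta> * \<Delta>) \<le> card W"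
  shows "has_wheel adj k"
proof (rule ccontr)
  assume no_wheel: "\<not> has_wheel adj k"
  define W' where "W' = unpopular_walks k W"
  have W': "W' \<subseteq> W" "finite W'" using fin by (auto simp: W'_def unpopular_walks_def)
  have half: "2 * card W \<le> 3 * card W'"
    using card_unpopular_walks_ge[OF no_wheel _ fin W deg many_starts] k by (simp add: W'_def)
  have "has_wheel adj k"
  proof (rule wheel_from_long_walks[OF W'(2) _ k])
    show "long_walk M v q x w" if "w \<in> W'" for w using that W W'(1) by blast
    show "card {w \<in> butlast ` W'. last w = Middle z} \<le> branching k" for z
      unfolding W'_def by (rule card_unpopular_prefixes_le[OF fin])
    have "64 * k * t * card (butlast ` W') \<le> 64 * k * t * (card (take 3 ` W) * \<Delta>)"
      using fin W'(1)
      by (intro mult_le_mono2 order_trans[OF card_mono card_long_walk_prefixes_le[OF fin W deg]]) auto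
    moreover have "0 < card W" using fin \<open>W \<noteq> {}\<close> by (simp add: card_gt_0_iff)
    moreover have "3 * (64 * k * t * (card (take 3 ` W) * \<Delta>)) = 192 * k * t * (\<Delta> * card (take 3 ` W))"
      by (simp add: mult.commute)
    ultimately show "64 * k * t * card (butlast ` W') < card W'"
      using many_starts half by linarith
    have "last ` W' \<subseteq> spoked_nodes v"
      using W'(1) by (fastforce dest!: W arcD(2) light_path_spoked_node simp: long_walk_def)
    then have "32 * k * long_branching k M * card (last ` W') \<le> 32 * k * long_branching k M * (\<Delta> * \<Delta>)"
      by (intro mult_le_mono2 order_trans[OF card_mono card_spoked_nodes_le[OF deg]]) simp_all
    moreover have "2 * (32 * k * long_branching k M * (\<Delta> * \<Delta>)) \<le> card W" using many by (simp only: mult.assoc)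
    ultimately have "32 * k * long_branching k M * card (last ` W') \<le> card W'" using half by linarith
    then show "32 * k * (16 * k * (branching k + 2 * t * t) + (branching k + t * t * t + M * t)) *
        card (last ` W') \<le> card W'"
      unfolding long_branching_def .
  qed
  then show False using no_wheel by blast
qed

end

section \<open>Counting light paths of length three\<close>

context codegree_graph
begin

lemma wheel_from_heavy_clique:
  assumes T: "card T = Suc k" and heavy: "\<And>z w. z \<in> T \<Longrightarrow> w \<in> T \<Longrightarrow> z \<noteq> w \<Longrightarrow> heavy z w"
    and k: "2 \<le> k" and t: "3 * k + 1 \<le> t"
  shows "has_wheel adj k"
proof -
  have finT: "finite T" using T card.infinite by fastforce
  obtain h where h: "bij_betw h {..<Suc k} T"
    using ex_bij_betw_nat_finite[OF finT] T by (auto simp: atLeast0LessThan)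
  define W where "W = case_sum (\<lambda>i. nbrs (h k) \<inter> nbrs (h i)) (\<lambda>i. nbrs (h i) \<inter> nbrs (h (Suc i mod k)))"
  have hT: "h i \<in> T" if "i \<le> k" for i using h that by (auto simp: bij_betw_def)
  have h_neq: "h i \<noteq> h j" if "i \<le> k" "j \<le> k" "i \<noteq> j" for i j
    using h that by (auto simp: bij_betw_def inj_on_def less_Suc_eq_le)
  have codegree: "t \<le> card (nbrs (h i) \<inter> nbrs (h j))" if "i \<le> k" "j \<le> k" "i \<noteq> j" for i j
    using heavy[OF hT hT h_neq] that by (auto simp: heavy_def)
  have succ: "Suc i mod k < k" "Suc i mod k \<noteq> i" if "i < k" for i
    using that k by (auto simp: mod_Suc)
  let ?I = "{..<k} <+> {..<k}"
  have "t \<le> card (W (Inl i))" "t \<le> card (W (Inr i))" if "i < k" for i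
    using codegree[of k i] codegree[of i "Suc i mod k"] succ[OF that] that by (auto simp: W_def)
  moreover have "card T + card ?I \<le> t" using T t by (simp add: card_Plus)
  ultimately have "card T + card ?I \<le> card (W i)" if "i \<in> ?I" for i
    using that le_trans by blast
  then obtain c where c: "\<forall>i\<in>?I. c i \<in> W i - T" "inj_on c ?I"
    using exists_distinct_representatives[of ?I T W] finT by auto
  define p b where "p = c \<circ> Inl" and "b = c \<circ> Inr"
  have p: "p i \<in> nbrs (h k)" "p i \<in> nbrs (h i)" "p i \<notin> T"
    and b: "b i \<in> nbrs (h i)" "b i \<in> nbrs (h (Suc i mod k))" "b i \<notin> T" if "i < k" for i
    using c(1)[rule_format, of "Inl i"] c(1)[rule_format, of "Inr i"] that by (auto simp: W_def p_def b_def)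
  have "p i \<noteq> b j" if "i < k" "j < k" for i j
    using c(2) that by (auto simp: p_def b_def inj_on_def)
  moreover have "inj_on p {..<k}" "inj_on b {..<k}"
    using c(2) by (auto simp: p_def b_def inj_on_def)
  moreover have "inj_on h {..<k}" using h by (auto simp: bij_betw_def inj_on_def)
  moreover have "h i \<noteq> p j \<and> h i \<noteq> b j" if "i \<le> k" "j < k" for i j
    using that hT p(3) b(3) by metis
  ultimately have "distinct (h k # map h [0..<k] @ map p [0..<k] @ map b [0..<k])"
    unfolding distinct_wheel_iff using h_neq[of k] by auto
  moreover have "adj (h k) (p i) \<and> adj (p i) (h i) \<and> adj (h i) (b i) \<and> adj (b i) (h (Suc i mod k))"
    if "i < k" for i
    using p[OF that] b[OF that] adj_commute by (auto simp: nbrs_def)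
  ultimately show ?thesis unfolding has_wheel_def by blast
qed

definition light_nbrs :: "'a \<Rightarrow> 'a \<Rightarrow> 'a set" where
  "light_nbrs p u = {w \<in> nbrs p. light u w}"

definition rich_edges :: "nat \<Rightarrow> ('a \<times> 'a) set" where
  "rich_edges d = {(p, u). adj p u \<and> d \<le> card (light_nbrs p u) \<and> d \<le> card (light_nbrs u p)}"

definition light_path_count :: nat where
  "light_path_count = (\<Sum>w\<in>V \<times> V. card (light_paths (fst w) (snd w)))"

lemma finite_light_nbrs [simp]: "finite (light_nbrs p u)"
  by (simp add: light_nbrs_def)

lemma finite_rich_edges: "finite (rich_edges d)"
  by (rule finite_subset[of _ "V \<times> V"]) (use finite_V adj_in_V in \<open>auto simp: rich_edges_def\<close>)

lemma card_few_light_le: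
  assumes no_wheel: "\<not> has_wheel adj k" and k: "2 \<le> k" and t: "3 * k + 1 \<le> t" and S: "finite S"
  shows "card {u \<in> S. card {w \<in> S. light u w} < d} \<le> k * d"
proof (rule ccontr)
  define B where "B = {u \<in> S. card {w \<in> S. light u w} < d}"
  assume "\<not> card {u \<in> S. card {w \<in> S. light u w} < d} \<le> k * d"
  then have many: "k * d < card B" by (simp add: B_def)
  have "\<exists>T\<subseteq>B. card T = Suc k \<and> (\<forall>z\<in>T. \<forall>w\<in>T. z \<noteq> w \<longrightarrow> \<not> \<not> heavy z w)"
  proof (rule exists_pairwise_unrelated[OF _ _ _ _ many])
    show "finite B" using S by (simp add: B_def)
    fix z assume z: "z \<in> B"
    have "card {w \<in> B. \<not> heavy z w} \<le> card (insert z {w \<in> S. light z w})"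
      using S by (intro card_mono) (auto simp: light_def B_def)
    also have "\<dots> \<le> Suc (card {w \<in> S. light z w})" by (rule card_insert_le_m1) (auto simp: S)
    also have "\<dots> \<le> d" using z by (auto simp: B_def)
    finally show "card {w \<in> B. \<not> heavy z w} \<le> d" .
  qed (auto simp: heavy_commute heavy_def)
  then show False using wheel_from_heavy_clique[OF _ _ k t] no_wheel by blast
qed

lemma card_rich_edges_ge:
  assumes no_wheel: "\<not> has_wheel adj k" and k: "2 \<le> k" and t: "3 * k + 1 \<le> t"
    and deg: "\<And>y. y \<in> V \<Longrightarrow> \<delta> \<le> card (nbrs y)" and d: "4 * k * d \<le> \<delta>"
  shows "card V * \<delta> \<le> 2 * card (rich_edges d)"
proof -
  define poor where "poor = (SIGMA p:V. {u \<in> nbrs p. card (light_nbrs p u) < d})"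
  have "finite poor" using finite_V by (simp add: poor_def)
  have "card poor \<le> card V * (k * d)"
    unfolding poor_def using finite_V card_few_light_le[OF no_wheel k t]
    by (intro card_le_image_Sigma[of _ id V "\<lambda>p. {u \<in> nbrs p. card (light_nbrs p u) < d}"])
      (auto simp: light_nbrs_def)
  moreover have "card (prod.swap ` poor) \<le> card poor" using \<open>finite poor\<close> by (rule card_image_le)
  moreover have "card V * \<delta> \<le> card (SIGMA p:V. nbrs p)"
    using finite_V deg by (intro card_Sigma_ge) auto
  moreover have "card (SIGMA p:V. nbrs p) \<le> card (rich_edges d \<union> (poor \<union> prod.swap ` poor))"
  proof (rule card_mono)
    show "(SIGMA p:V. nbrs p) \<subseteq> rich_edges d \<union> (poor \<union> prod.swap ` poor)"
    proof (rule subrelI)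
      fix p u assume "(p, u) \<in> (SIGMA p:V. nbrs p)"
      then have "p \<in> V" "u \<in> V" "adj p u" "adj u p" using adj_sym adj_in_V by (auto simp: nbrs_def)
      then have "(p, u) \<in> rich_edges d \<or> (p, u) \<in> poor \<or> (u, p) \<in> poor"
        by (auto simp: rich_edges_def poor_def nbrs_def)
      then show "(p, u) \<in> rich_edges d \<union> (poor \<union> prod.swap ` poor)" by force
    qed
  qed (use finite_rich_edges \<open>finite poor\<close> in simp)
  moreover have "\<dots> \<le> card (rich_edges d) + (card poor + card (prod.swap ` poor))"
    using card_Un_le[of "rich_edges d" "poor \<union> prod.swap ` poor"] card_Un_le[of poor "prod.swap ` poor"]
    by linarith
  moreover have "4 * (card V * (k * d)) \<le> card V * \<delta>"
    using mult_le_mono2[OF d, of "card V"] by (simp add: algebra_simps)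
  ultimately show ?thesis by linarith
qed

lemma light_path_count_ge_rich_edges: "card (rich_edges d) * (d * (d - 1)) \<le> light_path_count"
proof -
  let ?L = "\<lambda>(p, u). SIGMA v:light_nbrs p u. light_nbrs u p - {v}"
  have "card (rich_edges d) * (d * (d - 1)) \<le> card (SIGMA g:rich_edges d. ?L g)"
  proof (intro card_Sigma_ge finite_rich_edges)
    fix g assume "g \<in> rich_edges d"
    then show "finite (?L g) \<and> d * (d - 1) \<le> card (?L g)"
      using card_distinct_pairs_ge[of "light_nbrs (fst g) (snd g)" "light_nbrs (snd g) (fst g)" d]
      by (auto simp: rich_edges_def simp del: card_SigmaI)
  qed
  also have "\<dots> \<le> card (SIGMA w:V \<times> V. light_paths (fst w) (snd w))"
  proof (rule card_inj_on_le[where f = prod.swap])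
    show "prod.swap ` (SIGMA g:rich_edges d. ?L g) \<subseteq> (SIGMA w:V \<times> V. light_paths (fst w) (snd w))"
      using adj_in_V
      by (auto simp: rich_edges_def light_nbrs_def nbrs_def light_paths_def light_path_def
          adj_commute light_commute)
  qed (use finite_V in \<open>auto simp: inj_on_def\<close>)
  also have "\<dots> = light_path_count"
    unfolding light_path_count_def using finite_V by (intro card_SigmaI) auto
  finally show ?thesis .
qed

lemma light_path_count_ge:
  assumes "\<not> has_wheel adj k" "2 \<le> k" "3 * k + 1 \<le> t"
    and "\<And>y. y \<in> V \<Longrightarrow> \<delta> \<le> card (nbrs y)" "4 * k * d \<le> \<delta>"
  shows "card V * \<delta> * (d * (d - 1)) \<le> 2 * light_path_count"
proof -
  have "card V * \<delta> * (d * (d - 1)) \<le> 2 * card (rich_edges d) * (d * (d - 1))"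
    using card_rich_edges_ge[OF assms] by (rule mult_le_mono1)
  then show ?thesis using light_path_count_ge_rich_edges[of d] unfolding mult.assoc by linarith
qed

text \<open>Two light paths between \<open>x\<close> and \<open>y\<close> are given by their inner vertices. If they are compatible,
  they form arcs with hub \<open>y\<close> as well as with hub \<open>x\<close>.\<close>

definition compatible :: "'a \<times> 'a \<Rightarrow> 'a \<times> 'a \<Rightarrow> bool" where
  "compatible z w \<longleftrightarrow> light (fst z) (fst w) \<and> light (snd z) (snd w) \<and> fst z \<noteq> snd w \<and> snd z \<noteq> fst w"

definition clashing :: "'a \<times> 'a \<Rightarrow> 'a \<times> 'a \<Rightarrow> bool" where
  "clashing z w \<longleftrightarrow> fst z \<noteq> fst w \<and> snd z \<noteq> snd w \<and> fst z \<noteq> snd w \<and> snd z \<noteq> fst w \<and>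
     (heavy (fst z) (fst w) \<or> heavy (snd z) (snd w))"

lemma clashing_commute: "clashing z w \<longleftrightarrow> clashing w z"
  unfolding clashing_def by (auto simp: heavy_commute)

lemma card_clashing_family_less:
  assumes no_wheel: "\<not> has_wheel adj k" and k: "2 \<le> k" and t: "3 * k + 1 \<le> t" and "finite T"
    and clash: "\<And>z w. z \<in> T \<Longrightarrow> w \<in> T \<Longrightarrow> z \<noteq> w \<Longrightarrow> clashing z w"
  shows "card T < ramsey_number (Suc k)"
proof (rule ccontr)
  assume "\<not> ?thesis"
  then obtain R where R: "R \<subseteq> T" "card R = Suc k"
    "(\<forall>z\<in>R. \<forall>w\<in>R. z \<noteq> w \<longrightarrow> heavy (fst z) (fst w)) \<or> (\<forall>z\<in>R. \<forall>w\<in>R. z \<noteq> w \<longrightarrow> \<not> heavy (fst z) (fst w))"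
    using ramsey_relation[OF \<open>finite T\<close>, of "Suc k" "\<lambda>z w. heavy (fst z) (fst w)"] heavy_commute
    by (auto simp: not_less)
  have no_heavy_image: False
    if "inj_on f R" "\<And>z w. z \<in> R \<Longrightarrow> w \<in> R \<Longrightarrow> z \<noteq> w \<Longrightarrow> heavy (f z) (f w)" for f
  proof -
    have "has_wheel adj k"
      by (rule wheel_from_heavy_clique[of "f ` R", OF _ _ k t]) (use that R(2) in \<open>auto simp: card_image\<close>)
    then show False using no_wheel by blast
  qed
  have "inj_on fst R" "inj_on snd R"
    using clash R(1) by (auto simp: inj_on_def clashing_def) blast+
  with R clash no_heavy_image[of fst] no_heavy_image[of snd] show False
    unfolding clashing_def by blast
qed

lemma card_mostly_clashing_le:
  assumes no_wheel: "\<not> has_wheel adj k" and k: "2 \<le> k" and t: "3 * k + 1 \<le> t" and Z: "finite Z"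
  shows "card {z \<in> Z. card {w \<in> Z. \<not> clashing z w} \<le> d} \<le> ramsey_number (Suc k) * d"
proof (rule ccontr)
  let ?B = "{z \<in> Z. card {w \<in> Z. \<not> clashing z w} \<le> d}"
  assume "\<not> ?thesis"
  then have many: "ramsey_number (Suc k) * d < card ?B" by simp
  have "\<exists>T\<subseteq>?B. card T = Suc (ramsey_number (Suc k)) \<and> (\<forall>z\<in>T. \<forall>w\<in>T. z \<noteq> w \<longrightarrow> \<not> \<not> clashing z w)"
  proof (rule exists_pairwise_unrelated[OF _ _ _ _ many])
    show "finite ?B" using Z by simp
    fix z assume z: "z \<in> ?B"
    have "card {w \<in> ?B. \<not> clashing z w} \<le> card {w \<in> Z. \<not> clashing z w}"
      using Z by (intro card_mono) auto
    then show "card {w \<in> ?B. \<not> clashing z w} \<le> d" using z by simp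
    show "\<not> clashing z z" by (simp add: clashing_def)
  qed (simp add: clashing_commute)
  then obtain T where T: "T \<subseteq> ?B" "card T = Suc (ramsey_number (Suc k))"
    "\<And>z w. z \<in> T \<Longrightarrow> w \<in> T \<Longrightarrow> z \<noteq> w \<Longrightarrow> clashing z w"
    by blast
  have "finite T" using T(2) card.infinite by fastforce
  then show False using card_clashing_family_less[OF no_wheel k t \<open>finite T\<close> T(3)] T(2) by simp
qed

lemma card_not_clashing_le:
  "card {w \<in> light_paths x y. \<not> clashing z w} \<le> card {w \<in> light_paths x y. compatible z w} + 4 * t"
proof -
  obtain b u where z: "z = (b, u)" by (rule prod.exhaust)
  let ?C = "{w \<in> light_paths x y. compatible z w}"
  define A where "A = Pair b ` light_common b y \<union> Pair u ` light_common u y"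
  define B where "B = (\<lambda>c. (c, u)) ` light_common x u \<union> (\<lambda>c. (c, b)) ` light_common x b"
  have "{w \<in> light_paths x y. \<not> clashing z w} \<subseteq> ?C \<union> (A \<union> B)"
  proof (intro subsetI UnCI)
    fix w assume "w \<in> {w \<in> light_paths x y. \<not> clashing z w}" "w \<notin> A \<union> B"
    then obtain c d where w: "w = (c, d)" "(c, d) \<in> light_paths x y" "\<not> clashing z (c, d)" "(c, d) \<notin> A \<union> B"
      by (cases w) auto
    have "c \<in> light_common x d" "d \<in> light_common c y"
      using w(2) light_pathD(10,11) by (auto simp: light_paths_def)
    then have "b \<noteq> c" "u \<noteq> d" "b \<noteq> d" "u \<noteq> c" using w(4) by (auto simp: A_def B_def)
    then have "compatible z (c, d)" using w(3) by (auto simp: z clashing_def compatible_def light_def)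
    then show "w \<in> ?C" using w(1,2) by blast
  qed
  then have "card {w \<in> light_paths x y. \<not> clashing z w} \<le> card (?C \<union> (A \<union> B))"
    by (intro card_mono) (auto simp: A_def B_def)
  also have "\<dots> \<le> card ?C + (card A + card B)"
    using card_Un_le[of ?C "A \<union> B"] card_Un_le[of A B] by linarith
  also have "card A \<le> 2 * t" unfolding A_def by (rule card_Un_light_common_le[OF order_refl])
  also have "card B \<le> 2 * t" unfolding B_def by (rule card_Un_light_common_le[OF order_refl])
  finally show ?thesis by simp
qed

definition compatible_pairs :: "'a \<Rightarrow> 'a \<Rightarrow> (('a \<times> 'a) \<times> 'a \<times> 'a) set" where
  "compatible_pairs x y = (SIGMA z:light_paths x y. {w \<in> light_paths x y. compatible z w})"

lemma finite_compatible_pairs [simp]: "finite (compatible_pairs x y)"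
  by (simp add: compatible_pairs_def)

lemma card_compatible_pairs_ge:
  assumes no_wheel: "\<not> has_wheel adj k" and k: "2 \<le> k" and t: "3 * k + 1 \<le> t"
    and many: "16 * t * ramsey_number (Suc k) \<le> card (light_paths x y)"
  shows "card (light_paths x y) * card (light_paths x y) \<le>
    16 * ramsey_number (Suc k) * card (compatible_pairs x y)"
proof -
  define r where "r = ramsey_number (Suc k)"
  define Z where "Z = light_paths x y"
  define d where "d = card Z div (2 * r)"
  define B where "B = {z \<in> Z. card {w \<in> Z. \<not> clashing z w} \<le> d}"
  have r: "0 < r" using le_ramsey_number[of "Suc k"] by (simp add: r_def)
  have finZ: "finite Z" by (simp add: Z_def)
  have "d - 4 * t \<le> card {w \<in> Z. compatible z w}" if "z \<in> Z - B" for z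
    using that card_not_clashing_le[of x y z] by (auto simp: B_def Z_def)
  then have "card (Z - B) * (d - 4 * t) \<le> card (SIGMA z:Z - B. {w \<in> Z. compatible z w})"
    using finZ by (intro card_Sigma_ge) auto
  also have "\<dots> \<le> card (compatible_pairs x y)"
    by (intro card_mono) (auto simp: compatible_pairs_def Z_def)
  finally have pairs: "card (Z - B) * (d - 4 * t) \<le> card (compatible_pairs x y)" .
  have "card B \<le> r * d" unfolding B_def r_def by (rule card_mostly_clashing_le[OF no_wheel k t finZ])
  moreover have "2 * (r * d) \<le> card Z"
    using div_times_less_eq_dividend[of "card Z" "2 * r"] by (simp add: d_def mult_ac)
  moreover have "card Z = card B + card (Z - B)"
    by (rule card_eq_card_plus_card_Diff[OF finZ]) (auto simp: B_def)
  ultimately have half: "card Z \<le> 2 * card (Z - B)" by linarith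
  have d_large: "8 * t \<le> d"
    unfolding d_def using many r by (simp add: less_eq_div_iff_mult_less_eq Z_def r_def algebra_simps)
  have "card Z < 2 * r * (d + 1)"
    unfolding d_def using r dividend_less_times_div[of "2 * r" "card Z"] by (simp add: algebra_simps)
  also have "\<dots> \<le> 2 * r * (2 * d)"
    using d_large t by (intro mult_le_mono2) simp
  also have "\<dots> \<le> 2 * r * (2 * (2 * (d - 4 * t)))"
    using d_large by (intro mult_le_mono2) simp
  finally have "card Z * card Z \<le> 2 * card (Z - B) * (8 * r * (d - 4 * t))"
    using half by (intro mult_le_mono) simp_all
  also have "\<dots> = 16 * r * (card (Z - B) * (d - 4 * t))" by simp
  also have "\<dots> \<le> 16 * r * card (compatible_pairs x y)" using pairs by (rule mult_le_mono2)
  finally show ?thesis by (simp add: Z_def r_def)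
qed

end

section \<open>Wheel-free graphs of bounded degree\<close>

lemma cube_le_of_cubic_bounds:
  fixes n x b L B D :: real
  assumes pos: "0 < n" "0 < x" "0 \<le> b" "0 \<le> B" "0 \<le> D"
    and L: "n * x ^ 3 \<le> b * L" "L \<le> B * n\<^sup>2 \<or> L ^ 3 \<le> D * (n ^ 4 * x ^ 6)"
  shows "x ^ 3 \<le> B * b * n + D * b ^ 3 * n"
  using L(2)
proof
  assume "L \<le> B * n\<^sup>2"
  then have "b * L \<le> b * (B * n\<^sup>2)" using pos by (intro mult_left_mono)
  then have "n * x ^ 3 \<le> n * (B * b * n)" using L(1) by (simp add: power2_eq_square mult_ac)
  then have "x ^ 3 \<le> B * b * n" using pos by simp
  also have "\<dots> \<le> B * b * n + D * b ^ 3 * n" using pos by simp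
  finally show ?thesis .
next
  assume "L ^ 3 \<le> D * (n ^ 4 * x ^ 6)"
  then have "b ^ 3 * L ^ 3 \<le> b ^ 3 * (D * (n ^ 4 * x ^ 6))" using pos by (intro mult_left_mono) auto
  moreover have "(n * x ^ 3) ^ 3 \<le> (b * L) ^ 3" using L(1) pos by (intro power_mono) auto
  ultimately have "n ^ 3 * x ^ 6 * x ^ 3 \<le> n ^ 3 * x ^ 6 * (D * b ^ 3 * n)"
    by (simp add: power_mult_distrib mult_ac eval_nat_numeral)
  then have "x ^ 3 \<le> D * b ^ 3 * n" by (rule mult_left_le_imp_le) (use pos in simp)
  also have "\<dots> \<le> B * b * n + D * b ^ 3 * n" using pos by simp
  finally show ?thesis .
qed

context codegree_graph
begin

definition arcs :: "'a \<Rightarrow> 'a rim_node list set" where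
  "arcs v = {[Spoked p u, Middle b, Spoked p' u'] | p u b p' u'. arc v p u b p' u'}"

definition good_arcs :: "nat \<Rightarrow> 'a \<Rightarrow> 'a rim_node list set" where
  "good_arcs M v = {w \<in> arcs v. card (light_paths (rim_vertex (hd w)) (spoke_vertex (last w))) \<le> M}"

lemma finite_arcs [simp]: "finite (arcs v)"
proof (rule finite_subset)
  show "arcs v \<subseteq> (\<lambda>(p, u, b, p', u'). [Spoked p u, Middle b, Spoked p' u']) ` (V \<times> V \<times> V \<times> V \<times> V)"
  proof
    fix w assume "w \<in> arcs v"
    then obtain p u b p' u' where "w = [Spoked p u, Middle b, Spoked p' u']" "arc v p u b p' u'"
      by (auto simp: arcs_def)
    then show "w \<in> (\<lambda>(p, u, b, p', u'). [Spoked p u, Middle b, Spoked p' u']) ` (V \<times> V \<times> V \<times> V \<times> V)"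
      using arc_in_V by (intro rev_image_eqI[of "(p, u, b, p', u')"]) auto
  qed
qed (use finite_V in simp)

lemma finite_good_arcs [simp]: "finite (good_arcs M v)"
  by (simp add: good_arcs_def)

lemma rev_arcs: "w \<in> arcs v \<Longrightarrow> rev w \<in> arcs v"
  by (auto simp: arcs_def arc_commute)

lemma arcs_ends: "w \<in> arcs v \<Longrightarrow> hd w \<in> spoked_nodes v \<and> last w \<in> spoked_nodes v"
  by (auto simp: arcs_def dest: light_path_spoked_node[OF arcD(1)] light_path_spoked_node[OF arcD(2)])

lemma exists_root_of_many_arcs:
  fixes W :: real
  assumes deg: "\<And>y. card (nbrs y) \<le> \<Delta>" and W: "0 < W" and many: "2 * W * (real \<Delta>)\<^sup>2 < card (good_arcs M v)"
  obtains n where "W < card {w \<in> good_arcs M v. hd w = n \<and> W < card {w' \<in> arcs v. hd w' = last w}}"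
proof -
  let ?A = "good_arcs M v"
  have few_ends: "card (f ` Y) * W \<le> (real \<Delta>)\<^sup>2 * W" if "f ` Y \<subseteq> spoked_nodes v"
    for f and Y :: "'a rim_node list set"
  proof -
    have "card (f ` Y) \<le> \<Delta> * \<Delta>"
      using that by (intro order_trans[OF card_mono card_spoked_nodes_le[OF deg]]) simp_all
    then have "real (card (f ` Y)) \<le> real (\<Delta> * \<Delta>)" by (simp only: of_nat_le_iff)
    then show ?thesis using W by (simp add: power2_eq_square)
  qed
  have "card (?A - crowded last W ?A) \<le> card (last ` ?A) * W"
    using W by (intro card_not_crowded_le) auto
  also have "\<dots> \<le> (real \<Delta>)\<^sup>2 * W"
    using arcs_ends by (intro few_ends) (auto simp: good_arcs_def)
  finally have "(real \<Delta>)\<^sup>2 * W < card (crowded last W ?A)"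
    using many card_eq_card_plus_card_Diff[of ?A "crowded last W ?A"] crowded_subset[of last W ?A]
    by (simp add: algebra_simps)
  moreover have "card (hd ` crowded last W ?A) * W \<le> (real \<Delta>)\<^sup>2 * W"
    using arcs_ends by (intro few_ends) (auto simp: good_arcs_def crowded_def)
  ultimately have "card (hd ` crowded last W ?A) * W < card (crowded last W ?A)" by linarith
  then obtain n where n: "W < card {w \<in> crowded last W ?A. hd w = n}"
    using exists_large_fibre[of "crowded last W ?A" hd W] crowded_subset[of last W ?A] finite_subset[of _ ?A]
    by auto
  have out: "card {w' \<in> ?A. last w' = m} \<le> card {w' \<in> arcs v. hd w' = m}" for m
    by (rule card_inj_on_le[of rev]) (auto simp: good_arcs_def rev_arcs hd_rev)
  have "{w \<in> crowded last W ?A. hd w = n} \<subseteq>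
      {w \<in> ?A. hd w = n \<and> W < card {w' \<in> arcs v. hd w' = last w}}"
  proof clarify
    fix w assume "w \<in> crowded last W ?A" "n = hd w"
    then show "w \<in> ?A \<and> hd w = hd w \<and> W < card {w' \<in> arcs v. hd w' = last w}"
      using out[of "last w"] by (auto simp: crowded_def)
  qed
  then have "card {w \<in> crowded last W ?A. hd w = n} \<le>
      card {w \<in> ?A. hd w = n \<and> W < card {w' \<in> arcs v. hd w' = last w}}"
    by (intro card_mono) auto
  then show thesis using n that[of n] by linarith
qed

lemma card_arcs_with_middle_le:
  assumes deg: "\<And>y. card (nbrs y) \<le> \<Delta>"
  shows "card {w \<in> arcs v. hd w = n \<and> w ! 1 = Middle b} \<le> \<Delta> * t"
proof -
  have "{w \<in> arcs v. hd w = n \<and> w ! 1 = Middle b} \<subseteq>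
      (\<lambda>(u, p). [n, Middle b, Spoked p u]) ` (SIGMA u : nbrs b. light_common v u)"
  proof clarify
    fix w assume w: "w \<in> arcs v" "w ! 1 = Middle b" "n = hd w"
    then obtain p u p' u' where eq: "w = [Spoked p u, Middle b, Spoked p' u']" and arc: "arc v p u b p' u'"
      by (auto simp: arcs_def)
    show "w \<in> (\<lambda>(u, p). [hd w, Middle b, Spoked p u]) ` (SIGMA u : nbrs b. light_common v u)"
      using light_pathD(3,10)[OF arcD(2)[OF arc]]
      by (intro rev_image_eqI[of "(u', p')"]) (auto simp: eq nbrs_def adj_commute)
  qed
  then show ?thesis by (rule card_le_image_Sigma) (use deg card_light_common in auto)
qed

definition extensions :: "'a \<Rightarrow> 'a rim_node list \<Rightarrow> 'a rim_node list set" where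
  "extensions v w = {w' \<in> arcs v. hd w' = last w \<and> w' ! 1 \<noteq> w ! 1}"

lemma long_walk_append_extension:
  assumes "w \<in> good_arcs M v" "hd w = Spoked q x" "w' \<in> extensions v w"
  shows "long_walk M v q x (w @ tl w')" "take 3 (w @ tl w') = w" "last w # drop 3 (w @ tl w') = w'"
  using assms by (auto simp: good_arcs_def extensions_def arcs_def long_walk_def)

lemma card_extensions_ge:
  assumes deg: "\<And>y. card (nbrs y) \<le> \<Delta>" and "w \<in> arcs v"
  shows "card {w' \<in> arcs v. hd w' = last w} \<le> card (extensions v w) + \<Delta> * t"
proof -
  obtain b where b: "w ! 1 = Middle b" using \<open>w \<in> arcs v\<close> by (auto simp: arcs_def)
  let ?B = "{w' \<in> arcs v. hd w' = last w \<and> w' ! 1 = Middle b}"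
  have "{w' \<in> arcs v. hd w' = last w} = extensions v w \<union> ?B"
    by (auto simp: extensions_def b simp del: One_nat_def)
  then have "card {w' \<in> arcs v. hd w' = last w} \<le> card (extensions v w) + card ?B"
    by (simp only: card_Un_le)
  then show ?thesis using card_arcs_with_middle_le[OF deg, of v "last w" b] by linarith
qed

definition slack :: "nat \<Rightarrow> nat" where
  "slack k = 256 * k * long_branching k 4 + (384 * k * t)\<^sup>2"

lemma slack_bounds:
  fixes W :: real
  assumes W: "0 < W" "real (slack k * Q * \<Delta>\<^sup>2) \<le> W\<^sup>2" and Q: "1 \<le> Q"
  shows "real (384 * k * t * \<Delta>) \<le> W"
    "real (256 * k * long_branching k (4 * Q) * \<Delta>\<^sup>2) \<le> W\<^sup>2"
proof -
  have le_W: "real a \<le> W\<^sup>2" if "a \<le> slack k * Q * \<Delta>\<^sup>2" for a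
    using that W(2) by (meson of_nat_le_iff order_trans)
  have "(384 * k * t)\<^sup>2 * 1 * \<Delta>\<^sup>2 \<le> slack k * Q * \<Delta>\<^sup>2"
    using Q by (intro mult_le_mono) (auto simp: slack_def)
  then have "real ((384 * k * t)\<^sup>2 * 1 * \<Delta>\<^sup>2) \<le> W\<^sup>2" by (rule le_W)
  then have "(real (384 * k * t * \<Delta>))\<^sup>2 \<le> W\<^sup>2" by (simp add: power_mult_distrib)
  then show "real (384 * k * t * \<Delta>) \<le> W"
    by (rule power2_le_imp_le) (rule less_imp_le[OF W(1)])
  have "256 * k * long_branching k (4 * Q) * \<Delta>\<^sup>2 \<le> 256 * k * (long_branching k 4 * Q) * \<Delta>\<^sup>2"
    by (intro mult_le_mono1 mult_le_mono2 long_branching_mult_le Q)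
  also have "\<dots> = 256 * k * long_branching k 4 * Q * \<Delta>\<^sup>2"
    by (simp only: mult.assoc)
  also have "\<dots> \<le> slack k * Q * \<Delta>\<^sup>2"
    by (intro mult_le_mono1) (simp add: slack_def)
  finally show "real (256 * k * long_branching k (4 * Q) * \<Delta>\<^sup>2) \<le> W\<^sup>2"
    by (rule le_W)
qed

lemma exists_many_long_walks:
  fixes W :: real
  assumes deg: "\<And>y. card (nbrs y) \<le> \<Delta>" and W: "0 < W" "2 * real (\<Delta> * t) \<le> W"
    and many: "2 * W * (real \<Delta>)\<^sup>2 < card (good_arcs M v)"
  obtains q x L where "finite L" "\<And>w. w \<in> L \<Longrightarrow> long_walk M v q x w"
    "W < card (take 3 ` L)" "card (take 3 ` L) * W \<le> 2 * card L"
proof -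
  obtain n where n: "W < card {w \<in> good_arcs M v. hd w = n \<and> W < card {w' \<in> arcs v. hd w' = last w}}"
    using exists_root_of_many_arcs[OF deg W(1) many] by blast
  define R where "R = {w \<in> good_arcs M v. hd w = n \<and> W < card {w' \<in> arcs v. hd w' = last w}}"
  have "finite R" by (simp add: R_def)
  have "R \<noteq> {}" using n W(1) unfolding R_def[symmetric] by auto
  then obtain q x where qx: "n = Spoked q x" by (auto simp: R_def good_arcs_def arcs_def)
  define L where "L = (\<lambda>(w, w'). w @ tl w') ` Sigma R (extensions v)"
  have ext: "W \<le> 2 * card (extensions v w)" if "w \<in> R" for w
  proof -
    have "w \<in> arcs v" "W < card {w' \<in> arcs v. hd w' = last w}" using that by (auto simp: R_def good_arcs_def)
    then show ?thesis using card_extensions_ge[OF deg, of w v] W(2) by linarith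
  qed
  have fin: "finite (extensions v w)" for w by (simp add: extensions_def)
  have long: "long_walk M v q x (w @ tl w')" "take 3 (w @ tl w') = w" "last w # drop 3 (w @ tl w') = w'"
    if "w \<in> R" "w' \<in> extensions v w" for w w'
    using long_walk_append_extension[of w M v q x w'] that qx by (auto simp: R_def)
  have "inj_on (\<lambda>(w, w'). w @ tl w') (Sigma R (extensions v))"
    by (auto simp: inj_on_def) (metis long(2), metis long(2,3))
  then have "card L = (\<Sum>w\<in>R. card (extensions v w))"
    using \<open>finite R\<close> fin by (simp add: L_def card_image)
  then have "2 * real (card L) = (\<Sum>w\<in>R. 2 * real (card (extensions v w)))"
    by (simp add: sum_distrib_left)
  then have "card R * W \<le> 2 * card L"
    using sum_bounded_below[of R W "\<lambda>w. 2 * real (card (extensions v w))"] ext by simp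
  moreover have "take 3 ` L = R"
  proof
    show "take 3 ` L \<subseteq> R" using long(2) by (auto simp: L_def)
    show "R \<subseteq> take 3 ` L"
    proof
      fix w assume w: "w \<in> R"
      then have "extensions v w \<noteq> {}" using ext[OF w] W(1) by auto
      then obtain w' where "w' \<in> extensions v w" by blast
      with w show "w \<in> take 3 ` L"
        using long(2) by (intro image_eqI[of _ _ "w @ tl w'"]) (force simp: L_def)+
    qed
  qed
  moreover have "finite L" using \<open>finite R\<close> fin by (simp add: L_def)
  moreover have "long_walk M v q x w" if "w \<in> L" for w using that long(1) by (auto simp: L_def)
  ultimately show thesis using that n unfolding R_def[symmetric] by metis
qed

lemma wheel_from_good_arcs:
  fixes W :: real
  assumes k: "4 \<le> k" and Q: "1 \<le> Q" and deg: "\<And>y. card (nbrs y) \<le> \<Delta>"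
    and W: "0 < W" "real (slack k * Q * \<Delta>\<^sup>2) \<le> W\<^sup>2"
    and many: "2 * W * (real \<Delta>)\<^sup>2 < card (good_arcs (4 * Q) v)"
  shows "has_wheel adj k"
proof -
  note large = slack_bounds[OF W Q]
  have "2 * (\<Delta> * t) \<le> 384 * k * t * \<Delta>"
    using k mult_le_mono1[of 1 "192 * k" "t * \<Delta>"] by (simp add: algebra_simps)
  then have "2 * real (\<Delta> * t) \<le> W" using large(1) by linarith
  then obtain q x L where L: "finite L" "\<And>w. w \<in> L \<Longrightarrow> long_walk (4 * Q) v q x w"
    "W < card (take 3 ` L)" "card (take 3 ` L) * W \<le> 2 * card L"
    using exists_many_long_walks[OF deg W(1) _ many] by metis
  have "W * W \<le> card (take 3 ` L) * W" using L(3) W(1) by (intro mult_right_mono) auto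
  then have "W\<^sup>2 \<le> 2 * card L" using L(4) by (simp add: power2_eq_square)
  show ?thesis
  proof (rule wheel_from_many_long_walks[OF L(1,2) k _ deg])
    show "L \<noteq> {}" using L(3) W(1) by auto
    have "card (take 3 ` L) * real (384 * k * t * \<Delta>) \<le> card (take 3 ` L) * W"
      using large(1) by (intro mult_left_mono) simp_all
    also have "card (take 3 ` L) * real (384 * k * t * \<Delta>) = 2 * real (192 * k * t * (\<Delta> * card (take 3 ` L)))"
      by simp
    finally have "real (192 * k * t * (\<Delta> * card (take 3 ` L))) \<le> card L"
      using L(4) by simp
    then show "192 * k * t * (\<Delta> * card (take 3 ` L)) \<le> card L"
      by (simp only: of_nat_le_iff)
    have "real (256 * k * long_branching k (4 * Q) * \<Delta>\<^sup>2) \<le> real (2 * card L)"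
      using large(2) \<open>W\<^sup>2 \<le> 2 * card L\<close> by linarith
    then have "256 * k * long_branching k (4 * Q) * \<Delta>\<^sup>2 \<le> 2 * card L" by (simp only: of_nat_le_iff)
    moreover have "64 * k * a * (\<Delta> * \<Delta>) \<le> l" if "256 * k * a * \<Delta>\<^sup>2 \<le> 2 * l" for a l
      using that by (simp add: power2_eq_square mult_ac)
    ultimately show "64 * k * long_branching k (4 * Q) * (\<Delta> * \<Delta>) \<le> card L" by blast
  qed
qed

lemma card_good_arcs_le:
  assumes no_wheel: "\<not> has_wheel adj k" and k: "4 \<le> k" and t: "1 \<le> t" and Q: "1 \<le> Q"
    and deg: "\<And>y. card (nbrs y) \<le> \<Delta>" and \<Delta>: "0 < \<Delta>"
  shows "card (good_arcs (4 * Q) v) \<le> 2 * sqrt (slack k * Q) * real \<Delta> ^ 3"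
proof (rule ccontr)
  assume "\<not> ?thesis"
  then have many: "2 * (sqrt (slack k * Q) * \<Delta>) * (real \<Delta>)\<^sup>2 < card (good_arcs (4 * Q) v)"
    by (simp add: power2_eq_square power3_eq_cube mult.assoc)
  have "0 < slack k" using k t by (simp add: slack_def)
  then have "0 < sqrt (slack k * Q) * \<Delta>" using Q \<Delta> by simp
  then show False
    using wheel_from_good_arcs[OF k Q deg _ _ many] no_wheel by (simp add: power_mult_distrib)
qed

text \<open>If \<open>(b, u)\<close> and \<open>(q, v)\<close> are compatible light paths from \<open>x\<close> to \<open>p\<close>, then \<open>x\<close> and \<open>u\<close>, with
  spoke vertices \<open>q\<close> and \<open>p\<close>, are the ends of an arc around the hub \<open>v\<close> through \<open>b\<close>.\<close>

lemma sum_compatible_pairs_le: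
  assumes I: "I \<subseteq> V \<times> V" and M: "\<And>i. i \<in> I \<Longrightarrow> card (light_paths (fst i) (snd i)) \<le> M"
  shows "(\<Sum>i\<in>I. card (compatible_pairs (fst i) (snd i))) \<le> (\<Sum>v\<in>V. card (good_arcs M v))"
proof -
  have "finite I" using I finite_V finite_subset by blast
  let ?f = "\<lambda>((x, p), ((b, u), (q, v))). (v, [Spoked q x, Middle b, Spoked p u])"
  have "card (SIGMA i:I. compatible_pairs (fst i) (snd i)) \<le> card (SIGMA v:V. good_arcs M v)"
  proof (rule card_inj_on_le[where f = ?f])
    show "?f ` (SIGMA i:I. compatible_pairs (fst i) (snd i)) \<subseteq> (SIGMA v:V. good_arcs M v)"
    proof clarsimp
      fix x p b u q v assume xp: "(x, p) \<in> I" and "((b, u), (q, v)) \<in> compatible_pairs x p"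
      then have l: "light_path x b u p" "light_path x q v p" "compatible (b, u) (q, v)"
        by (auto simp: compatible_pairs_def light_paths_def)
      have "arc v q x b p u"
        using l adj_commute light_commute unfolding arc_def light_path_def compatible_def by auto
      then show "v \<in> V \<and> [Spoked q x, Middle b, Spoked p u] \<in> good_arcs M v"
        using l(2) adj_in_V M[OF xp] by (auto simp: good_arcs_def arcs_def light_path_def)
    qed
  qed (use finite_V in \<open>auto simp: inj_on_def\<close>)
  then show ?thesis using \<open>finite I\<close> finite_V by simp
qed

lemma tail_sum_light_paths_le:
  assumes no_wheel: "\<not> has_wheel adj k" and k: "4 \<le> k" and t: "3 * k + 1 \<le> t"
    and deg: "\<And>y. card (nbrs y) \<le> \<Delta>" and \<Delta>: "0 < \<Delta>"
    and Q: "16 * t * ramsey_number (Suc k) \<le> Q" "1 \<le> Q"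
    and level: "tail_sum q (V \<times> V) Q \<le> 2 * (\<Sum>i | i \<in> V \<times> V \<and> Q \<le> q i \<and> q i < 4 * Q. q i)"
    and q: "q = (\<lambda>i. card (light_paths (fst i) (snd i)))"
  shows "real (Q * tail_sum q (V \<times> V) Q) \<le>
    64 * real (ramsey_number (Suc k)) * real (card V) * sqrt (slack k * Q) * real \<Delta> ^ 3"
proof -
  let ?r = "ramsey_number (Suc k)"
  define I where "I = {i. i \<in> V \<times> V \<and> Q \<le> q i \<and> q i < 4 * Q}"
  have "Q * (\<Sum>i\<in>I. q i) \<le> (\<Sum>i\<in>I. 16 * ?r * card (compatible_pairs (fst i) (snd i)))"
    unfolding sum_distrib_left
  proof (rule sum_mono)
    fix i assume "i \<in> I"
    then have "Q \<le> q i" by (simp add: I_def)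
    then have "Q * q i \<le> q i * q i" by (rule mult_le_mono1)
    also have "\<dots> \<le> 16 * ?r * card (compatible_pairs (fst i) (snd i))"
      using card_compatible_pairs_ge[OF no_wheel _ t, of "fst i" "snd i"] \<open>Q \<le> q i\<close> Q(1) k by (simp add: q)
    finally show "Q * q i \<le> 16 * ?r * card (compatible_pairs (fst i) (snd i))" .
  qed
  also have "\<dots> = 16 * ?r * (\<Sum>i\<in>I. card (compatible_pairs (fst i) (snd i)))"
    by (rule sum_distrib_left[symmetric])
  also have "\<dots> \<le> 16 * ?r * (\<Sum>v\<in>V. card (good_arcs (4 * Q) v))"
    by (intro mult_le_mono2 sum_compatible_pairs_le) (auto simp: I_def q)
  finally have "real (Q * (\<Sum>i\<in>I. q i)) \<le> real (16 * ?r * (\<Sum>v\<in>V. card (good_arcs (4 * Q) v)))"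
    by (simp only: of_nat_le_iff)
  also have "\<dots> = 16 * real ?r * (\<Sum>v\<in>V. real (card (good_arcs (4 * Q) v)))" by simp
  also have "\<dots> \<le> 16 * real ?r * (\<Sum>v\<in>V. 2 * sqrt (slack k * Q) * real \<Delta> ^ 3)"
    using card_good_arcs_le[OF no_wheel k _ Q(2) deg \<Delta>] t by (intro mult_left_mono sum_mono) simp_all
  also have "\<dots> = 32 * real ?r * real (card V) * sqrt (slack k * Q) * real \<Delta> ^ 3" by simp
  finally have "2 * real (Q * (\<Sum>i\<in>I. q i)) \<le>
      64 * real ?r * real (card V) * sqrt (slack k * Q) * real \<Delta> ^ 3"
    by linarith
  moreover have "Q * tail_sum q (V \<times> V) Q \<le> 2 * (Q * (\<Sum>i\<in>I. q i))"
    using mult_le_mono2[OF level, of Q] by (simp add: I_def)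
  ultimately show ?thesis by linarith
qed

lemma light_path_count_square_le:
  assumes no_wheel: "\<not> has_wheel adj k" and k: "4 \<le> k" and t: "3 * k + 1 \<le> t"
    and deg: "\<And>y. card (nbrs y) \<le> \<Delta>" and \<Delta>: "0 < \<Delta>"
    and Q0: "16 * t * ramsey_number (Suc k) \<le> Q0" "2 * Q0 * (card V)\<^sup>2 \<le> light_path_count"
  shows "Q0 * (real light_path_count)\<^sup>2 \<le>
    (128 * real (ramsey_number (Suc k)) * real (card V) * real \<Delta> ^ 3)\<^sup>2 * slack k"
proof -
  define q where "q = (\<lambda>i. card (light_paths (fst i) (snd i)))"
  define F where "F = tail_sum q (V \<times> V)"
  define a where "a = 64 * real (ramsey_number (Suc k)) * real (card V) * real \<Delta> ^ 3"
  have fin: "finite (V \<times> V)" using finite_V by simp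
  have "1 \<le> 16 * t * ramsey_number (Suc k)" using t le_ramsey_number[of "Suc k"] by simp
  then have "0 < Q0" using Q0(1) by linarith
  then obtain Q where Q: "Q0 \<le> Q" "Q0 * (F Q0)\<^sup>2 \<le> Q * (F Q)\<^sup>2"
    "F Q \<le> 2 * (\<Sum>i | i \<in> V \<times> V \<and> Q \<le> q i \<and> q i < 4 * Q. q i)"
    unfolding F_def using exists_dyadic_level[OF fin] by blast
  have "real (Q * F Q) \<le>
      64 * real (ramsey_number (Suc k)) * real (card V) * sqrt (slack k * Q) * real \<Delta> ^ 3"
    unfolding F_def
  proof (rule tail_sum_light_paths_le[OF no_wheel k t deg \<Delta> _ _ _ q_def])
    show "tail_sum q (V \<times> V) Q \<le> 2 * (\<Sum>i | i \<in> V \<times> V \<and> Q \<le> q i \<and> q i < 4 * Q. q i)"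
      using Q(3) by (simp only: F_def)
  qed (use Q(1) Q0(1) \<open>0 < Q0\<close> in auto)
  then have "real (Q * F Q) \<le> a * sqrt (slack k * Q)" by (simp add: a_def mult_ac)
  then have "(real (Q * F Q))\<^sup>2 \<le> (a * sqrt (slack k * Q))\<^sup>2" by (intro power_mono) auto
  then have "real Q * (real Q * (real (F Q))\<^sup>2) \<le> real Q * (a\<^sup>2 * slack k)"
    by (simp add: power2_eq_square mult_ac)
  then have FQ: "real Q * (real (F Q))\<^sup>2 \<le> a\<^sup>2 * slack k"
    using Q(1) \<open>0 < Q0\<close> by simp
  have "light_path_count = sum q (V \<times> V)" by (simp add: light_path_count_def q_def)
  then have "light_path_count \<le> (card V)\<^sup>2 * Q0 + F Q0"
    using sum_le_tail_sum[OF fin, of q Q0] by (simp add: F_def card_cartesian_product power2_eq_square)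
  moreover have "2 * ((card V)\<^sup>2 * Q0) \<le> light_path_count" using Q0(2) by (simp add: mult_ac)
  ultimately have "light_path_count \<le> 2 * F Q0" by linarith
  then have "(real light_path_count)\<^sup>2 \<le> (2 * real (F Q0))\<^sup>2" by (intro power_mono) auto
  then have "Q0 * (real light_path_count)\<^sup>2 \<le> Q0 * (2 * real (F Q0))\<^sup>2" by (rule mult_left_mono) simp
  also have "\<dots> = 4 * real (Q0 * (F Q0)\<^sup>2)" by (simp add: power_mult_distrib)
  also have "\<dots> \<le> 4 * real (Q * (F Q)\<^sup>2)" using Q(2) by (simp only: of_nat_le_iff mult_le_cancel_left_pos)
  also have "\<dots> \<le> 4 * (a\<^sup>2 * slack k)" using FQ by simp
  also have "\<dots> = (128 * real (ramsey_number (Suc k)) * real (card V) * real \<Delta> ^ 3)\<^sup>2 * slack k"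
    by (simp add: a_def power_mult_distrib)
  finally show ?thesis .
qed

lemma light_path_count_le:
  assumes no_wheel: "\<not> has_wheel adj k" and k: "4 \<le> k" and t: "3 * k + 1 \<le> t"
    and deg: "\<And>y. card (nbrs y) \<le> \<Delta>" and \<Delta>: "0 < \<Delta>" and V: "V \<noteq> {}"
  defines "r \<equiv> ramsey_number (Suc k)"
  shows "light_path_count \<le> 2 * (16 * t * r + 1) * (card V)\<^sup>2 \<or>
    real light_path_count ^ 3 \<le> 4 * (128 * real r)\<^sup>2 * slack k * (real (card V) ^ 4 * real \<Delta> ^ 6)"
proof -
  let ?L = "real light_path_count" and ?n = "real (card V)"
  define Q where "Q = light_path_count div (2 * (card V)\<^sup>2)"
  have n: "0 < card V" using V finite_V by (simp add: card_gt_0_iff)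
  have Q_le: "2 * Q * (card V)\<^sup>2 \<le> light_path_count"
    using div_times_less_eq_dividend[of light_path_count "2 * (card V)\<^sup>2"] by (simp add: Q_def mult_ac)
  have Q_gt: "light_path_count < 2 * (Q + 1) * (card V)\<^sup>2"
    using dividend_less_times_div[of "2 * (card V)\<^sup>2" light_path_count] n by (simp add: Q_def algebra_simps)
  show ?thesis
  proof (cases "16 * t * r \<le> Q")
    case True
    have "1 \<le> 16 * t * r" using t le_ramsey_number[of "Suc k"] by (simp add: r_def)
    then have "1 \<le> Q" using True by linarith
    then have "2 * (Q + 1) * (card V)\<^sup>2 \<le> 4 * Q * (card V)\<^sup>2"
      by (intro mult_le_mono1) simp
    then have "real light_path_count \<le> real (4 * Q * (card V)\<^sup>2)" using Q_gt by linarith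
    then have "?L * ?L\<^sup>2 \<le> real (4 * Q * (card V)\<^sup>2) * ?L\<^sup>2" by (rule mult_right_mono) simp
    also have "\<dots> = 4 * ?n\<^sup>2 * (Q * ?L\<^sup>2)" by simp
    also have "\<dots> \<le> 4 * ?n\<^sup>2 * ((128 * real r * ?n * real \<Delta> ^ 3)\<^sup>2 * slack k)"
      unfolding r_def
      by (intro mult_left_mono light_path_count_square_le[OF no_wheel k t deg \<Delta> True[unfolded r_def] Q_le]) simp
    also have "\<dots> = 4 * (128 * real r)\<^sup>2 * slack k * (?n ^ 4 * real \<Delta> ^ 6)"
      by (simp add: eval_nat_numeral)
    finally show ?thesis by (simp add: eval_nat_numeral)
  next
    case False
    then have "2 * (Q + 1) * (card V)\<^sup>2 \<le> 2 * (16 * t * r + 1) * (card V)\<^sup>2"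
      by (intro mult_le_mono1 mult_le_mono2) linarith
    then show ?thesis using Q_gt by linarith
  qed
qed

lemma min_degree_cubed_le_light_path_count:
  assumes no_wheel: "\<not> has_wheel adj k" and k: "2 \<le> k" and t: "3 * k + 1 \<le> t"
    and deg: "\<And>y. y \<in> V \<Longrightarrow> \<delta> \<le> card (nbrs y)" and \<delta>: "16 * k \<le> \<delta>"
  shows "card V * \<delta> ^ 3 \<le> 128 * k\<^sup>2 * light_path_count"
proof -
  define d where "d = \<delta> div (4 * k)"
  have "16 * k div (4 * k) \<le> d" unfolding d_def using \<delta> by (rule div_le_mono)
  then have d: "4 \<le> d" using k by simp
  have "\<delta> \<le> 4 * k * (d + 1)"
    unfolding d_def using k dividend_less_times_div[of "4 * k" \<delta>] by (simp add: algebra_simps)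
  also have "\<dots> \<le> 4 * k * (2 * (d - 1))" using d by (intro mult_le_mono2) simp
  finally have "\<delta> \<le> 8 * k * (d - 1)" by simp
  moreover from this have "\<delta> \<le> 8 * k * d" by (rule le_trans) simp
  ultimately have "\<delta> * \<delta> \<le> (8 * k * d) * (8 * k * (d - 1))" by (rule mult_le_mono[rotated])
  then have "card V * \<delta> * (\<delta> * \<delta>) \<le> card V * \<delta> * ((8 * k * d) * (8 * k * (d - 1)))" by (rule mult_le_mono2)
  also have "\<dots> = 64 * k\<^sup>2 * (card V * \<delta> * (d * (d - 1)))" by (simp add: power2_eq_square)
  also have "\<dots> \<le> 64 * k\<^sup>2 * (2 * light_path_count)"
    by (intro mult_le_mono2 light_path_count_ge[OF no_wheel k t deg]) (simp_all add: d_def)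
  finally show ?thesis by (simp add: power3_eq_cube)
qed

lemma max_degree_cubed_le_light_path_count:
  fixes K :: real
  assumes no_wheel: "\<not> has_wheel adj k" and k: "2 \<le> k" and t: "3 * k + 1 \<le> t"
    and deg: "\<And>y. y \<in> V \<Longrightarrow> \<delta> \<le> card (nbrs y)" and \<delta>: "16 * k \<le> \<delta>"
    and K: "0 \<le> K" "real \<Delta> \<le> K * real \<delta>"
  shows "card V * real \<Delta> ^ 3 \<le> 128 * (real k)\<^sup>2 * K ^ 3 * light_path_count"
proof -
  have "real (card V * \<delta> ^ 3) \<le> real (128 * k\<^sup>2 * light_path_count)"
    unfolding of_nat_le_iff by (rule min_degree_cubed_le_light_path_count[OF no_wheel k t deg \<delta>])
  then have "K ^ 3 * real (card V * \<delta> ^ 3) \<le> K ^ 3 * real (128 * k\<^sup>2 * light_path_count)"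
    using K(1) by (intro mult_left_mono) auto
  moreover have "real \<Delta> ^ 3 \<le> (K * real \<delta>) ^ 3" using K(2) by (intro power_mono) auto
  then have "card V * real \<Delta> ^ 3 \<le> card V * (K * real \<delta>) ^ 3" by (intro mult_left_mono) auto
  ultimately show ?thesis by (simp add: power_mult_distrib mult_ac)
qed

definition degree_const :: "nat \<Rightarrow> real \<Rightarrow> real" where
  "degree_const k K = (16 * k * K) ^ 3 + 2 * (16 * t * ramsey_number (Suc k) + 1) * (128 * (real k)\<^sup>2 * K ^ 3)
     + 4 * (128 * real (ramsey_number (Suc k)))\<^sup>2 * slack k * (128 * (real k)\<^sup>2 * K ^ 3) ^ 3"

lemma max_degree_cubed_le:
  fixes K :: real
  assumes no_wheel: "\<not> has_wheel adj k" and k: "4 \<le> k" and t: "3 * k + 1 \<le> t" and V: "V \<noteq> {}"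
    and low: "\<And>y. y \<in> V \<Longrightarrow> \<delta> \<le> card (nbrs y)" and up: "\<And>y. card (nbrs y) \<le> \<Delta>"
    and K: "1 \<le> K" "real \<Delta> \<le> K * real \<delta>"
  shows "real \<Delta> ^ 3 \<le> degree_const k K * card V"
proof -
  define n where "n = real (card V)"
  define L where "L = real light_path_count"
  define a where "a = (16 * k * K) ^ 3"
  define b where "b = 128 * (real k)\<^sup>2 * K ^ 3"
  define B where "B = real (2 * (16 * t * ramsey_number (Suc k) + 1))"
  define D where "D = 4 * (128 * real (ramsey_number (Suc k)))\<^sup>2 * slack k"
  have n: "1 \<le> n" using V finite_V by (simp add: n_def Suc_le_eq card_gt_0_iff)
  have nonneg: "0 \<le> a" "0 \<le> b" "0 \<le> B" "0 \<le> D" using K(1) by (simp_all add: a_def b_def B_def D_def)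
  have const: "degree_const k K * n = a * n + (B * b * n + D * b ^ 3 * n)"
    by (simp add: degree_const_def a_def b_def B_def D_def algebra_simps)
  have "real \<Delta> ^ 3 \<le> a \<or> real \<Delta> ^ 3 \<le> B * b * n + D * b ^ 3 * n"
  proof (cases "16 * k \<le> \<delta>")
    case False
    then have "real \<delta> \<le> 16 * k" by simp
    then have "K * real \<delta> \<le> 16 * k * K" using K(1) by (simp add: mult.commute mult_left_mono)
    then have "real \<Delta> ^ 3 \<le> a" unfolding a_def using K(2) by (intro power_mono) linarith+
    then show ?thesis by blast
  next
    case True
    obtain y where "y \<in> V" using V by blast
    then have \<Delta>: "0 < \<Delta>" using low[of y] up[of y] True k by linarith
    have "n * real \<Delta> ^ 3 \<le> b * L"
      using max_degree_cubed_le_light_path_count[OF no_wheel _ t low True _ K(2)] k K(1)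
      by (simp add: n_def b_def L_def)
    moreover have "L \<le> B * n\<^sup>2" if "light_path_count \<le> 2 * (16 * t * ramsey_number (Suc k) + 1) * (card V)\<^sup>2"
      using of_nat_mono[OF that, where 'a = real] by (simp add: L_def B_def n_def algebra_simps)
    then have "L \<le> B * n\<^sup>2 \<or> L ^ 3 \<le> D * (n ^ 4 * real \<Delta> ^ 6)"
      using light_path_count_le[OF no_wheel k t up \<Delta> V] unfolding L_def n_def D_def by blast
    ultimately have "real \<Delta> ^ 3 \<le> B * b * n + D * b ^ 3 * n"
      using n \<Delta> nonneg by (intro cube_le_of_cubic_bounds[where L = L]) simp_all
    then show ?thesis by blast
  qed
  moreover have "a \<le> a * n" using nonneg(1) n by (simp add: mult_le_cancel_left1)
  moreover have "0 \<le> a * n" "0 \<le> B * b * n + D * b ^ 3 * n" using nonneg n by simp_all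
  ultimately show ?thesis using const unfolding n_def[symmetric] by linarith
qed

end

definition wheel_const :: "nat \<Rightarrow> real \<Rightarrow> real" where
  "wheel_const k K = max 1 (codegree_graph.degree_const (3 * k + 1) k K)"

lemma (in simple_graph) wheel_free_max_degree_bound:
  fixes K :: real
  assumes no_wheel: "\<not> has_wheel adj k" and k: "4 \<le> k" and V: "V \<noteq> {}"
    and deg: "\<And>y. y \<in> V \<Longrightarrow> \<delta> \<le> card {z. adj y z} \<and> card {z. adj y z} \<le> \<Delta>"
    and K: "1 \<le> K" "real \<Delta> \<le> K * real \<delta>"
  shows "real \<Delta> ^ 3 \<le> wheel_const k K * card V"
proof -
  interpret codegree_graph adj V "3 * k + 1" by unfold_locales
  have "card (nbrs y) \<le> \<Delta>" for y
  proof (cases "y \<in> V")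
    case False
    then have "nbrs y = {}" using adj_V by (auto simp: nbrs_def)
    then show ?thesis by simp
  qed (use deg in \<open>simp add: nbrs_def\<close>)
  then have "real \<Delta> ^ 3 \<le> degree_const k K * card V"
    using deg by (intro max_degree_cubed_le[OF no_wheel k _ V _ _ K]) (simp_all add: nbrs_def)
  also have "\<dots> \<le> wheel_const k K * card V"
    by (intro mult_right_mono) (auto simp: wheel_const_def)
  finally show ?thesis .
qed

lemma (in simple_graph) wheel_free_degree_cubed_le:
  fixes K x :: real
  assumes no_wheel: "\<not> has_wheel adj k" and k: "4 \<le> k" and V: "V \<noteq> {}"
    and deg: "\<And>y. y \<in> V \<Longrightarrow> x \<le> card {z. adj y z} \<and> card {z. adj y z} \<le> K * x"
    and K: "1 \<le> K" and x: "0 \<le> x"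
  shows "x ^ 3 \<le> wheel_const k K * card V"
proof -
  define \<delta> where "\<delta> = nat \<lceil>x\<rceil>"
  define \<Delta> where "\<Delta> = nat \<lfloor>K * x\<rfloor>"
  have deg': "\<delta> \<le> card {z. adj y z} \<and> card {z. adj y z} \<le> \<Delta>" if "y \<in> V" for y
    using deg[OF that] by (simp add: \<delta>_def \<Delta>_def nat_le_iff ceiling_le_iff le_nat_floor)
  have "x \<le> real \<delta>" unfolding \<delta>_def by linarith
  then have "K * x \<le> K * real \<delta>" using K by (intro mult_left_mono) auto
  moreover have "0 \<le> K * x" using K x by simp
  then have "real \<Delta> \<le> K * x" unfolding \<Delta>_def by linarith
  ultimately have ratio: "real \<Delta> \<le> K * real \<delta>" by linarith
  obtain y where "y \<in> V" using V by blast
  then have "x \<le> real \<Delta>" using deg'[of y] \<open>x \<le> real \<delta>\<close> by linarith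
  then have "x ^ 3 \<le> real \<Delta> ^ 3" using x by (rule power_mono)
  also have "\<dots> \<le> wheel_const k K * card V"
    by (rule wheel_free_max_degree_bound[OF no_wheel k V deg' K ratio])
  finally show ?thesis .
qed

section \<open>Copies of graphs and the extremal number\<close>

definition embedding :: "('b \<Rightarrow> 'a) \<Rightarrow> 'b graph \<Rightarrow> 'a graph \<Rightarrow> bool" where
  "embedding f F G \<longleftrightarrow> inj_on f (verts F) \<and> f ` verts F \<subseteq> verts G \<and> (\<forall>e\<in>edges F. f ` e \<in> edges G)"

lemma finite_simple_graph_image:
  assumes F: "finite_simple_graph F" and f: "inj_on f (verts F)"
  shows "finite_simple_graph (f ` verts F, (`) f ` edges F)"
    and "isomorphic (f ` verts F, (`) f ` edges F) F"
proof -
  have edge: "e \<subseteq> verts F" "card e = 2" if "e \<in> edges F" for e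
    using F that by (auto simp: finite_simple_graph_def)
  have "f ` e \<subseteq> f ` verts F \<and> card (f ` e) = 2" if "e \<in> edges F" for e
    using edge[OF that] card_image[OF inj_on_subset[OF f edge(1)[OF that]]] by auto
  then show "finite_simple_graph (f ` verts F, (`) f ` edges F)"
    using F by (simp add: finite_simple_graph_def)
  have "bij_betw (inv_into (verts F) f) (f ` verts F) (verts F)"
    using f by (simp add: bij_betw_inv_into inj_on_imp_bij_betw)
  moreover have "inv_into (verts F) f ` f ` e = e" if "e \<in> edges F" for e
    using edge(1)[OF that] f by simp
  then have "(`) (inv_into (verts F) f) ` (`) f ` edges F = edges F"
    by (simp add: image_image)
  ultimately show "isomorphic (f ` verts F, (`) f ` edges F) F"
    unfolding isomorphic_def by (intro exI[of _ "inv_into (verts F) f"]) simp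
qed

lemma contains_copy_iff_embedding:
  assumes F: "finite_simple_graph F"
  shows "contains_copy G F \<longleftrightarrow> (\<exists>f. embedding f F G)"
proof
  assume "contains_copy G F"
  then obtain H g where H: "subgraph H G" and g: "bij_betw g (verts H) (verts F)" "(`) g ` edges H = edges F"
    unfolding contains_copy_def isomorphic_def by blast
  define f where "f = inv_into (verts H) g"
  have "bij_betw f (verts F) (verts H)" unfolding f_def using g(1) by (rule bij_betw_inv_into)
  then have "inj_on f (verts F)" "f ` verts F \<subseteq> verts G"
    using H by (simp_all add: bij_betw_def subgraph_def)
  moreover have "f ` e \<in> edges G" if "e \<in> edges F" for e
  proof -
    have "e \<in> (`) g ` edges H" using that g(2) by simp
    then obtain e' where e': "e' \<in> edges H" "e = g ` e'" by blast
    have "e' \<subseteq> verts H" using H e'(1) by (auto simp: subgraph_def finite_simple_graph_def)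
    then have "f ` e = e'" using g(1) by (simp add: f_def e'(2) bij_betw_def)
    then show ?thesis using H e'(1) by (auto simp: subgraph_def)
  qed
  ultimately show "\<exists>f. embedding f F G" unfolding embedding_def by blast
next
  assume "\<exists>f. embedding f F G"
  then obtain f where f: "inj_on f (verts F)" "f ` verts F \<subseteq> verts G" "\<And>e. e \<in> edges F \<Longrightarrow> f ` e \<in> edges G"
    unfolding embedding_def by blast
  then have "subgraph (f ` verts F, (`) f ` edges F) G"
    using finite_simple_graph_image(1)[OF F f(1)] by (auto simp: subgraph_def)
  then show "contains_copy G F"
    unfolding contains_copy_def using finite_simple_graph_image(2)[OF F f(1)] by blast
qed

lemma contains_copy_trans:
  assumes "finite_simple_graph F" "finite_simple_graph H" "contains_copy G H" "contains_copy H F"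
  shows "contains_copy G F"
proof -
  obtain g f where "embedding g H G" "embedding f F H"
    using assms by (auto simp: contains_copy_iff_embedding)
  then have "embedding (g \<circ> f) F G"
    unfolding embedding_def image_comp[symmetric] by (blast intro: comp_inj_on inj_on_subset)
  then show ?thesis using assms(1) by (auto simp: contains_copy_iff_embedding)
qed

lemma finite_edges:
  assumes "finite_simple_graph G" shows "finite (edges G)"
  by (rule finite_subset[of _ "Pow (verts G)"]) (use assms in \<open>auto simp: finite_simple_graph_def\<close>)

lemma finite_free_edge_counts:
  "finite {card (edges G) | G :: nat graph. finite_simple_graph G \<and> card (verts G) = n \<and> \<not> contains_copy G F}"
    (is "finite ?S")
proof (rule finite_subset)
  show "?S \<subseteq> {..2 ^ n}"
  proof
    fix m assume "m \<in> ?S"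
    then obtain G :: "nat graph" where G: "m = card (edges G)" "finite_simple_graph G" "card (verts G) = n"
      by blast
    then have "edges G \<subseteq> Pow (verts G)" "finite (verts G)" by (auto simp: finite_simple_graph_def)
    then show "m \<in> {..2 ^ n}" using card_mono[of "Pow (verts G)" "edges G"] G by (simp add: card_Pow)
  qed
qed simp

lemma ex_attained:
  assumes "finite_simple_graph F" "edges F \<noteq> {}"
  obtains G :: "nat graph" where "finite_simple_graph G" "card (verts G) = n" "\<not> contains_copy G F"
    "card (edges G) = ex n F"
proof -
  let ?S = "{card (edges G) | G :: nat graph. finite_simple_graph G \<and> card (verts G) = n \<and> \<not> contains_copy G F}"
  have "\<not> contains_copy ({..<n}, {}) F"
    using assms by (auto simp: contains_copy_iff_embedding embedding_def)
  then have "card (edges ({..<n}, {})) \<in> ?S"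
    by (intro CollectI exI[of _ "({..<n}, {})"]) (simp add: finite_simple_graph_def)
  then have "ex n F \<in> ?S"
    unfolding ex_def by (intro Max_in finite_free_edge_counts) blast
  then show thesis using that by auto
qed

text \<open>The graph \<open>G\<close> is copied to the naturals and padded with isolated vertices, which no copy of \<open>F\<close>
  can use.\<close>

lemma card_edges_le_ex:
  assumes G: "finite_simple_graph G" "card (verts G) \<le> n" "\<not> contains_copy G F"
    and F: "finite_simple_graph F" "\<Union> (edges F) = verts F"
  shows "card (edges G) \<le> ex n F"
proof -
  have "finite (verts G)" and E: "\<And>e. e \<in> edges G \<Longrightarrow> e \<subseteq> verts G"
    using G(1) by (auto simp: finite_simple_graph_def)
  then obtain h where h: "inj_on h (verts G)" "h ` verts G \<subseteq> {..<n}"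
    using card_le_inj[of "verts G" "{..<n}"] G(2) by auto
  let ?H = "({..<n}, (`) h ` edges G)"
  have "finite_simple_graph ?H"
    using finite_simple_graph_image(1)[OF G(1) h(1)] h(2) by (fastforce simp: finite_simple_graph_def)
  moreover have "\<not> contains_copy ?H F"
  proof
    assume "contains_copy ?H F"
    then obtain f where f: "inj_on f (verts F)" "\<And>e. e \<in> edges F \<Longrightarrow> f ` e \<in> (`) h ` edges G"
      using F(1) by (auto simp: contains_copy_iff_embedding embedding_def)
    have f_range: "f ` verts F \<subseteq> h ` verts G"
      using f(2) E F(2)[symmetric] by fastforce
    have "embedding (inv_into (verts G) h \<circ> f) F G"
      unfolding embedding_def
    proof (intro conjI ballI)
      show "inj_on (inv_into (verts G) h \<circ> f) (verts F)"
        using f(1) f_range by (intro comp_inj_on inj_on_inv_into)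
      show "(inv_into (verts G) h \<circ> f) ` verts F \<subseteq> verts G"
        using f_range by (auto simp: image_subset_iff intro!: inv_into_into)
      fix e assume "e \<in> edges F"
      then obtain e' where e': "e' \<in> edges G" "f ` e = h ` e'"
        using f(2)[OF \<open>e \<in> edges F\<close>] by (metis imageE)
      have "(inv_into (verts G) h \<circ> f) ` e = inv_into (verts G) h ` h ` e'"
        unfolding e'(2)[symmetric] by (rule image_comp[symmetric])
      also have "\<dots> = e'" using E[OF e'(1)] h(1) by simp
      finally show "(inv_into (verts G) h \<circ> f) ` e \<in> edges G" using e'(1) by simp
    qed
    then show False using G(3) F(1) by (auto simp: contains_copy_iff_embedding)
  qed
  moreover have "card ((`) h ` edges G) = card (edges G)"
    using E h(1) by (intro card_image inj_onI) (metis inj_on_image_eq_iff)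
  ultimately show ?thesis
    unfolding ex_def by (intro Max_ge[OF finite_free_edge_counts] CollectI exI[of _ ?H]) simp
qed

lemma ex_mono:
  assumes "finite_simple_graph F" "finite_simple_graph H" "edges F \<noteq> {}" "edges H \<noteq> {}" "contains_copy H F"
  shows "ex n F \<le> ex n H"
proof -
  obtain G :: "nat graph" where G: "finite_simple_graph G" "card (verts G) = n" "\<not> contains_copy G F"
    "card (edges G) = ex n F"
    using ex_attained[OF assms(1,3)] .
  have "\<not> contains_copy G H" using contains_copy_trans[OF assms(1,2) _ assms(5)] G(3) by blast
  then have "card (edges G) \<in> {card (edges G) | G :: nat graph.
      finite_simple_graph G \<and> card (verts G) = n \<and> \<not> contains_copy G H}"
    using G(1,2) by blast
  then show ?thesis
    unfolding ex_def[of n H] G(4)[symmetric] by (rule Max_ge[OF finite_free_edge_counts])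
qed

section \<open>Wheels as graphs\<close>

abbreviation wheel :: "nat \<Rightarrow> nat option graph" where
  "wheel k \<equiv> add_apex (cycle_graph k)"

lemma edges_cycle_graph: "edges (cycle_graph k) = (\<lambda>i. {i, Suc i mod k}) ` {..<k}"
  by (auto simp: cycle_graph_def)

lemma embedding_cycle_graph_iff: "embedding w (cycle_graph k) G \<longleftrightarrow>
    inj_on w {..<k} \<and> w ` {..<k} \<subseteq> verts G \<and> (\<forall>i<k. {w i, w (Suc i mod k)} \<in> edges G)"
  by (simp add: embedding_def edges_cycle_graph) (simp add: cycle_graph_def Ball_def)

lemma finite_simple_graph_cycle_graph:
  assumes "2 \<le> k" shows "finite_simple_graph (cycle_graph k)"
proof -
  have "Suc i mod k \<noteq> i" "Suc i mod k < k" if "i < k" for i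
    using that assms by (auto simp: mod_Suc)
  then have "card {i, Suc i mod k} = 2 \<and> {i, Suc i mod k} \<subseteq> {..<k}" if "i < k" for i
    using that by (metis card_2_iff insert_subset empty_subsetI lessThan_iff)
  then show ?thesis
    by (auto simp only: finite_simple_graph_def cycle_graph_def fst_conv snd_conv finite_lessThan)
qed

lemma finite_simple_graph_add_apex:
  assumes "finite_simple_graph G" shows "finite_simple_graph (add_apex G)"
  using assms by (fastforce simp: finite_simple_graph_def add_apex_def card_image)

lemma finite_simple_graph_subdivision1:
  assumes "finite_simple_graph G" shows "finite_simple_graph (subdivision1 G)"
  using assms finite_edges[OF assms] by (auto simp: finite_simple_graph_def subdivision1_def)

lemma finite_simple_graph_subdivided_wheel: "2 \<le> k \<Longrightarrow> finite_simple_graph (subdivision1 (wheel k))"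
  by (intro finite_simple_graph_subdivision1 finite_simple_graph_add_apex finite_simple_graph_cycle_graph)

definition rim :: "nat \<Rightarrow> nat \<Rightarrow> nat option set" where
  "rim k i = {Some i, Some (Suc i mod k)}"

definition spoke :: "nat \<Rightarrow> nat option set" where
  "spoke i = {None, Some i}"

lemma verts_wheel: "verts (wheel k) = insert None (Some ` {..<k})"
  by (simp add: add_apex_def cycle_graph_def)

lemma edges_wheel: "edges (wheel k) = rim k ` {..<k} \<union> spoke ` {..<k}"
proof -
  have "{{None, Some v} | v. v \<in> verts (cycle_graph k)} = spoke ` {..<k}"
    by (auto simp: cycle_graph_def spoke_def)
  then show ?thesis by (simp add: add_apex_def edges_cycle_graph image_image rim_def)
qed

lemma inj_on_rim:
  assumes "3 \<le> k" shows "inj_on (rim k) {..<k}"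
proof (rule inj_onI, rule ccontr)
  fix i j assume ij: "i \<in> {..<k}" "j \<in> {..<k}" "rim k i = rim k j" "i \<noteq> j"
  then have cyclic: "i = Suc j mod k" "j = Suc i mod k" by (auto simp: rim_def doubleton_eq_iff)
  have succ: "Suc l mod k = Suc l \<or> Suc l mod k = 0 \<and> Suc l = k" if "l < k" for l
    using that by (cases "Suc l = k") simp_all
  have "i = Suc j \<or> i = 0 \<and> Suc j = k" "j = Suc i \<or> j = 0 \<and> Suc i = k"
    using succ[of j] succ[of i] ij(1,2) unfolding cyclic[symmetric] by blast+
  then show False using assms by linarith
qed

lemma verts_subdivided_wheel: "verts (subdivision1 (wheel k)) =
    insert (Inl None) ((Inl \<circ> Some) ` {..<k} \<union> (Inr \<circ> rim k) ` {..<k} \<union> (Inr \<circ> spoke) ` {..<k})"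
  by (simp add: subdivision1_def edges_wheel verts_wheel image_Un image_comp Un_assoc)

lemma edges_subdivision1I: "e \<in> edges G \<Longrightarrow> v \<in> e \<Longrightarrow> {Inl v, Inr e} \<in> edges (subdivision1 G)"
  unfolding subdivision1_def snd_conv by blast

lemma edges_subdivided_wheel_nonempty:
  assumes "0 < k" shows "edges (subdivision1 (wheel k)) \<noteq> {}"
proof -
  have "{Inl None, Inr (spoke 0)} \<in> edges (subdivision1 (wheel k))"
    using assms by (intro edges_subdivision1I) (auto simp: edges_wheel spoke_def)
  then show ?thesis by blast
qed

definition wheel_map :: "nat \<Rightarrow> 'a \<Rightarrow> (nat \<Rightarrow> 'a) \<Rightarrow> (nat \<Rightarrow> 'a) \<Rightarrow> (nat \<Rightarrow> 'a)
    \<Rightarrow> nat option + nat option set \<Rightarrow> 'a" where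
  "wheel_map k v a p b = case_sum (case_option v a)
     (\<lambda>e. if None \<in> e then p (the_inv_into {..<k} spoke e) else b (the_inv_into {..<k} (rim k) e))"

lemma wheel_map_Inl: "wheel_map k v a p b (Inl None) = v" "wheel_map k v a p b (Inl (Some i)) = a i"
  by (simp_all add: wheel_map_def)

lemma wheel_map_spoke:
  assumes "i < k" shows "wheel_map k v a p b (Inr (spoke i)) = p i"
proof -
  have "inj_on spoke {..<k}" by (auto simp: inj_on_def spoke_def doubleton_eq_iff)
  then have "the_inv_into {..<k} spoke (spoke i) = i" using assms by (simp add: the_inv_into_f_f)
  then show ?thesis by (simp add: wheel_map_def) (simp add: spoke_def)
qed

lemma wheel_map_rim:
  assumes "3 \<le> k" "i < k" shows "wheel_map k v a p b (Inr (rim k i)) = b i"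
proof -
  have "the_inv_into {..<k} (rim k) (rim k i) = i"
    using assms inj_on_rim by (simp add: the_inv_into_f_f)
  then show ?thesis by (simp add: wheel_map_def) (simp add: rim_def)
qed

lemmas wheel_map_simps = wheel_map_Inl wheel_map_spoke wheel_map_rim

lemma inj_on_wheel_map:
  assumes k: "3 \<le> k" and dist: "distinct (v # map a [0..<k] @ map p [0..<k] @ map b [0..<k])"
  shows "inj_on (wheel_map k v a p b) (verts (subdivision1 (wheel k)))"
proof -
  have "inj_on a {..<k}" "inj_on p {..<k}" "inj_on b {..<k}"
    using dist unfolding distinct_wheel_iff by blast+
  then have eq: "a i = a j \<longleftrightarrow> i = j" "p i = p j \<longleftrightarrow> i = j" "b i = b j \<longleftrightarrow> i = j" if "i < k" "j < k" for i j
    using that by (simp_all add: inj_on_eq_iff)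
  have hub: "v \<noteq> a i" "v \<noteq> p i" "v \<noteq> b i" if "i < k" for i
    using dist that unfolding distinct_wheel_iff by blast+
  have neq: "a i \<noteq> p j" "a i \<noteq> b j" "p i \<noteq> b j" if "i < k" "j < k" for i j
    using dist that unfolding distinct_wheel_iff by blast+
  show ?thesis
    unfolding verts_subdivided_wheel inj_on_def
    by (auto simp: wheel_map_simps k eq hub hub[symmetric] neq neq[symmetric])
qed

lemma contains_subdivided_wheel:
  assumes k: "3 \<le> k"
    and adj: "\<And>i. i < k \<Longrightarrow> {v, p i} \<in> edges G \<and> {p i, a i} \<in> edges G \<and>
        {a i, b i} \<in> edges G \<and> {b i, a (Suc i mod k)} \<in> edges G"
    and dist: "distinct (v # map a [0..<k] @ map p [0..<k] @ map b [0..<k])"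
    and G: "finite_simple_graph G"
  shows "contains_copy G (subdivision1 (wheel k))"
proof -
  let ?f = "wheel_map k v a p b"
  have "embedding ?f (subdivision1 (wheel k)) G"
    unfolding embedding_def
  proof (intro conjI ballI)
    show "inj_on ?f (verts (subdivision1 (wheel k)))" using k dist by (rule inj_on_wheel_map)
    have edge: "x \<in> verts G \<and> y \<in> verts G" if "{x, y} \<in> edges G" for x y
      using G that by (auto simp: finite_simple_graph_def)
    have "v \<in> verts G \<and> a i \<in> verts G \<and> p i \<in> verts G \<and> b i \<in> verts G" if "i < k" for i
      using adj[OF that] edge by blast
    moreover have "0 < k" using k by simp
    ultimately show "?f ` verts (subdivision1 (wheel k)) \<subseteq> verts G"
      unfolding verts_subdivided_wheel by (auto simp: wheel_map_simps k)
    fix c assume "c \<in> edges (subdivision1 (wheel k))"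
    then obtain w e where c: "c = {Inl w, Inr e}" "e \<in> edges (wheel k)" "w \<in> e"
      by (auto simp: subdivision1_def)
    from c(2) consider (rim) i where "i < k" "e = rim k i" | (spoke) i where "i < k" "e = spoke i"
      unfolding edges_wheel by auto
    then show "?f ` c \<in> edges G"
    proof cases
      case rim
      then have "w = Some i \<or> w = Some (Suc i mod k)" using c(3) by (simp add: rim_def)
      then have "?f ` c = {a i, b i} \<or> ?f ` c = {b i, a (Suc i mod k)}"
        using rim c(1) by (auto simp: wheel_map_simps k)
      then show ?thesis using adj[OF rim(1)] by auto
    next
      case spoke
      then have "w = None \<or> w = Some i" using c(3) by (simp add: spoke_def)
      then have "?f ` c = {v, p i} \<or> ?f ` c = {p i, a i}"
        using spoke c(1) by (auto simp: wheel_map_simps)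
      then show ?thesis using adj[OF spoke(1)] by auto
    qed
  qed
  then show ?thesis
    using finite_simple_graph_subdivided_wheel[of k] k by (auto simp: contains_copy_iff_embedding)
qed

section \<open>Almost regular subgraphs\<close>

locale edge_set =
  fixes E :: "'a set set"
  assumes card_edge: "e \<in> E \<Longrightarrow> card e = 2"
begin

definition induced :: "'a set \<Rightarrow> 'a set set" where
  "induced U = {e \<in> E. e \<subseteq> U}"

definition degree_in :: "'a set \<Rightarrow> 'a \<Rightarrow> nat" where
  "degree_in U w = card {z \<in> U. {w, z} \<in> E}"

lemma finite_induced: "finite U \<Longrightarrow> finite (induced U)"
  by (rule finite_subset[of _ "Pow U"]) (auto simp: induced_def)

lemma induced_empty: "induced {} = {}"
  using card_edge[of "{}"] by (auto simp: induced_def)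

lemma card_incident_edges:
  assumes "w \<in> U"
  shows "card {e \<in> induced U. w \<in> e} = degree_in U w"
proof -
  have "inj_on (\<lambda>z. {w, z}) {z \<in> U. {w, z} \<in> E}"
    by (auto simp: inj_on_def doubleton_eq_iff)
  then have "card ((\<lambda>z. {w, z}) ` {z \<in> U. {w, z} \<in> E}) = degree_in U w"
    unfolding degree_in_def by (rule card_image)
  moreover have "(\<lambda>z. {w, z}) ` {z \<in> U. {w, z} \<in> E} = {e \<in> induced U. w \<in> e}"
  proof (intro equalityI subsetI)
    fix e assume e: "e \<in> {e \<in> induced U. w \<in> e}"
    then have "card e = 2" using card_edge by (auto simp: induced_def)
    then obtain z where "e = {w, z}" using e by (auto simp: card_2_iff)
    then show "e \<in> (\<lambda>z. {w, z}) ` {z \<in> U. {w, z} \<in> E}" using e by (auto simp: induced_def)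
  qed (use assms in \<open>auto simp: induced_def\<close>)
  ultimately show ?thesis by simp
qed

lemma sum_degree_in:
  assumes "finite U"
  shows "(\<Sum>w\<in>U. degree_in U w) = 2 * card (induced U)"
proof -
  have "card {w \<in> U. w \<in> e} = 2" if "e \<in> induced U" for e
  proof -
    have "{w \<in> U. w \<in> e} = e" using that by (auto simp: induced_def)
    then show ?thesis using that card_edge by (simp add: induced_def)
  qed
  then have "(\<Sum>w\<in>U. card {e \<in> induced U. w \<in> e}) = 2 * card (induced U)"
    using assms finite_induced by (intro sum_multicount) auto
  then show ?thesis by (simp add: card_incident_edges)
qed

lemma degree_in_mono: "finite U \<Longrightarrow> W \<subseteq> U \<Longrightarrow> degree_in W w \<le> degree_in U w"
  unfolding degree_in_def by (intro card_mono) auto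

lemma card_induced_remove:
  assumes "finite U" "w \<in> U"
  shows "card (induced U) \<le> card (induced (U - {w})) + degree_in U w"
proof -
  have "induced U = induced (U - {w}) \<union> {e \<in> induced U. w \<in> e}" by (auto simp: induced_def)
  then have "card (induced U) \<le> card (induced (U - {w})) + card {e \<in> induced U. w \<in> e}"
    by (metis card_Un_le)
  then show ?thesis by (simp add: card_incident_edges[OF assms(2)])
qed

lemma exists_min_degree_subset:
  fixes c :: real
  assumes "finite U" "c * card U < card (induced U)"
  obtains W where "W \<subseteq> U" "W \<noteq> {}" "\<And>w. w \<in> W \<Longrightarrow> c \<le> degree_in W w"
proof -
  define dense where "dense W \<longleftrightarrow> c * card W < card (induced W)" for W
  obtain W where W: "W \<subseteq> U" "dense W" and min: "\<And>T. T \<subseteq> U \<Longrightarrow> dense T \<Longrightarrow> card W \<le> card T"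
    using ex_has_least_nat[of "\<lambda>T. T \<subseteq> U \<and> dense T" U card] assms(2) by (auto simp: dense_def)
  have "finite W" using W(1) assms(1) finite_subset by blast
  show thesis
  proof (rule that[OF W(1)])
    show "W \<noteq> {}" using W(2) by (auto simp: dense_def induced_empty)
    fix w assume w: "w \<in> W"
    then have "card W = Suc (card (W - {w}))" using \<open>finite W\<close> by (metis card.remove)
    moreover have "\<not> dense (W - {w})" using min[of "W - {w}"] W(1) calculation by auto
    ultimately show "c \<le> degree_in W w"
      using W(2) card_induced_remove[OF \<open>finite W\<close> w] by (simp add: dense_def algebra_simps)
  qed
qed

text \<open>Cut \<open>U\<close> into pieces as small as \<open>S\<close>; each edge meeting \<open>S\<close> lies in the union of \<open>S\<close> and one of them.\<close>

lemma card_edges_meeting_le: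
  fixes x :: real
  assumes U: "finite U" and S: "S \<subseteq> U" "S \<noteq> {}"
    and small: "\<And>T. T \<subseteq> U \<Longrightarrow> card T \<le> 2 * card S \<Longrightarrow> card (induced T) \<le> x"
  shows "card {e \<in> induced U. e \<inter> S \<noteq> {}} \<le> 2 * card U / card S * x"
proof -
  define s where "s = card S"
  define m where "m = card U div s"
  have s: "0 < s" "s \<le> card U" using S U by (auto simp: s_def card_gt_0_iff card_mono finite_subset)
  obtain g :: "'a \<Rightarrow> nat" where g: "\<And>w. w \<in> U \<Longrightarrow> g w \<le> m" "\<And>i. card {w \<in> U. g w = i} \<le> s"
    unfolding m_def using exists_small_fibres[OF U s(1)] by blast
  define B where "B i = {w \<in> U. g w = i}" for i
  have B: "card (S \<union> B i) \<le> 2 * card S" for i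
    using card_Un_le[of S "B i"] g(2)[of i] by (simp add: s_def B_def)
  have "{e \<in> induced U. e \<inter> S \<noteq> {}} \<subseteq> (\<Union>i\<in>{..m}. induced (S \<union> B i))"
  proof
    fix e assume e: "e \<in> {e \<in> induced U. e \<inter> S \<noteq> {}}"
    then obtain y where y: "y \<in> e" "y \<in> S" by auto
    have "card e = 2" using e card_edge by (auto simp: induced_def)
    then obtain z where z: "e = {y, z}" using y(1) by (auto simp: card_2_iff)
    have "z \<in> U" using e z by (auto simp: induced_def)
    then have "e \<in> induced (S \<union> B (g z))" using e y z by (auto simp: induced_def B_def)
    then show "e \<in> (\<Union>i\<in>{..m}. induced (S \<union> B i))" using g(1)[OF \<open>z \<in> U\<close>] by blast
  qed
  moreover have "finite (S \<union> B i)" for i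
    using S(1) U by (simp add: B_def finite_subset)
  ultimately have "card {e \<in> induced U. e \<inter> S \<noteq> {}} \<le> card (\<Union>i\<in>{..m}. induced (S \<union> B i))"
    using finite_induced by (intro card_mono) auto
  also have "\<dots> \<le> (\<Sum>i\<le>m. card (induced (S \<union> B i)))"
    by (rule card_UN_le) simp
  finally have "real (card {e \<in> induced U. e \<inter> S \<noteq> {}}) \<le> (\<Sum>i\<le>m. real (card (induced (S \<union> B i))))"
    by (simp flip: of_nat_sum)
  also have "\<dots> \<le> (\<Sum>i\<le>m. x)"
    using S(1) by (intro sum_mono small B) (auto simp: B_def)
  also have "\<dots> = (real m + 1) * x" by simp
  also have "\<dots> \<le> 2 * card U / s * x"
  proof (rule mult_right_mono)
    have "real m \<le> card U / s" unfolding m_def by (rule of_nat_div_le_of_nat)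
    moreover have "1 \<le> card U / s" using s by simp
    ultimately show "real m + 1 \<le> 2 * card U / s" by simp
    show "0 \<le> x" using small[of "{}"] by (simp add: induced_empty)
  qed
  finally show ?thesis by (simp add: s_def)
qed

lemma exists_densest_subset:
  fixes \<alpha> :: real
  assumes V: "finite V" and E: "\<And>e. e \<in> E \<Longrightarrow> e \<subseteq> V" "E \<noteq> {}"
  obtains U where "U \<subseteq> V" "0 < card (induced U)"
    "card E / card V powr \<alpha> \<le> card (induced U) / card U powr \<alpha>"
    "\<And>T. T \<subseteq> U \<Longrightarrow> card (induced T) \<le> card (induced U) / card U powr \<alpha> * card T powr \<alpha>"
proof -
  define f where "f T = card (induced T) / card T powr \<alpha>" for T
  have "induced V = E" using E by (auto simp: induced_def)
  then have "V \<noteq> {}" "0 < card (induced V)"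
    using E(2) finite_induced[OF V] by (auto simp: induced_empty card_gt_0_iff)
  then have "0 < f V" using V by (simp add: f_def card_gt_0_iff)
  have "Max (f ` Pow V) \<in> f ` Pow V" using V by (intro Max_in) auto
  then obtain U where U: "U \<subseteq> V" "f U = Max (f ` Pow V)" by auto
  then have max: "f T \<le> f U" if "T \<subseteq> V" for T using that V by simp
  have "0 < f U" using \<open>0 < f V\<close> max[of V] by simp
  show thesis
  proof (rule that[OF U(1)])
    show "0 < card (induced U)" using \<open>0 < f U\<close> by (auto simp: f_def zero_less_divide_iff)
    show "card E / card V powr \<alpha> \<le> card (induced U) / card U powr \<alpha>"
      using max[of V] by (simp add: f_def \<open>induced V = E\<close>)
    fix T assume T: "T \<subseteq> U"
    show "card (induced T) \<le> card (induced U) / card U powr \<alpha> * card T powr \<alpha>"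
    proof (cases "T = {}")
      case False
      then have "0 < card T powr \<alpha>" using T U(1) V by (auto simp: card_gt_0_iff finite_subset)
      then show ?thesis using max[of T] T U(1) by (simp add: f_def pos_divide_le_eq)
    qed (simp add: induced_empty)
  qed
qed

lemma card_high_degree_le:
  fixes D :: real
  assumes "finite U" "0 < card (induced U)"
  shows "D * card {w \<in> U. D * card (induced U) / card U < degree_in U w} \<le> 2 * card U"
proof -
  let ?e = "real (card (induced U))"
  define S where "S = {w \<in> U. D * ?e / card U < degree_in U w}"
  have "U \<noteq> {}" using assms(2) by (auto simp: induced_empty)
  then have u: "0 < real (card U)" using assms(1) by (simp add: card_gt_0_iff)
  have "card S * (D * ?e / card U) \<le> (\<Sum>w\<in>S. real (degree_in U w))"
    using sum_bounded_below[of S "D * ?e / card U" "\<lambda>w. real (degree_in U w)"] by (simp add: S_def less_imp_le)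
  also have "\<dots> \<le> (\<Sum>w\<in>U. real (degree_in U w))"
    using assms(1) by (intro sum_mono2) (auto simp: S_def)
  also have "\<dots> = 2 * ?e"
    using sum_degree_in[OF assms(1)] by (simp flip: of_nat_sum)
  finally have "(D * card S) * ?e \<le> (2 * card U) * ?e" using u by (simp add: field_simps)
  then show ?thesis using assms(2) unfolding S_def by (simp only: mult_le_cancel_right_pos of_nat_0_less_iff)
qed

lemma card_edges_meeting_le_half:
  fixes \<epsilon> :: real
  assumes \<epsilon>: "0 < \<epsilon>" and U: "finite U" "S \<subseteq> U" "S \<noteq> {}"
    and dens: "\<And>T. T \<subseteq> U \<Longrightarrow> card (induced T) \<le> card (induced U) / card U powr (1 + \<epsilon>) * card T powr (1 + \<epsilon>)"
    and S: "2 * 8 powr (1 / \<epsilon>) * card S \<le> card U"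
  shows "card {e \<in> induced U. e \<inter> S \<noteq> {}} \<le> card (induced U) / 2"
proof -
  define u where "u = real (card U)"
  define s where "s = real (card S)"
  define f where "f = card (induced U) / u powr (1 + \<epsilon>)"
  have s: "0 < s" using U by (simp add: s_def card_gt_0_iff finite_subset)
  have u: "0 < u" using U by (auto simp: u_def card_gt_0_iff)
  have f: "0 \<le> f" by (simp add: f_def)
  have "(2 * s) powr \<epsilon> \<le> (u / 8 powr (1 / \<epsilon>)) powr \<epsilon>"
    using S s \<epsilon> by (intro powr_mono2) (auto simp: s_def u_def field_simps)
  also have "\<dots> = u powr \<epsilon> / 8" using u \<epsilon> by (simp add: powr_divide powr_powr)
  finally have s_powr: "(2 * s) powr \<epsilon> \<le> u powr \<epsilon> / 8" .
  have "card {e \<in> induced U. e \<inter> S \<noteq> {}} \<le> 2 * card U / card S * (f * (2 * s) powr (1 + \<epsilon>))"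
  proof (rule card_edges_meeting_le[OF U])
    fix T assume T: "T \<subseteq> U" "card T \<le> 2 * card S"
    have "card (induced T) \<le> f * card T powr (1 + \<epsilon>)" using dens[OF T(1)] by (simp add: f_def u_def)
    also have "\<dots> \<le> f * (2 * s) powr (1 + \<epsilon>)"
      using T(2) f \<epsilon> by (intro mult_left_mono powr_mono2) (auto simp: s_def)
    finally show "card (induced T) \<le> f * (2 * s) powr (1 + \<epsilon>)" .
  qed
  also have "\<dots> = f * u * (4 * (2 * s) powr \<epsilon>)"
    using s by (simp add: powr_add flip: u_def s_def)
  also have "\<dots> \<le> f * u * (4 * (u powr \<epsilon> / 8))"
    using s_powr f u by (intro mult_left_mono) auto
  also have "\<dots> = card (induced U) / 2" using u by (simp add: f_def powr_add)
  finally show ?thesis .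
qed

text \<open>In a densest induced subgraph few edges meet the small set of vertices of large degree, so that these
  can be deleted.\<close>

lemma almost_regular_subgraph:
  fixes \<epsilon> :: real
  assumes \<epsilon>: "0 < \<epsilon>" and V: "finite V" and E: "\<And>e. e \<in> E \<Longrightarrow> e \<subseteq> V" "E \<noteq> {}"
  obtains U W where "U \<subseteq> V" "W \<subseteq> U" "W \<noteq> {}" "0 < card (induced U)"
    "card E / card V powr (1 + \<epsilon>) \<le> card (induced U) / card U powr (1 + \<epsilon>)"
    "\<And>w. w \<in> W \<Longrightarrow> card (induced U) / (4 * card U) \<le> degree_in W w"
    "\<And>w. w \<in> W \<Longrightarrow> degree_in W w \<le> 4 * 8 powr (1 / \<epsilon>) * card (induced U) / card U"
proof -
  obtain U where U: "U \<subseteq> V" "0 < card (induced U)"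
    and density: "card E / card V powr (1 + \<epsilon>) \<le> card (induced U) / card U powr (1 + \<epsilon>)"
    "\<And>T. T \<subseteq> U \<Longrightarrow> card (induced T) \<le> card (induced U) / card U powr (1 + \<epsilon>) * card T powr (1 + \<epsilon>)"
    using exists_densest_subset[OF V E] by blast
  have "finite U" using U(1) V finite_subset by blast
  have "U \<noteq> {}" using U(2) by (auto simp: induced_empty)
  then have u: "0 < real (card U)" using \<open>finite U\<close> by (simp add: card_gt_0_iff)
  define D where "D = 4 * 8 powr (1 / \<epsilon>)"
  define S where "S = {w \<in> U. D * card (induced U) / card U < degree_in U w}"
  have "card {e \<in> induced U. e \<inter> S \<noteq> {}} \<le> card (induced U) / 2"
  proof (cases "S = {}")
    case False
    have "2 * 8 powr (1 / \<epsilon>) * card S \<le> card U"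
      using card_high_degree_le[OF \<open>finite U\<close> U(2), of D] by (simp add: S_def D_def)
    then show ?thesis
      using False density(2) by (intro card_edges_meeting_le_half[OF \<epsilon> \<open>finite U\<close>]) (auto simp: S_def)
  qed simp
  moreover have "induced U = induced (U - S) \<union> {e \<in> induced U. e \<inter> S \<noteq> {}}" by (auto simp: induced_def)
  then have "card (induced U) \<le> card (induced (U - S)) + card {e \<in> induced U. e \<inter> S \<noteq> {}}"
    by (metis card_Un_le)
  ultimately have rest: "card (induced U) / 2 \<le> card (induced (U - S))" by linarith
  have "card (induced U) / (4 * card U) * card (U - S) \<le> card (induced U) / (4 * card U) * card U"
    using \<open>finite U\<close> by (intro mult_left_mono) (auto simp: card_mono)
  also have "\<dots> = card (induced U) / 4" using u by simp
  also have "\<dots> < card (induced (U - S))" using rest U(2) by linarith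
  finally obtain W where W: "W \<subseteq> U - S" "W \<noteq> {}"
    "\<And>w. w \<in> W \<Longrightarrow> card (induced U) / (4 * card U) \<le> degree_in W w"
    using exists_min_degree_subset[of "U - S" "card (induced U) / (4 * card U)"] \<open>finite U\<close> by auto
  have "degree_in W w \<le> D * card (induced U) / card U" if "w \<in> W" for w
  proof -
    have "degree_in U w \<le> D * card (induced U) / card U" using that W(1) by (auto simp: S_def)
    then show ?thesis
      using degree_in_mono[OF \<open>finite U\<close>, of W w] W(1) by (meson Diff_subset of_nat_le_iff order_trans)
  qed
  then show thesis using that[OF U(1) _ W(2) U(2) density(1) W(3)] W(1) unfolding D_def by blast
qed

end

section \<open>The upper bound\<close>

lemma has_wheel_contains_copy:
  assumes k: "3 \<le> k" and G: "finite_simple_graph G"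
    and adj: "\<And>x y. adj x y \<Longrightarrow> {x, y} \<in> edges G" and "has_wheel adj k"
  shows "contains_copy G (subdivision1 (wheel k))"
proof -
  obtain v a p b where "\<forall>i<k. adj v (p i) \<and> adj (p i) (a i) \<and> adj (a i) (b i) \<and> adj (b i) (a (Suc i mod k))"
    and dist: "distinct (v # map a [0..<k] @ map p [0..<k] @ map b [0..<k])"
    using \<open>has_wheel adj k\<close> unfolding has_wheel_def by blast
  then show ?thesis using adj by (intro contains_subdivided_wheel[OF k _ dist G]) blast
qed

lemma density_le_of_cube_le:
  fixes e u C :: real
  assumes "0 \<le> e" "0 < u" "(e / (4 * u)) ^ 3 \<le> C * u"
  shows "e / u powr (4 / 3) \<le> (64 * C) powr (1 / 3)"
proof -
  have "e ^ 3 \<le> 64 * C * u ^ 4"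
    using assms(2,3) by (simp add: power_divide power_mult_distrib field_simps eval_nat_numeral)
  then have "(e powr 3) powr (1 / 3) \<le> (64 * C * u powr 4) powr (1 / 3)"
    using assms(1,2) by (intro powr_mono2) auto
  also have "(e powr 3) powr (1 / 3) = e" using assms(1) by (subst powr_powr) simp
  also have "(64 * C * u powr 4) powr (1 / 3) = (64 * C) powr (1 / 3) * (u powr 4) powr (1 / 3)"
    by (rule powr_mult)
  also have "(u powr 4) powr (1 / 3) = u powr (4 / 3)" by (subst powr_powr) simp
  finally show ?thesis using assms(2) by (simp add: pos_divide_le_eq)
qed

lemma subdivided_wheel_free_density:
  fixes G :: "'a graph"
  assumes k: "4 \<le> k" and G: "finite_simple_graph G" "\<not> contains_copy G (subdivision1 (wheel k))"
    and ne: "edges G \<noteq> {}"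
  shows "card (edges G) / card (verts G) powr (4 / 3) \<le> (64 * wheel_const k 8192) powr (1 / 3)"
proof -
  have V: "finite (verts G)" and E: "\<And>e. e \<in> edges G \<Longrightarrow> e \<subseteq> verts G" "\<And>e. e \<in> edges G \<Longrightarrow> card e = 2"
    using G(1) by (auto simp: finite_simple_graph_def)
  interpret edge_set "edges G" using E(2) by unfold_locales
  obtain U W where UW: "U \<subseteq> verts G" "W \<subseteq> U" "W \<noteq> {}" "0 < card (induced U)"
    and density: "card (edges G) / card (verts G) powr (4 / 3) \<le> card (induced U) / card U powr (4 / 3)"
    and low: "\<And>w. w \<in> W \<Longrightarrow> card (induced U) / (4 * card U) \<le> degree_in W w"
    and high: "\<And>w. w \<in> W \<Longrightarrow> degree_in W w \<le> 2048 * card (induced U) / card U"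
    using almost_regular_subgraph[OF _ V E(1) ne, of "1 / 3"] by auto
  define x where "x = card (induced U) / (4 * card U)"
  have finU: "finite U" using UW(1) V finite_subset by blast
  then have u: "0 < card U" using UW(2,3) by (auto simp: card_gt_0_iff)
  define adj where "adj y z \<longleftrightarrow> y \<in> W \<and> z \<in> W \<and> {y, z} \<in> edges G" for y z
  have deg: "x \<le> card {z. adj w z} \<and> card {z. adj w z} \<le> 8192 * x" if "w \<in> W" for w
  proof -
    have "card {z. adj w z} = degree_in W w" using that by (simp add: adj_def degree_in_def)
    then show ?thesis using low[OF that] high[OF that] by (simp add: x_def)
  qed
  interpret W: simple_graph adj W
  proof
    show "finite W" using UW(2) finU finite_subset by blast
    show "\<not> adj y y" for y using E(2)[of "{y, y}"] by (auto simp: adj_def)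
  qed (auto simp: adj_def insert_commute)
  have no_wheel: "\<not> has_wheel adj k"
    using has_wheel_contains_copy[OF _ G(1), of k adj] G(2) k by (auto simp: adj_def)
  have "x ^ 3 \<le> wheel_const k 8192 * card W"
    by (rule W.wheel_free_degree_cubed_le[OF no_wheel k UW(3) deg]) (simp_all add: x_def)
  also have "\<dots> \<le> wheel_const k 8192 * card U"
    using UW(2) finU by (intro mult_left_mono) (auto simp: card_mono wheel_const_def)
  finally have "card (induced U) / card U powr (4 / 3) \<le> (64 * wheel_const k 8192) powr (1 / 3)"
    using u by (intro density_le_of_cube_le) (simp_all add: x_def)
  then show ?thesis using density by linarith
qed

lemma card_edges_subdivided_wheel_free:
  assumes k: "4 \<le> k" and G: "finite_simple_graph G" "\<not> contains_copy G (subdivision1 (wheel k))"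
  shows "card (edges G) \<le> (64 * wheel_const k 8192) powr (1 / 3) * card (verts G) powr (4 / 3)"
proof (cases "edges G = {}")
  case False
  then have "0 < card (verts G)"
    using G(1) by (fastforce simp: finite_simple_graph_def card_gt_0_iff)
  then show ?thesis
    using subdivided_wheel_free_density[OF k G False] by (simp add: pos_divide_le_eq)
qed simp

lemma ex_subdivided_wheel_le:
  assumes "4 \<le> k"
  shows "ex n (subdivision1 (wheel k)) \<le> (64 * wheel_const k 8192) powr (1 / 3) * real n powr (4 / 3)"
proof -
  have "finite_simple_graph (subdivision1 (wheel k))" "edges (subdivision1 (wheel k)) \<noteq> {}"
    using assms by (simp_all add: finite_simple_graph_subdivided_wheel edges_subdivided_wheel_nonempty)
  then obtain G :: "nat graph" where "finite_simple_graph G" "card (verts G) = n"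
    "\<not> contains_copy G (subdivision1 (wheel k))" "card (edges G) = ex n (subdivision1 (wheel k))"
    by (rule ex_attained)
  then show ?thesis using card_edges_subdivided_wheel_free[OF assms, of G] by simp
qed

section \<open>The lower bound\<close>

lemma card_roots_separable:
  fixes p :: "'a :: alg_closed_field poly"
  assumes p: "p \<noteq> 0" and separable: "\<And>x. poly p x = 0 \<Longrightarrow> poly (pderiv p) x \<noteq> 0"
  shows "card {x. poly p x = 0} = degree p"
proof -
  obtain A where A: "size A = degree p" "p = smult (lead_coeff p) (\<Prod>x\<in>#A. [:-x, 1:])"
    using alg_closed_imp_factorization[OF p] by blast
  have "proots (\<Prod>x\<in>#A. [:-x, 1:]) = A"
    by (induction A) (simp_all add: proots_mult prod_mset_zero_iff image_iff del: mult_pCons_left)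
  then have roots: "proots p = A"
    by (subst A(2)) (simp add: p)
  have simple: "order x p = 1" if "poly p x = 0" for x
  proof (rule ccontr)
    assume "order x p \<noteq> 1"
    then have "2 \<le> order x p" using that p order_root[of p x] by (cases "order x p") auto
    then have "[:-x, 1:]\<^sup>2 dvd p" using p by (simp add: order_divides)
    then obtain r where "p = [:-x, 1:]\<^sup>2 * r" by (elim dvdE)
    then have "p = [:-x, 1:] * ([:-x, 1:] * r)" by (simp only: power2_eq_square mult.assoc)
    then have "poly (pderiv p) x = 0" by (simp only: pderiv_mult poly_add poly_mult) simp
    then show False using separable[OF that] by blast
  qed
  have "degree p = (\<Sum>x | poly p x = 0. order x p)"
    using A(1) p by (simp add: size_multiset_overloaded_eq flip: roots)
  also have "\<dots> = card {x. poly p x = 0}" using simple by simp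
  finally show ?thesis by simp
qed

lemma card_power_fixed_points:
  fixes q :: nat
  assumes "1 < q" "of_nat q = (0 :: 'a :: alg_closed_field)"
  shows "card {x :: 'a. x ^ q = x} = q"
proof -
  define p :: "'a poly" where "p = monom 1 q - monom 1 1"
  have degree: "degree p = q"
    unfolding p_def using assms(1)
    by (subst diff_conv_add_uminus, subst degree_add_eq_left) (auto simp: degree_monom_eq)
  then have "p \<noteq> 0" using assms(1) by auto
  moreover have "poly (pderiv p) x = - 1" for x
    using assms(2) by (simp add: p_def pderiv_diff pderiv_monom poly_monom)
  ultimately have "card {x. poly p x = 0} = q"
    using card_roots_separable[of p] degree by simp
  then show ?thesis by (simp add: p_def poly_monom)
qed

definition GF2 :: "nat \<Rightarrow> bit alg_closure set" where
  "GF2 m = {x. x ^ (2 ^ m) = x}"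

lemma CHAR_bit [simp]: "CHAR(bit) = 2"
proof -
  have "CHAR(bit) dvd 2" using of_nat_eq_0_iff_char_dvd[where 'a = bit, of 2] by simp
  then show ?thesis using two_is_prime_nat by (auto simp: prime_nat_iff)
qed

lemma card_GF2:
  assumes "0 < m" shows "card (GF2 m) = 2 ^ m"
proof -
  have "of_nat (2 ^ m) = (0 :: bit alg_closure)"
    unfolding of_nat_eq_0_iff_char_dvd using assms by simp
  then show ?thesis
    unfolding GF2_def using assms by (intro card_power_fixed_points one_less_power) auto
qed

lemma GF2_diff:
  assumes "x \<in> GF2 m" "y \<in> GF2 m" shows "x - y \<in> GF2 m"
proof -
  have "(x - y + y) ^ 2 ^ m = (x - y) ^ 2 ^ m + y ^ 2 ^ m"
    by (rule freshmans_dream'[where n = m]) simp_all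
  then show ?thesis using assms by (simp add: GF2_def eq_diff_eq)
qed

lemma GF2_mult: "x \<in> GF2 m \<Longrightarrow> y \<in> GF2 m \<Longrightarrow> x * y \<in> GF2 m"
  by (simp add: GF2_def power_mult_distrib)

type_synonym 'a triple = "'a \<times> 'a \<times> 'a"

definition incident :: "'a :: comm_ring triple \<Rightarrow> 'a triple \<Rightarrow> bool" where
  "incident = (\<lambda>(a, b, c) (x, y, z). b + y = a * x \<and> c + z = a * y)"

lemma incident_no_hexagon:
  fixes P1 P2 P3 L1 L2 L3 :: "'a :: idom triple"
  assumes inc: "incident P1 L1" "incident P2 L1" "incident P2 L2" "incident P3 L2"
      "incident P3 L3" "incident P1 L3"
    and P: "P1 \<noteq> P2" "P2 \<noteq> P3" "P1 \<noteq> P3" and L: "L2 \<noteq> L3"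
  shows False
proof -
  obtain a1 b1 c1 a2 b2 c2 a3 b3 c3 x1 y1 z1 x2 y2 z2 x3 y3 z3 where eqs:
    "P1 = (a1, b1, c1)" "P2 = (a2, b2, c2)" "P3 = (a3, b3, c3)"
    "L1 = (x1, y1, z1)" "L2 = (x2, y2, z2)" "L3 = (x3, y3, z3)"
    by (metis prod.exhaust)
  have pts: "b1 = a1 * x1 - y1" "c1 = a1 * y1 - z1" "b2 = a2 * x1 - y1" "c2 = a2 * y1 - z1"
    "b2 = a2 * x2 - y2" "c2 = a2 * y2 - z2" "b3 = a3 * x2 - y2" "c3 = a3 * y2 - z2"
    "b3 = a3 * x3 - y3" "c3 = a3 * y3 - z3" "b1 = a1 * x3 - y3" "c1 = a1 * y3 - z3"
    using inc unfolding eqs incident_def by (auto simp: eq_diff_eq)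
  have distinct: "a1 \<noteq> a2" "a2 \<noteq> a3" "a1 \<noteq> a3"
    using P pts unfolding eqs by auto
  have y: "y1 - y2 = a2 * (x1 - x2)" "y2 - y3 = a3 * (x2 - x3)" "y1 - y3 = a1 * (x1 - x3)"
    and z: "z1 - z2 = a2 * (y1 - y2)" "z2 - z3 = a3 * (y2 - y3)" "z1 - z3 = a1 * (y1 - y3)"
    using pts by (auto simp: algebra_simps)
  have moment1: "a2 * (x1 - x2) + a3 * (x2 - x3) = a1 * (x1 - x3)"
    unfolding y[symmetric] by simp
  have moment2: "a2 * (a2 * (x1 - x2)) + a3 * (a3 * (x2 - x3)) = a1 * (a1 * (x1 - x3))"
    unfolding y[symmetric] z[symmetric] by simp
  have "(a3 - a1) * (a3 - a2) * (x2 - x3) =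
      (a2 * (a2 * (x1 - x2)) + a3 * (a3 * (x2 - x3)) - a1 * (a1 * (x1 - x3)))
      - (a1 + a2) * (a2 * (x1 - x2) + a3 * (x2 - x3) - a1 * (x1 - x3))"
    by (simp add: algebra_simps)
  also have "\<dots> = 0" unfolding moment1 moment2 by simp
  finally have "x2 = x3" using distinct by simp
  then show False using pts L unfolding eqs by auto
qed

definition wenger_graph :: "'a :: comm_ring set \<Rightarrow> ('a triple + 'a triple) graph" where
  "wenger_graph K = (Inl ` (K \<times> K \<times> K) \<union> Inr ` (K \<times> K \<times> K),
     {{Inl P, Inr L} | P L. P \<in> K \<times> K \<times> K \<and> L \<in> K \<times> K \<times> K \<and> incident P L})"

lemma finite_simple_graph_wenger_graph: "finite K \<Longrightarrow> finite_simple_graph (wenger_graph K)"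
  by (auto simp: finite_simple_graph_def wenger_graph_def)

lemma card_verts_wenger_graph: "finite K \<Longrightarrow> card (verts (wenger_graph K)) = 2 * card K ^ 3"
  by (simp add: wenger_graph_def card_Plus card_cartesian_product power3_eq_cube flip: Plus_def)

lemma card_edges_wenger_graph:
  assumes K: "\<And>x y. x \<in> K \<Longrightarrow> y \<in> K \<Longrightarrow> x - y \<in> K" "\<And>x y. x \<in> K \<Longrightarrow> y \<in> K \<Longrightarrow> x * y \<in> K"
  shows "card (edges (wenger_graph K)) = card K ^ 4"
proof -
  define line_edge where "line_edge = (\<lambda>(a :: 'a, x, y, z). {Inl (a, a * x - y, a * y - z), Inr (x, y, z)})"
  have "inj_on line_edge (K \<times> K \<times> K \<times> K)" by (auto simp: inj_on_def line_edge_def doubleton_eq_iff)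
  then have "card (line_edge ` (K \<times> K \<times> K \<times> K)) = card K ^ 4"
    by (simp add: card_image card_cartesian_product power4_eq_xxxx)
  also have "line_edge ` (K \<times> K \<times> K \<times> K) = edges (wenger_graph K)"
  proof (intro equalityI subsetI)
    fix e assume "e \<in> line_edge ` (K \<times> K \<times> K \<times> K)"
    then obtain a x y z where e: "a \<in> K" "x \<in> K" "y \<in> K" "z \<in> K" "e = line_edge (a, x, y, z)"
      by auto
    have "incident (a, a * x - y, a * y - z) (x, y, z)" by (simp add: incident_def)
    moreover have "(a, a * x - y, a * y - z) \<in> K \<times> K \<times> K" "(x, y, z) \<in> K \<times> K \<times> K"
      using e K by auto
    ultimately show "e \<in> edges (wenger_graph K)"
      unfolding wenger_graph_def e(5) line_edge_def snd_conv prod.case by blast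
  next
    fix e assume "e \<in> edges (wenger_graph K)"
    then obtain a b c x y z where e: "e = {Inl (a, b, c), Inr (x, y, z)}" "incident (a, b, c) (x, y, z)"
      "a \<in> K" "x \<in> K" "y \<in> K" "z \<in> K" by (auto simp: wenger_graph_def)
    have "b = a * x - y" "c = a * y - z" using e(2) by (simp_all add: incident_def eq_diff_eq)
    then have "e = line_edge (a, x, y, z)" using e(1) by (simp add: line_edge_def)
    then show "e \<in> line_edge ` (K \<times> K \<times> K \<times> K)" using e by auto
  qed
  finally show ?thesis .
qed

lemma wenger_graph_no_hexagon_at_point:
  fixes K :: "'a :: idom set"
  assumes "\<And>i. i < 6 \<Longrightarrow> {w i, w (Suc i mod 6)} \<in> edges (wenger_graph K)" and "inj_on w {..<6}"
    and "w 0 = Inl P"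
  shows False
proof -
  have point_line: "\<exists>L. y = Inr L \<and> incident P L" if "{Inl P, y} \<in> edges (wenger_graph K)" for P y
    using that by (auto simp: wenger_graph_def doubleton_eq_iff)
  have line_point: "\<exists>P. y = Inl P \<and> incident P L" if "{Inr L, y} \<in> edges (wenger_graph K)" for L y
    using that by (auto simp: wenger_graph_def doubleton_eq_iff)
  have e: "{w 0, w 1} \<in> edges (wenger_graph K)" "{w 1, w 2} \<in> edges (wenger_graph K)"
    "{w 2, w 3} \<in> edges (wenger_graph K)" "{w 3, w 4} \<in> edges (wenger_graph K)"
    "{w 4, w 5} \<in> edges (wenger_graph K)" "{w 5, w 0} \<in> edges (wenger_graph K)"
    using assms(1)[of 0] assms(1)[of 1] assms(1)[of 2] assms(1)[of 3] assms(1)[of 4] assms(1)[of 5]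
    by (simp_all flip: numeral_2_eq_2)
  obtain L1 where L1: "w 1 = Inr L1" "incident P L1" using point_line e(1) assms(3) by metis
  obtain P2 where P2: "w 2 = Inl P2" "incident P2 L1" using line_point e(2) L1(1) by metis
  obtain L2 where L2: "w 3 = Inr L2" "incident P2 L2" using point_line e(3) P2(1) by metis
  obtain P3 where P3: "w 4 = Inl P3" "incident P3 L2" using line_point e(4) L2(1) by metis
  obtain L3 where L3: "w 5 = Inr L3" "incident P3 L3" using point_line e(5) P3(1) by metis
  have "incident P L3" using line_point e(6) L3(1) assms(3) by (metis sum.inject(1))
  moreover have "w 0 \<noteq> w 2" "w 2 \<noteq> w 4" "w 0 \<noteq> w 4" "w 3 \<noteq> w 5"
    using assms(2) by (simp_all add: inj_on_eq_iff)
  ultimately show False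
    using incident_no_hexagon[of P L1 P2 L2 P3 L3] assms(3) L1 P2 L2 P3 L3 by auto
qed

lemma wenger_graph_hexagon_free:
  fixes K :: "'a :: idom set"
  shows "\<not> contains_copy (wenger_graph K) (cycle_graph 6)"
proof
  assume "contains_copy (wenger_graph K) (cycle_graph 6)"
  then obtain w where "embedding w (cycle_graph 6) (wenger_graph K)"
    by (auto simp: contains_copy_iff_embedding finite_simple_graph_cycle_graph)
  then have inj: "inj_on w {..<6}" and edge: "\<And>i. i < 6 \<Longrightarrow> {w i, w (Suc i mod 6)} \<in> edges (wenger_graph K)"
    unfolding embedding_cycle_graph_iff by blast+
  define w' where "w' i = w (Suc i mod 6)" for i
  have inj': "inj_on w' {..<6}"
  proof (rule inj_onI)
    fix i j assume ij: "i \<in> {..<6}" "j \<in> {..<6}" "w' i = w' j"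
    then have "Suc i mod 6 = Suc j mod 6" using inj by (simp add: w'_def inj_on_eq_iff)
    then show "i = j" using ij(1,2) by (simp add: mod_Suc split: if_splits)
  qed
  have edge': "{w' i, w' (Suc i mod 6)} \<in> edges (wenger_graph K)" for i
    using edge[of "Suc i mod 6"] by (simp add: w'_def)
  have "(\<exists>P. w 0 = Inl P) \<or> (\<exists>P. w' 0 = Inl P)"
    using edge[of 0] by (auto simp: w'_def wenger_graph_def doubleton_eq_iff)
  then show False
    using wenger_graph_no_hexagon_at_point[OF edge inj] wenger_graph_no_hexagon_at_point[OF edge' inj'] by blast
qed

lemma subdivided_wheel_contains_hexagon:
  assumes k: "3 \<le> k"
  shows "contains_copy (subdivision1 (wheel k)) (cycle_graph 6)"
proof -
  define ws :: "(nat option + nat option set) list" where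
    "ws = [Inl None, Inr (spoke 0), Inl (Some 0), Inr (rim k 0), Inl (Some 1), Inr (spoke 1)]"
  have "distinct ws" "length ws = 6" by (auto simp: ws_def spoke_def rim_def)
  then have inj: "inj_on (nth ws) {..<6}" by (intro inj_on_nth) auto
  have "set ws \<subseteq> verts (subdivision1 (wheel k))"
    using k by (auto simp: ws_def subdivision1_def verts_wheel edges_wheel)
  then have verts: "nth ws ` {..<6} \<subseteq> verts (subdivision1 (wheel k))"
    using \<open>length ws = 6\<close> nth_mem[of _ ws] by auto
  have edge: "{Inl x, Inr e} \<in> edges (subdivision1 (wheel k))" "{Inr e, Inl x} \<in> edges (subdivision1 (wheel k))"
    if "e \<in> {spoke 0, spoke 1, rim k 0}" "x \<in> e" for x e
  proof -
    have "e \<in> edges (wheel k)" using that k by (auto simp: edges_wheel)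
    then show "{Inl x, Inr e} \<in> edges (subdivision1 (wheel k))"
      using that(2) by (rule edges_subdivision1I)
    then show "{Inr e, Inl x} \<in> edges (subdivision1 (wheel k))" by (simp add: insert_commute)
  qed
  have "{Inl None, Inr (spoke 0)} \<in> edges (subdivision1 (wheel k))"
    "{Inr (spoke 0), Inl (Some 0)} \<in> edges (subdivision1 (wheel k))"
    "{Inl (Some 0), Inr (rim k 0)} \<in> edges (subdivision1 (wheel k))"
    "{Inr (rim k 0), Inl (Some 1)} \<in> edges (subdivision1 (wheel k))"
    "{Inl (Some 1), Inr (spoke 1)} \<in> edges (subdivision1 (wheel k))"
    "{Inr (spoke 1), Inl None} \<in> edges (subdivision1 (wheel k))"
    using k by (intro edge; simp add: spoke_def rim_def)+
  then have "\<forall>i \<in> {0, 1, 2, 3, 4, 5}. {ws ! i, ws ! (Suc i mod 6)} \<in> edges (subdivision1 (wheel k))"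
    unfolding ws_def by simp
  moreover have "i \<in> {0, 1, 2, 3, 4, 5}" if "i < 6" for i :: nat using that by auto
  ultimately have "embedding (nth ws) (cycle_graph 6) (subdivision1 (wheel k))"
    using inj verts unfolding embedding_cycle_graph_iff by meson
  then show ?thesis by (auto simp: contains_copy_iff_embedding finite_simple_graph_cycle_graph)
qed

lemma ex_hexagon_ge:
  assumes "0 < m" "2 * (2 ^ m) ^ 3 \<le> n"
  shows "(2 ^ m) ^ 4 \<le> ex n (cycle_graph 6)"
proof -
  have "finite (GF2 m)" using card_GF2[OF assms(1)] by (intro card_ge_0_finite) simp
  have "card (edges (wenger_graph (GF2 m))) \<le> ex n (cycle_graph 6)"
  proof (rule card_edges_le_ex)
    show "finite_simple_graph (wenger_graph (GF2 m))"
      using \<open>finite (GF2 m)\<close> by (rule finite_simple_graph_wenger_graph)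
    show "card (verts (wenger_graph (GF2 m))) \<le> n"
      using assms by (simp add: card_verts_wenger_graph \<open>finite (GF2 m)\<close> card_GF2)
    show "\<Union> (edges (cycle_graph 6)) = verts (cycle_graph 6)"
      by (auto simp: edges_cycle_graph) (auto simp: cycle_graph_def)
  qed (auto simp: wenger_graph_hexagon_free finite_simple_graph_cycle_graph)
  then show ?thesis
    using assms(1) by (simp add: card_edges_wenger_graph GF2_diff GF2_mult card_GF2)
qed

lemma ex_hexagon_lower_bound:
  assumes "16 \<le> n"
  shows "(real n / 16) powr (4 / 3) \<le> ex n (cycle_graph 6)"
proof -
  have "1 \<le> n div 2" using assms by simp
  then obtain m where m: "8 ^ m \<le> n div 2" "n div 2 < 8 ^ (m + 1)"
    using ex_power_ivl1[of 8 "n div 2"] by auto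
  have "0 < m" using m(2) assms by (cases m) auto
  have eight: "((2 :: nat) ^ m) ^ 3 = 8 ^ m" by (simp add: power_mult[symmetric] mult.commute[of m] power_mult)
  have "n < 16 * 8 ^ m" using m(2) by simp
  then have "real n \<le> real (16 * (2 ^ m) ^ 3)" unfolding eight by (simp only: of_nat_le_iff)
  then have "(real n / 16) powr (4 / 3) \<le> ((2 ^ m) ^ 3) powr (4 / 3)" by (intro powr_mono2) auto
  also have "((2 ^ m) ^ 3 :: real) powr (4 / 3) = ((2 ^ m) powr 3) powr (4 / 3)" by simp
  also have "\<dots> = (2 ^ m) powr 4" by (subst powr_powr) simp
  also have "\<dots> = real ((2 ^ m) ^ 4)" by simp
  also have "\<dots> \<le> ex n (cycle_graph 6)"
    unfolding of_nat_le_iff using m(1) eight by (intro ex_hexagon_ge \<open>0 < m\<close>) simp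
  finally show ?thesis .
qed

lemma ex_subdivided_wheel_ge:
  assumes "3 \<le> k" "16 \<le> n"
  shows "(1 / 16) powr (4 / 3) * real n powr (4 / 3) \<le> ex n (subdivision1 (wheel k))"
proof -
  have "(1 / 16) powr (4 / 3) * real n powr (4 / 3) = (real n / 16) powr (4 / 3)"
    by (simp flip: powr_mult)
  also have "\<dots> \<le> ex n (cycle_graph 6)" using assms(2) by (rule ex_hexagon_lower_bound)
  also have "ex n (cycle_graph 6) \<le> ex n (subdivision1 (wheel k))"
  proof (rule ex_mono)
    show "edges (cycle_graph 6) \<noteq> {}" by (simp add: edges_cycle_graph lessThan_empty_iff)
  qed (use assms(1) in \<open>simp_all add: finite_simple_graph_cycle_graph finite_simple_graph_subdivided_wheel
    edges_subdivided_wheel_nonempty subdivided_wheel_contains_hexagon\<close>)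
  finally show ?thesis by simp
qed

theorem theorem1p3:
  fixes k :: nat
  assumes "k \<ge> 4"
  shows "\<exists>c C :: real. 0 < c \<and> 0 < C \<and>
    (\<forall>\<^sub>F n in sequentially.
       c * real n powr (4 / 3) \<le> real (ex n (subdivision1 (add_apex (cycle_graph k)))) \<and>
       real (ex n (subdivision1 (add_apex (cycle_graph k)))) \<le> C * real n powr (4 / 3))"
proof (intro exI conjI)
  let ?C = "(64 * wheel_const k 8192) powr (1 / 3)"
  show "\<forall>\<^sub>F n in sequentially.
      (1 / 16) powr (4 / 3) * real n powr (4 / 3) \<le> real (ex n (subdivision1 (wheel k))) \<and>
      real (ex n (subdivision1 (wheel k))) \<le> ?C * real n powr (4 / 3)"
    using eventually_ge_at_top[of 16]
  proof eventually_elim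
    case (elim n)
    then show ?case using ex_subdivided_wheel_ge[of k n] ex_subdivided_wheel_le[OF assms, of n] assms by simp
  qed
  show "0 < ?C" by (simp add: wheel_const_def)
qed simp

end
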